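(* Let $K$ be a field and let $\{\mathcal S_\epsilon\}_{\epsilon\in\mathbf Q}$ be a noise system in $\mathrm{Tame}(\mathbf Q,\mathrm{Vect}_K)$ whose components are closed under direct sums (that is, for every $\epsilon$, if $G,H\in\mathcal S_\epsilon$ then $G\oplus H\in\mathcal S_\epsilon$). Let $F\colon\mathbf Q\to\mathrm{Vect}_K$ be a compact and tame functor, written up to isomorphism as a finite direct sum $$F\cong\bigoplus_{i\in I}[w_i,u_i)\oplus\bigoplus_{j\in J}K(v_j,-).$$ For a positive $t\in\mathbf Q$ put $$I_t:=\{i\in I\mid [w_i,u_i)\notin\mathcal S_\epsilon\text{ for any }\epsilon<t\},\qquad J_t:=\{j\in J\mid K(v_j,-)\notin\mathcal S_\epsilon\text{ for any }\epsilon<t\}.$$ Then $\mathrm{bar}(F)_t=|I_t|+|J_t|$.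
   Context: $\mathbf Q$ denotes the poset of non-negative rational numbers regarded as a category, $\mathbf N\subset\mathbf Q$ the natural numbers (including $0$), $\mathrm{Vect}_K$ the category of $K$-vector spaces. Tameness: for a positive rational $\alpha$ and $v\in\mathbf Q$ let $b_\alpha v$ be the largest $w\in\mathbf N$ with $\alpha w\le v$. For $F\colon\mathbf N\to\mathrm{Vect}_K$ let $\alpha^!F\colon\mathbf Q\to\mathrm{Vect}_K$ be $v\mapsto F(b_\alpha v)$, $(v\le u)\mapsto F(b_\alpha v\le b_\alpha u)$. A functor $\mathbf Q\to\mathrm{Vect}_K$ is tame if it is isomorphic to some $\alpha^!F$ for some positive rational $\alpha$. $\mathrm{Tame}(\mathbf Q,\mathrm{Vect}_K)$ is the full subcategory of tame functors in $\mathrm{Fun}(\mathbf Q,\mathrm{Vect}_K)$. Compact: an object $A$ of an abelian category is compact if for every sequence of subobjects $A_1\subset A_2\subset\cdots\subset A$ with $\mathrm{colim}\,A_i=A$ there is $k$ with $A_k=A$. A "compact and tame functor" is a tame functor which is compact in $\mathrm{Fun}(\mathbf Q,\mathrm{Vect}_K)$. $K(v,-)\colon\mathbf Q\to\mathrm{Vect}_K$ is the functor with value $K$ at $w\ge v$ and $0$ otherwise, with identity maps between non-zero values. For $w\le u$, $[w,u)$ is the cokernel of the unique inclusion $K(u,-)\subset K(w,-)$. Every compact and tame functor $\mathbf Q\to\mathrm{Vect}_K$ is isomorphic to a finite direct sum of functors $[w,u)$ and $K(v,-)$. Rank: free functors are those of the form $\bigoplus_v K(v,-)\otimes V_v$ with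 $V_v$ vector spaces; such a functor has finite rank if $\sum_v\dim V_v<\infty$, and this sum is its rank. A minimal cover of $G$ is an epimorphism $\phi\colon P\to G$ with $P$ free such that every $f\colon P\to P$ with $\phi f=\phi$ is an isomorphism. $G$ has finite rank if it has a minimal cover $P\to G$ with $P$ of finite rank, and $\mathrm{rank}(G):=\mathrm{rank}(P)$. Minima of ranks below are over the functors of finite rank in the given collection. A noise system in $\mathrm{Tame}(\mathbf Q,\mathrm{Vect}_K)$ is a collection $\{\mathcal S_\epsilon\}_{\epsilon\in\mathbf Q}$ of sets of tame functors such that: the zero functor is in $\mathcal S_\epsilon$ for all $\epsilon$; if $0\le\tau<\epsilon$ then $\mathcal S_\tau\subseteq\mathcal S_\epsilon$; and for every exact sequence $0\to F\to G\to H\to0$ of tame functors, (i) if $G\in\mathcal S_\epsilon$ then $F,H\in\mathcal S_\epsilon$, and (ii) if $F\in\mathcal S_\epsilon$ and $H\in\mathcal S_\tau$ then $G\in\mathcal S_{\epsilon+\tau}$. A natural transformation $\phi$ of tame functors is an $\epsilon$-equivalence if there are $\tau,\mu\in\mathbf Q$ with $\tau+\mu\le\epsilon$, $\ker\phi\in\mathcal S_\tau$ and $\mathrm{coker}\,\phi\in\mathcal S_\mu$. Tame functors $F,G$ are $\epsilon$-close if there are a tame functor $H$ and natural transformations $\phi\colon H\to F$, $\psi\colon H\to G$ such that $\phi$ is a $\tau$-equivalence, $\psi$ is a $\mu$-equivalence and $\tau+\mu\le\epsilon$. For $t>0$, $B(F,t)$ is the collection of tame functors that are $\epsilon$-close to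 $F$ for some $\epsilon<t$. For a compact and tame $F$, $\mathrm{bar}(F)_0:=\mathrm{rank}(F)$ and $\mathrm{bar}(F)_t:=\min\{\mathrm{rank}(G)\mid G\in B(F,t)\}$ for $t>0$. *)

theory Defs
  imports Complex_Main "HOL-Algebra.AbelCoset" "Jordan_Normal_Form.Missing_VectorSpace"
begin

text \<open>
  A functor from the poset \<open>I\<close> (a subset of an ordered type) to \<open>K\<close>-vector spaces. The vector
  spaces have their carriers in the type \<open>'a\<close>, so \<open>'a\<close> plays the role of the universe: the objects
  of the functor category are exactly the functors of type \<open>('i, 'k, 'a) vfunctor\<close>. Isomorphisms
  may relate functors whose carriers live in different types; this is how explicitly constructed
  objects (quotients, direct sums) are compared with objects of the universe. The components
  of the record outside \<open>I\<close> are irrelevant.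
\<close>

record ('i, 'k, 'a) vfunctor =
  obj :: "'i \<Rightarrow> ('k, 'a) module"
  mor :: "'i \<Rightarrow> 'i \<Rightarrow> 'a \<Rightarrow> 'a"

definition is_vfunctor ::
  "'i::order set \<Rightarrow> ('k, 'm) ring_scheme \<Rightarrow> ('i, 'k, 'a) vfunctor \<Rightarrow> bool" where
  "is_vfunctor I K F \<longleftrightarrow>
     (\<forall>v\<in>I. vectorspace K (obj F v)) \<and>
     (\<forall>v\<in>I. \<forall>u\<in>I. v \<le> u \<longrightarrow> mor F v u \<in> module_hom K (obj F v) (obj F u)) \<and>
     (\<forall>v\<in>I. \<forall>x\<in>carrier (obj F v). mor F v v x = x) \<and>
     (\<forall>v\<in>I. \<forall>u\<in>I. \<forall>w\<in>I. v \<le> u \<longrightarrow> u \<le> w \<longrightarrow>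
        (\<forall>x\<in>carrier (obj F v). mor F u w (mor F v u x) = mor F v w x))"

definition nat_trans ::
  "'i::order set \<Rightarrow> ('k, 'm) ring_scheme \<Rightarrow> ('i, 'k, 'a) vfunctor \<Rightarrow> ('i, 'k, 'b) vfunctor
     \<Rightarrow> ('i \<Rightarrow> 'a \<Rightarrow> 'b) \<Rightarrow> bool" where
  "nat_trans I K F G \<phi> \<longleftrightarrow>
     (\<forall>v\<in>I. \<phi> v \<in> module_hom K (obj F v) (obj G v)) \<and>
     (\<forall>v\<in>I. \<forall>u\<in>I. v \<le> u \<longrightarrow>
        (\<forall>x\<in>carrier (obj F v). \<phi> u (mor F v u x) = mor G v u (\<phi> v x)))"

text \<open>Natural transformations are only relevant on carriers; this is their equality.\<close>

definition nt_eq ::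
  "'i set \<Rightarrow> ('i, 'k, 'a) vfunctor \<Rightarrow> ('i \<Rightarrow> 'a \<Rightarrow> 'b) \<Rightarrow> ('i \<Rightarrow> 'a \<Rightarrow> 'b) \<Rightarrow> bool" where
  "nt_eq I F \<phi> \<psi> \<longleftrightarrow> (\<forall>v\<in>I. \<forall>x\<in>carrier (obj F v). \<phi> v x = \<psi> v x)"

definition nat_iso ::
  "'i::order set \<Rightarrow> ('k, 'm) ring_scheme \<Rightarrow> ('i, 'k, 'a) vfunctor \<Rightarrow> ('i, 'k, 'b) vfunctor
     \<Rightarrow> ('i \<Rightarrow> 'a \<Rightarrow> 'b) \<Rightarrow> bool" where
  "nat_iso I K F G \<phi> \<longleftrightarrow> nat_trans I K F G \<phi> \<and>
     (\<exists>\<psi>. nat_trans I K G F \<psi> \<and>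
          nt_eq I F (\<lambda>v. \<psi> v \<circ> \<phi> v) (\<lambda>v x. x) \<and>
          nt_eq I G (\<lambda>v. \<phi> v \<circ> \<psi> v) (\<lambda>v x. x))"

definition isomorphic ::
  "'i::order set \<Rightarrow> ('k, 'm) ring_scheme \<Rightarrow> ('i, 'k, 'a) vfunctor \<Rightarrow> ('i, 'k, 'b) vfunctor
     \<Rightarrow> bool" where
  "isomorphic I K F G \<longleftrightarrow> (\<exists>\<phi>. nat_iso I K F G \<phi>)"

text \<open>
  Membership, up to isomorphism, of an explicitly constructed functor in a collection of functors
  of the universe. The collections to which this is applied are closed under isomorphism.
\<close>

definition in_upto_iso ::
  "'i::order set \<Rightarrow> ('k, 'm) ring_scheme \<Rightarrow> ('i, 'k, 'b) vfunctor \<Rightarrow> ('i, 'k, 'a) vfunctor set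
     \<Rightarrow> bool" where
  "in_upto_iso I K X \<A> \<longleftrightarrow> (\<exists>Y\<in>\<A>. isomorphic I K X Y)"

definition zero_functor :: "'i set \<Rightarrow> ('i, 'k, 'a) vfunctor \<Rightarrow> bool" where
  "zero_functor I Z \<longleftrightarrow> (\<forall>v\<in>I. carrier (obj Z v) = {\<zero>\<^bsub>obj Z v\<^esub>})"

text \<open>Epimorphisms and exactness in the functor category are pointwise.\<close>

definition epimorphism ::
  "'i::order set \<Rightarrow> ('k, 'm) ring_scheme \<Rightarrow> ('i, 'k, 'a) vfunctor \<Rightarrow> ('i, 'k, 'b) vfunctor
     \<Rightarrow> ('i \<Rightarrow> 'a \<Rightarrow> 'b) \<Rightarrow> bool" where
  "epimorphism I K F G \<phi> \<longleftrightarrow> nat_trans I K F G \<phi> \<and>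
     (\<forall>v\<in>I. \<phi> v ` carrier (obj F v) = carrier (obj G v))"

definition restrict_functor ::
  "('i, 'k, 'a) vfunctor \<Rightarrow> ('i \<Rightarrow> 'a set) \<Rightarrow> ('i, 'k, 'a) vfunctor" where
  "restrict_functor A B = \<lparr>obj = (\<lambda>v. (obj A v)\<lparr>carrier := B v\<rparr>), mor = mor A\<rparr>"

definition subfunctor ::
  "'i::order set \<Rightarrow> ('k, 'm) ring_scheme \<Rightarrow> ('i, 'k, 'a) vfunctor \<Rightarrow> ('i \<Rightarrow> 'a set) \<Rightarrow> bool" where
  "subfunctor I K A B \<longleftrightarrow>
     (\<forall>v\<in>I. subspace K (B v) (obj A v)) \<and>
     (\<forall>v\<in>I. \<forall>u\<in>I. v \<le> u \<longrightarrow> mor A v u ` B v \<subseteq> B u)"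

definition ker_functor ::
  "('i, 'k, 'a) vfunctor \<Rightarrow> ('i, 'k, 'b) vfunctor \<Rightarrow> ('i \<Rightarrow> 'a \<Rightarrow> 'b) \<Rightarrow> ('i, 'k, 'a) vfunctor" where
  "ker_functor F G \<phi> =
     restrict_functor F (\<lambda>v. {x \<in> carrier (obj F v). \<phi> v x = \<zero>\<^bsub>obj G v\<^esub>})"

text \<open>
  The fields \<open>mult\<close> and \<open>one\<close> of a module record carry no information for a vector space; they are
  filled with zeros.
\<close>

definition quotient_space :: "('k, 'a) module \<Rightarrow> 'a set \<Rightarrow> ('k, 'a set) module" where
  "quotient_space V W =
     \<lparr>carrier = a_rcosets\<^bsub>V\<^esub> W, mult = (\<lambda>X Y. W), one = W, zero = W,
      add = (\<lambda>X Y. X <+>\<^bsub>V\<^esub> Y), smult = (\<lambda>c X. \<Union>x\<in>X. W +>\<^bsub>V\<^esub> (c \<odot>\<^bsub>V\<^esub> x))\<rparr>"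

definition coker_functor ::
  "('i, 'k, 'a) vfunctor \<Rightarrow> ('i, 'k, 'b) vfunctor \<Rightarrow> ('i \<Rightarrow> 'a \<Rightarrow> 'b)
     \<Rightarrow> ('i, 'k, 'b set) vfunctor" where
  "coker_functor F G \<phi> =
     \<lparr>obj = (\<lambda>v. quotient_space (obj G v) (\<phi> v ` carrier (obj F v))),
      mor = (\<lambda>v u X. \<Union>x\<in>X. (\<phi> u ` carrier (obj F u)) +>\<^bsub>obj G u\<^esub> mor G v u x)\<rparr>"

definition short_exact ::
  "'i::order set \<Rightarrow> ('k, 'm) ring_scheme \<Rightarrow> ('i, 'k, 'a) vfunctor \<Rightarrow> ('i, 'k, 'a) vfunctor
     \<Rightarrow> ('i, 'k, 'a) vfunctor \<Rightarrow> ('i \<Rightarrow> 'a \<Rightarrow> 'a) \<Rightarrow> ('i \<Rightarrow> 'a \<Rightarrow> 'a) \<Rightarrow> bool" where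
  "short_exact I K F G H f g \<longleftrightarrow>
     nat_trans I K F G f \<and> nat_trans I K G H g \<and>
     (\<forall>v\<in>I. inj_on (f v) (carrier (obj F v)) \<and>
            f v ` carrier (obj F v) = {x \<in> carrier (obj G v). g v x = \<zero>\<^bsub>obj H v\<^esub>} \<and>
            g v ` carrier (obj G v) = carrier (obj H v))"

text \<open>
  \<open>A\<close>, with the inclusions, is the colimit of the increasing sequence of subfunctors \<open>B n\<close>, by the
  universal property in the functor category.
\<close>

definition is_colimit_of_chain ::
  "'i::order set \<Rightarrow> ('k, 'm) ring_scheme \<Rightarrow> ('i, 'k, 'a) vfunctor \<Rightarrow> (nat \<Rightarrow> 'i \<Rightarrow> 'a set)
     \<Rightarrow> bool" where
  "is_colimit_of_chain I K A B \<longleftrightarrow>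
     (\<forall>(C :: ('i, 'k, 'a) vfunctor) \<psi>.
        is_vfunctor I K C \<and>
        (\<forall>n. nat_trans I K (restrict_functor A (B n)) C (\<psi> n)) \<and>
        (\<forall>n. nt_eq I (restrict_functor A (B n)) (\<psi> n) (\<psi> (Suc n))) \<longrightarrow>
        (\<exists>\<theta>. nat_trans I K A C \<theta> \<and> (\<forall>n. nt_eq I (restrict_functor A (B n)) \<theta> (\<psi> n)) \<and>
             (\<forall>\<theta>'. nat_trans I K A C \<theta>' \<and>
                   (\<forall>n. nt_eq I (restrict_functor A (B n)) \<theta>' (\<psi> n)) \<longrightarrow> nt_eq I A \<theta>' \<theta>)))"

definition compact_functor ::
  "'i::order set \<Rightarrow> ('k, 'm) ring_scheme \<Rightarrow> ('i, 'k, 'a) vfunctor \<Rightarrow> bool" where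
  "compact_functor I K A \<longleftrightarrow>
     (\<forall>B. (\<forall>n. subfunctor I K A (B n)) \<and> (\<forall>n. \<forall>v\<in>I. B n v \<subseteq> B (Suc n) v) \<and>
          is_colimit_of_chain I K A B \<longrightarrow>
          (\<exists>k. \<forall>v\<in>I. B k v = carrier (obj A v)))"

definition dsum2 ::
  "('i, 'k, 'a) vfunctor \<Rightarrow> ('i, 'k, 'b) vfunctor \<Rightarrow> ('i, 'k, 'a \<times> 'b) vfunctor" where
  "dsum2 F G = \<lparr>obj = (\<lambda>v. direct_sum (obj F v) (obj G v)),
                mor = (\<lambda>v u. map_prod (mor F v u) (mor G v u))\<rparr>"

definition module_sum :: "'j set \<Rightarrow> ('j \<Rightarrow> ('k, 'a) module) \<Rightarrow> ('k, 'j \<Rightarrow> 'a) module" where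
  "module_sum J M =
     \<lparr>carrier = {f \<in> \<Pi>\<^sub>E j\<in>J. carrier (M j). finite {j\<in>J. f j \<noteq> \<zero>\<^bsub>M j\<^esub>}},
      mult = (\<lambda>f g. \<lambda>j\<in>J. \<zero>\<^bsub>M j\<^esub>), one = (\<lambda>j\<in>J. \<zero>\<^bsub>M j\<^esub>), zero = (\<lambda>j\<in>J. \<zero>\<^bsub>M j\<^esub>),
      add = (\<lambda>f g. \<lambda>j\<in>J. f j \<oplus>\<^bsub>M j\<^esub> g j), smult = (\<lambda>c f. \<lambda>j\<in>J. c \<odot>\<^bsub>M j\<^esub> f j)\<rparr>"

definition dsum :: "'j set \<Rightarrow> ('j \<Rightarrow> ('i, 'k, 'a) vfunctor) \<Rightarrow> ('i, 'k, 'j \<Rightarrow> 'a) vfunctor" where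
  "dsum J X = \<lparr>obj = (\<lambda>v. module_sum J (\<lambda>j. obj (X j) v)),
               mor = (\<lambda>v u f. \<lambda>j\<in>J. mor (X j) v u (f j))\<rparr>"

abbreviation nnrat :: "rat set" where "nnrat \<equiv> {0..}"

definition b_floor :: "rat \<Rightarrow> rat \<Rightarrow> nat" where
  "b_floor \<alpha> v = (GREATEST w. \<alpha> * of_nat w \<le> v)"

definition extend_functor :: "rat \<Rightarrow> (nat, 'k, 'a) vfunctor \<Rightarrow> (rat, 'k, 'a) vfunctor" where
  "extend_functor \<alpha> F = \<lparr>obj = (\<lambda>v. obj F (b_floor \<alpha> v)),
                         mor = (\<lambda>v u. mor F (b_floor \<alpha> v) (b_floor \<alpha> u))\<rparr>"

definition tame :: "('k, 'm) ring_scheme \<Rightarrow> (rat, 'k, 'a) vfunctor \<Rightarrow> bool" where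
  "tame K F \<longleftrightarrow> is_vfunctor nnrat K F \<and>
     (\<exists>\<alpha>>0. \<exists>G :: (nat, 'k, 'a) vfunctor.
        is_vfunctor UNIV K G \<and> isomorphic nnrat K F (extend_functor \<alpha> G))"

text \<open>
  The functor \<open>K(v,-) \<otimes> V\<close>, with the canonical identification of \<open>K \<otimes> V\<close> with \<open>V\<close>: the value is
  \<open>V\<close> at \<open>w \<ge> v\<close> and the zero space otherwise.
\<close>

definition gen_functor :: "rat \<Rightarrow> ('k, 'a) module \<Rightarrow> (rat, 'k, 'a) vfunctor" where
  "gen_functor v V =
     \<lparr>obj = (\<lambda>w. if v \<le> w then V else V\<lparr>carrier := {\<zero>\<^bsub>V\<^esub>}\<rparr>), mor = (\<lambda>w u x. x)\<rparr>"

definition self_module :: "('k, 'm) ring_scheme \<Rightarrow> ('k, 'k) module" where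
  "self_module K = \<lparr>carrier = carrier K, mult = mult K, one = \<one>\<^bsub>K\<^esub>, zero = \<zero>\<^bsub>K\<^esub>,
                    add = add K, smult = mult K\<rparr>"

definition K_functor :: "('k, 'm) ring_scheme \<Rightarrow> rat \<Rightarrow> (rat, 'k, 'k) vfunctor" where
  "K_functor K v = gen_functor v (self_module K)"

text \<open>The inclusion \<open>K(u,-) \<subseteq> K(w,-)\<close> is the identity on carriers.\<close>

definition interval_functor ::
  "('k, 'm) ring_scheme \<Rightarrow> rat \<Rightarrow> rat \<Rightarrow> (rat, 'k, 'k set) vfunctor" where
  "interval_functor K w u = coker_functor (K_functor K u) (K_functor K w) (\<lambda>_ x. x)"

definition free_on ::
  "('k, 'm) ring_scheme \<Rightarrow> (rat, 'k, 'a) vfunctor \<Rightarrow> (rat \<Rightarrow> ('k, 'a) module) \<Rightarrow> bool" where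
  "free_on K P V \<longleftrightarrow> is_vfunctor nnrat K P \<and> (\<forall>v\<in>nnrat. vectorspace K (V v)) \<and>
     isomorphic nnrat K P (dsum nnrat (\<lambda>v. gen_functor v (V v)))"

definition free_functor :: "('k, 'm) ring_scheme \<Rightarrow> (rat, 'k, 'a) vfunctor \<Rightarrow> bool" where
  "free_functor K P \<longleftrightarrow> (\<exists>V. free_on K P V)"

definition free_of_rank ::
  "('k, 'm) ring_scheme \<Rightarrow> (rat, 'k, 'a) vfunctor \<Rightarrow> nat \<Rightarrow> bool" where
  "free_of_rank K P n \<longleftrightarrow> (\<exists>V. free_on K P V \<and>
     (\<forall>v\<in>nnrat. vectorspace.fin_dim K (V v)) \<and>
     finite {v\<in>nnrat. vectorspace.dim K (V v) \<noteq> 0} \<and>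
     n = (\<Sum>v\<in>{v\<in>nnrat. vectorspace.dim K (V v) \<noteq> 0}. vectorspace.dim K (V v)))"

definition minimal_cover ::
  "('k, 'm) ring_scheme \<Rightarrow> (rat, 'k, 'a) vfunctor \<Rightarrow> (rat, 'k, 'a) vfunctor
     \<Rightarrow> (rat \<Rightarrow> 'a \<Rightarrow> 'a) \<Rightarrow> bool" where
  "minimal_cover K P G \<phi> \<longleftrightarrow> free_functor K P \<and> epimorphism nnrat K P G \<phi> \<and>
     (\<forall>f. nat_trans nnrat K P P f \<and> nt_eq nnrat P (\<lambda>v. \<phi> v \<circ> f v) \<phi> \<longrightarrow> nat_iso nnrat K P P f)"

definition has_rank ::
  "('k, 'm) ring_scheme \<Rightarrow> (rat, 'k, 'a) vfunctor \<Rightarrow> nat \<Rightarrow> bool" where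
  "has_rank K G n \<longleftrightarrow> (\<exists>P \<phi>. minimal_cover K P G \<phi> \<and> free_of_rank K P n)"

definition finite_rank :: "('k, 'm) ring_scheme \<Rightarrow> (rat, 'k, 'a) vfunctor \<Rightarrow> bool" where
  "finite_rank K G \<longleftrightarrow> (\<exists>n. has_rank K G n)"

definition functor_rank :: "('k, 'm) ring_scheme \<Rightarrow> (rat, 'k, 'a) vfunctor \<Rightarrow> nat" where
  "functor_rank K G = (THE n. has_rank K G n)"

definition noise_system ::
  "('k, 'm) ring_scheme \<Rightarrow> (rat \<Rightarrow> (rat, 'k, 'a) vfunctor set) \<Rightarrow> bool" where
  "noise_system K S \<longleftrightarrow>
     (\<forall>\<epsilon>\<in>nnrat. \<forall>F\<in>S \<epsilon>. tame K F) \<and>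
     (\<forall>\<epsilon>\<in>nnrat. \<forall>Z. is_vfunctor nnrat K Z \<and> zero_functor nnrat Z \<longrightarrow> Z \<in> S \<epsilon>) \<and>
     (\<forall>\<tau>\<in>nnrat. \<forall>\<epsilon>\<in>nnrat. \<tau> < \<epsilon> \<longrightarrow> S \<tau> \<subseteq> S \<epsilon>) \<and>
     (\<forall>F G H f g. tame K F \<and> tame K G \<and> tame K H \<and> short_exact nnrat K F G H f g \<longrightarrow>
        (\<forall>\<epsilon>\<in>nnrat. G \<in> S \<epsilon> \<longrightarrow> F \<in> S \<epsilon> \<and> H \<in> S \<epsilon>) \<and>
        (\<forall>\<epsilon>\<in>nnrat. \<forall>\<tau>\<in>nnrat. F \<in> S \<epsilon> \<and> H \<in> S \<tau> \<longrightarrow> G \<in> S (\<epsilon> + \<tau>)))"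

definition eps_equivalence ::
  "('k, 'm) ring_scheme \<Rightarrow> (rat \<Rightarrow> (rat, 'k, 'a) vfunctor set) \<Rightarrow> rat
     \<Rightarrow> (rat, 'k, 'a) vfunctor \<Rightarrow> (rat, 'k, 'a) vfunctor \<Rightarrow> (rat \<Rightarrow> 'a \<Rightarrow> 'a) \<Rightarrow> bool" where
  "eps_equivalence K S \<epsilon> F G \<phi> \<longleftrightarrow> nat_trans nnrat K F G \<phi> \<and>
     (\<exists>\<tau>\<in>nnrat. \<exists>\<mu>\<in>nnrat. \<tau> + \<mu> \<le> \<epsilon> \<and>
        ker_functor F G \<phi> \<in> S \<tau> \<and> in_upto_iso nnrat K (coker_functor F G \<phi>) (S \<mu>))"

definition eps_close ::
  "('k, 'm) ring_scheme \<Rightarrow> (rat \<Rightarrow> (rat, 'k, 'a) vfunctor set) \<Rightarrow> rat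
     \<Rightarrow> (rat, 'k, 'a) vfunctor \<Rightarrow> (rat, 'k, 'a) vfunctor \<Rightarrow> bool" where
  "eps_close K S \<epsilon> F G \<longleftrightarrow>
     (\<exists>H \<phi> \<psi>. tame K H \<and>
        (\<exists>\<tau>\<in>nnrat. \<exists>\<mu>\<in>nnrat. \<tau> + \<mu> \<le> \<epsilon> \<and>
           eps_equivalence K S \<tau> H F \<phi> \<and> eps_equivalence K S \<mu> H G \<psi>))"

definition noise_ball ::
  "('k, 'm) ring_scheme \<Rightarrow> (rat \<Rightarrow> (rat, 'k, 'a) vfunctor set) \<Rightarrow> (rat, 'k, 'a) vfunctor \<Rightarrow> rat
     \<Rightarrow> (rat, 'k, 'a) vfunctor set" where
  "noise_ball K S F t = {G. tame K G \<and> (\<exists>\<epsilon>\<in>nnrat. \<epsilon> < t \<and> eps_close K S \<epsilon> F G)}"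

definition bar ::
  "('k, 'm) ring_scheme \<Rightarrow> (rat \<Rightarrow> (rat, 'k, 'a) vfunctor set) \<Rightarrow> (rat, 'k, 'a) vfunctor \<Rightarrow> rat
     \<Rightarrow> nat" where
  "bar K S F t =
     (if t = 0 then functor_rank K F
      else (LEAST n. \<exists>G\<in>noise_ball K S F t. finite_rank K G \<and> functor_rank K G = n))"

definition closed_under_direct_sums ::
  "('k, 'm) ring_scheme \<Rightarrow> (rat \<Rightarrow> (rat, 'k, 'a) vfunctor set) \<Rightarrow> bool" where
  "closed_under_direct_sums K S \<longleftrightarrow>
     (\<forall>\<epsilon>\<in>nnrat. \<forall>G\<in>S \<epsilon>. \<forall>H\<in>S \<epsilon>. in_upto_iso nnrat K (dsum2 G H) (S \<epsilon>))"

text \<open>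
  The universe \<open>'a\<close> has to be large enough to contain the functors \<open>K(v,-)\<close> and all finite direct sums
  of its members up to isomorphism: it is infinite and at least as large as \<open>K\<close>.
\<close>

definition adequate_universe :: "('k, 'm) ring_scheme \<Rightarrow> 'a itself \<Rightarrow> bool" where
  "adequate_universe K (_ :: 'a itself) \<longleftrightarrow>
     infinite (UNIV :: 'a set) \<and> (\<exists>e :: 'k \<Rightarrow> 'a. inj_on e (carrier K))"

end

theory Submission
  imports Defs
begin

text \<open>
  Write \<open>F\<close> as a finite sum of cyclic functors \<open>X\<^sub>b\<close>, one for each bar, and let \<open>A\<close> be the set of those \<open>b\<close>
  for which \<open>X\<^sub>b\<close> lies in no \<open>S \<epsilon>\<close> with \<open>\<epsilon> < t\<close>. The theorem says \<open>bar(F)\<^sub>t = |A|\<close>. Bars of both kinds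
  are treated alike: the proof works with the one property that each \<open>X\<^sub>b\<close> is generated by one element.

  The upper bound is where closure under direct sums enters. The sum of all summands outside \<open>A\<close> lies in
  one \<open>S \<epsilon>\<close> with \<open>\<epsilon> < t\<close>, so projecting it away shows that the sum of the \<open>X\<^sub>b\<close> with \<open>b \<in> A\<close> is \<open>\<epsilon>\<close>-close
  to \<open>F\<close> (\<open>eps_close_subsum\<close>), and it has rank \<open>|A|\<close> (\<open>has_rank_subsum\<close>).

  For the lower bound let \<open>\<phi> : H \<rightarrow> F\<close> and \<open>\<psi> : H \<rightarrow> G\<close> have small kernels and cokernels. Push the generator of
  \<open>X\<^sub>b\<close> to the first time at which it vanishes in the cokernel of \<open>\<phi>\<close>, lift it to \<open>H\<close> and map it to \<open>G\<close>. These
  \<open>|A|\<close> elements of \<open>G\<close> satisfy no relation that involves an element born at the time of the relation: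
  such a relation would produce an element of \<open>ker \<psi>\<close> whose projection to some \<open>X\<^sub>b\<close> generates the kernel of
  \<open>X\<^sub>b \<rightarrow> coker \<phi>\<close>. Then \<open>X\<^sub>b\<close> would be an extension of a small functor by a small functor, with total size
  below \<open>t\<close> (\<open>rank_lower_bound\<close>).

  What makes this argument short is the notion of a reduced family, one without such relations. By linear
  algebra over \<open>K\<close> a reduced family is never larger than a generating one (\<open>reduced_card_le_generating\<close>).
  A minimal cover of \<open>G\<close> of finite rank is the same as a finite family that is both reduced and generating
  (\<open>minimal_cover_reduced\<close>, \<open>has_rank_of_reduced_generating\<close>). So the rank is the size of any such
  family (\<open>functor_rank_eq\<close>), and a reduced family of \<open>|A|\<close> elements in \<open>G\<close> gives
  \<open>|A| \<le> rank G\<close>.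

  Tameness is used in the form that the structure maps are bijections as long as no point of some grid
  \<open>\<alpha> \<nat>\<close> is passed (\<open>tame_iff_grid_const\<close>). This provides the first times above, and it shows that kernels,
  cokernels and cyclic subfunctors of tame functors are tame, as is needed to apply the axioms of a noise
  system to them.
\<close>

section \<open>Functors, natural transformations and subfunctors\<close>

lemma is_vfunctor_vectorspace:
  "is_vfunctor I K F \<Longrightarrow> v \<in> I \<Longrightarrow> vectorspace K (obj F v)"
  by (simp add: is_vfunctor_def)

lemma is_vfunctor_mor:
  assumes "is_vfunctor I K F" "v \<in> I" "u \<in> I" "v \<le> u"
  shows "mor F v u \<in> module_hom K (obj F v) (obj F u)"
  using assms by (simp add: is_vfunctor_def)

lemma is_vfunctor_mor_closed:
  assumes "is_vfunctor I K F" "v \<in> I" "u \<in> I" "v \<le> u" "x \<in> carrier (obj F v)"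
  shows "mor F v u x \<in> carrier (obj F u)"
  using module_hom_closed[OF is_vfunctor_mor[OF assms(1-4)]] assms(5) by blast

lemma is_vfunctor_mor_id:
  assumes "is_vfunctor I K F" "v \<in> I" "x \<in> carrier (obj F v)"
  shows "mor F v v x = x"
  using assms by (simp add: is_vfunctor_def)

lemma is_vfunctor_mor_comp:
  assumes "is_vfunctor I K F" "v \<in> I" "u \<in> I" "w \<in> I" "v \<le> u" "u \<le> w" "x \<in> carrier (obj F v)"
  shows "mor F u w (mor F v u x) = mor F v w x"
  using assms unfolding is_vfunctor_def by blast

lemma is_vfunctor_zero:
  assumes "is_vfunctor I K X" "q \<in> I"
  shows "\<zero>\<^bsub>obj X q\<^esub> \<in> carrier (obj X q)" "\<zero>\<^bsub>obj X q\<^esub> \<oplus>\<^bsub>obj X q\<^esub> \<zero>\<^bsub>obj X q\<^esub> = \<zero>\<^bsub>obj X q\<^esub>"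
    "c \<in> carrier K \<Longrightarrow> c \<odot>\<^bsub>obj X q\<^esub> \<zero>\<^bsub>obj X q\<^esub> = \<zero>\<^bsub>obj X q\<^esub>"
proof -
  interpret vectorspace K "obj X q" by (rule is_vfunctor_vectorspace[OF assms])
  show "\<zero>\<^bsub>obj X q\<^esub> \<in> carrier (obj X q)" "\<zero>\<^bsub>obj X q\<^esub> \<oplus>\<^bsub>obj X q\<^esub> \<zero>\<^bsub>obj X q\<^esub> = \<zero>\<^bsub>obj X q\<^esub>"
    "c \<in> carrier K \<Longrightarrow> c \<odot>\<^bsub>obj X q\<^esub> \<zero>\<^bsub>obj X q\<^esub> = \<zero>\<^bsub>obj X q\<^esub>" by simp_all
qed

lemma nat_trans_hom:
  "nat_trans I K F G \<phi> \<Longrightarrow> v \<in> I \<Longrightarrow> \<phi> v \<in> module_hom K (obj F v) (obj G v)"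
  by (simp add: nat_trans_def)

lemma nat_trans_closed:
  "nat_trans I K F G \<phi> \<Longrightarrow> v \<in> I \<Longrightarrow> x \<in> carrier (obj F v) \<Longrightarrow> \<phi> v x \<in> carrier (obj G v)"
  using module_hom_closed[OF nat_trans_hom] by blast

lemma nat_trans_natural:
  "nat_trans I K F G \<phi> \<Longrightarrow> v \<in> I \<Longrightarrow> u \<in> I \<Longrightarrow> v \<le> u \<Longrightarrow> x \<in> carrier (obj F v)
    \<Longrightarrow> \<phi> u (mor F v u x) = mor G v u (\<phi> v x)"
  by (simp add: nat_trans_def)

lemma module_homI:
  assumes "\<And>x. x \<in> carrier V \<Longrightarrow> f x \<in> carrier W"
    and "\<And>x y. x \<in> carrier V \<Longrightarrow> y \<in> carrier V \<Longrightarrow> f (x \<oplus>\<^bsub>V\<^esub> y) = f x \<oplus>\<^bsub>W\<^esub> f y"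
    and "\<And>c x. c \<in> carrier K \<Longrightarrow> x \<in> carrier V \<Longrightarrow> f (c \<odot>\<^bsub>V\<^esub> x) = c \<odot>\<^bsub>W\<^esub> f x"
  shows "f \<in> module_hom K V W"
  using assms unfolding module_hom_def by auto

lemma hom_zero:
  assumes "vectorspace K V" "vectorspace K W" "f \<in> module_hom K V W"
  shows "f \<zero>\<^bsub>V\<^esub> = \<zero>\<^bsub>W\<^esub>"
proof -
  interpret linear_map K V W f
    using assms by (simp add: linear_map_def mod_hom_def mod_hom_axioms_def vectorspace_def)
  show ?thesis by simp
qed

lemma hom_minus:
  assumes "vectorspace K V" "vectorspace K W" "f \<in> module_hom K V W"
    and "x \<in> carrier V" "y \<in> carrier V"
  shows "f (x \<ominus>\<^bsub>V\<^esub> y) = f x \<ominus>\<^bsub>W\<^esub> f y"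
proof -
  interpret linear_map K V W f
    using assms by (simp add: linear_map_def mod_hom_def mod_hom_axioms_def vectorspace_def)
  show ?thesis using assms(4,5) by (simp add: T_minus)
qed

lemma hom_finsum:
  assumes "vectorspace K V" "vectorspace K W" "f \<in> module_hom K V W"
    and "g \<in> A \<rightarrow> carrier V"
  shows "f (finsum V g A) = finsum W (\<lambda>a. f (g a)) A"
proof -
  interpret linear_map K V W f
    using assms by (simp add: linear_map_def mod_hom_def mod_hom_axioms_def vectorspace_def)
  have closed: "\<And>x. x \<in> carrier V \<Longrightarrow> f x \<in> carrier W"
    using module_hom_closed[OF assms(3)] by blast
  from assms(4) show ?thesis
    by (induction A rule: infinite_finite_induct) (auto simp: Pi_iff closed)
qed

lemma hom_inj_on:
  assumes "vectorspace K V" "vectorspace K W" "f \<in> module_hom K V W"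
    and "\<And>x. x \<in> carrier V \<Longrightarrow> f x = \<zero>\<^bsub>W\<^esub> \<Longrightarrow> x = \<zero>\<^bsub>V\<^esub>"
  shows "inj_on f (carrier V)"
proof (rule inj_onI)
  interpret V: vectorspace K V by fact
  interpret W: vectorspace K W by fact
  fix x y assume xy: "x \<in> carrier V" "y \<in> carrier V" "f x = f y"
  have "f y \<in> carrier W" using module_hom_closed[OF assms(3)] xy by blast
  hence "f (x \<ominus>\<^bsub>V\<^esub> y) = \<zero>\<^bsub>W\<^esub>"
    using hom_minus[OF assms(1-3) xy(1,2)] xy(3) by simp
  with assms(4) xy have "x \<ominus>\<^bsub>V\<^esub> y = \<zero>\<^bsub>V\<^esub>" by simp
  with xy show "x = y" by simp
qed

lemma nat_trans_comp:
  assumes "nat_trans I K F G \<phi>" "nat_trans I K G H \<psi>"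
  shows "nat_trans I K F H (\<lambda>v x. \<psi> v (\<phi> v x))"
  using assms unfolding nat_trans_def module_hom_def Pi_iff
  by (simp add: Ball_def)

lemma nat_trans_id:
  assumes "is_vfunctor I K F" shows "nat_trans I K F F (\<lambda>v x. x)"
  unfolding nat_trans_def module_hom_def by simp

lemma nat_iso_nat_trans: "nat_iso I K F G \<phi> \<Longrightarrow> nat_trans I K F G \<phi>"
  by (simp add: nat_iso_def)

lemma nat_iso_bij:
  assumes "nat_iso I K F G \<phi>" "v \<in> I"
  shows "bij_betw (\<phi> v) (carrier (obj F v)) (carrier (obj G v))"
proof -
  obtain \<psi> where \<psi>: "nat_trans I K G F \<psi>" "nt_eq I F (\<lambda>v. \<psi> v \<circ> \<phi> v) (\<lambda>v x. x)"
      "nt_eq I G (\<lambda>v. \<phi> v \<circ> \<psi> v) (\<lambda>v x. x)"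
    and \<phi>: "nat_trans I K F G \<phi>" using assms(1) by (auto simp: nat_iso_def)
  show ?thesis
    by (rule bij_betw_byWitness[where f' = "\<psi> v"])
       (use \<psi> \<phi> assms(2) in \<open>auto simp: nt_eq_def intro: nat_trans_closed\<close>)
qed

text \<open>
  The inverse is linear and natural because both properties can be checked after applying \<open>\<phi>\<close>,
  which is injective. So a bijective natural transformation carries the structure of \<open>F\<close> over to \<open>G\<close>.
\<close>

lemma nat_isoI_bij:
  assumes F: "is_vfunctor I K F" and \<phi>: "nat_trans I K F G \<phi>"
    and bij: "\<And>v. v \<in> I \<Longrightarrow> bij_betw (\<phi> v) (carrier (obj F v)) (carrier (obj G v))"
  shows "nat_iso I K F G \<phi>"
proof -
  define \<psi> where "\<psi> v = inv_into (carrier (obj F v)) (\<phi> v)" for v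
  have \<psi>_closed: "\<psi> v y \<in> carrier (obj F v)" and \<phi>\<psi>: "\<phi> v (\<psi> v y) = y"
    if "v \<in> I" "y \<in> carrier (obj G v)" for v y
    using bij[OF that(1)] that(2) unfolding \<psi>_def bij_betw_def
    by (auto intro: inv_into_into f_inv_into_f)
  have \<psi>\<phi>: "\<psi> v (\<phi> v x) = x" if "v \<in> I" "x \<in> carrier (obj F v)" for v x
    using bij[OF that(1)] that(2) unfolding \<psi>_def bij_betw_def by auto
  have "nat_trans I K G F \<psi>" unfolding nat_trans_def
  proof (intro conjI ballI impI)
    fix v assume v: "v \<in> I"
    interpret vectorspace K "obj F v" by (rule is_vfunctor_vectorspace[OF F v])
    note hom = nat_trans_hom[OF \<phi> v]
    show "\<psi> v \<in> module_hom K (obj G v) (obj F v)"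
    proof (rule module_homI)
      fix x y assume xy: "x \<in> carrier (obj G v)" "y \<in> carrier (obj G v)"
      have "\<phi> v (\<psi> v x \<oplus>\<^bsub>obj F v\<^esub> \<psi> v y) = x \<oplus>\<^bsub>obj G v\<^esub> y"
        using module_hom_add[OF hom] \<psi>_closed[OF v] \<phi>\<psi>[OF v] xy by simp
      thus "\<psi> v (x \<oplus>\<^bsub>obj G v\<^esub> y) = \<psi> v x \<oplus>\<^bsub>obj F v\<^esub> \<psi> v y"
        using \<psi>\<phi>[OF v] \<psi>_closed[OF v] xy by (metis M.a_closed)
    next
      fix c x assume cx: "c \<in> carrier K" "x \<in> carrier (obj G v)"
      have "\<phi> v (c \<odot>\<^bsub>obj F v\<^esub> \<psi> v x) = c \<odot>\<^bsub>obj G v\<^esub> x"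
        using module_hom_smult[OF hom] \<psi>_closed[OF v] \<phi>\<psi>[OF v] cx by simp
      thus "\<psi> v (c \<odot>\<^bsub>obj G v\<^esub> x) = c \<odot>\<^bsub>obj F v\<^esub> \<psi> v x"
        using \<psi>\<phi>[OF v] \<psi>_closed[OF v] cx by (metis smult_closed)
    qed (use \<psi>_closed v in auto)
  next
    fix v u x assume vu: "v \<in> I" "u \<in> I" "v \<le> u" and x: "x \<in> carrier (obj G v)"
    have "\<phi> u (mor F v u (\<psi> v x)) = mor G v u x"
      using nat_trans_natural[OF \<phi> vu] \<psi>_closed \<phi>\<psi> vu x by simp
    thus "\<psi> u (mor G v u x) = mor F v u (\<psi> v x)"
      using \<psi>\<phi>[OF vu(2)] is_vfunctor_mor_closed[OF F vu] \<psi>_closed[OF vu(1) x] by metis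
  qed
  thus ?thesis unfolding nat_iso_def nt_eq_def using \<phi> \<phi>\<psi> \<psi>\<phi> by auto
qed

lemma isomorphic_sym: "isomorphic I K F G \<Longrightarrow> isomorphic I K G F"
  unfolding isomorphic_def nat_iso_def by blast

lemma isomorphic_refl: "is_vfunctor I K F \<Longrightarrow> isomorphic I K F F"
  unfolding isomorphic_def nat_iso_def nt_eq_def
  by (intro exI[of _ "\<lambda>v x. x"] conjI nat_trans_id) auto

text \<open>
  The axioms of a vector space are equations between operations, together with the existence of
  negatives, so they pass to images. This is how quotients are recognised as vector spaces.
\<close>

lemma vectorspace_surj_image:
  assumes "vectorspace K V" and surj: "f ` carrier V = carrier W"
    and add: "\<And>x y. x \<in> carrier V \<Longrightarrow> y \<in> carrier V \<Longrightarrow> f (x \<oplus>\<^bsub>V\<^esub> y) = f x \<oplus>\<^bsub>W\<^esub> f y"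
    and smult: "\<And>c x. c \<in> carrier K \<Longrightarrow> x \<in> carrier V \<Longrightarrow> f (c \<odot>\<^bsub>V\<^esub> x) = c \<odot>\<^bsub>W\<^esub> f x"
    and zero: "f \<zero>\<^bsub>V\<^esub> = \<zero>\<^bsub>W\<^esub>"
  shows "vectorspace K W"
proof -
  interpret V: vectorspace K V by fact
  note add' = add[symmetric] and smult' = smult[symmetric]
  show ?thesis
  proof (rule vs_criteria)
    show "\<forall>v\<in>carrier W. \<exists>neg_v\<in>carrier W. v \<oplus>\<^bsub>W\<^esub> neg_v = \<zero>\<^bsub>W\<^esub>"
    proof
      fix v assume "v \<in> carrier W"
      then obtain x where x: "x \<in> carrier V" "v = f x" using surj by blast
      have "v \<oplus>\<^bsub>W\<^esub> f (\<ominus>\<^bsub>V\<^esub> x) = \<zero>\<^bsub>W\<^esub>" using x by (simp add: add' zero V.M.r_neg)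
      moreover have "f (\<ominus>\<^bsub>V\<^esub> x) \<in> carrier W" using x surj by auto
      ultimately show "\<exists>neg_v\<in>carrier W. v \<oplus>\<^bsub>W\<^esub> neg_v = \<zero>\<^bsub>W\<^esub>" by blast
    qed
  qed (use V.field_axioms in \<open>unfold surj[symmetric] zero[symmetric],
         auto simp: add' smult' V.M.a_ac V.smult_assoc1 V.smult_l_distr V.smult_r_distr\<close>)
qed

lemma is_vfunctor_surj_image:
  assumes F: "is_vfunctor I K F"
    and f: "nat_trans I K F G f" and surj: "\<And>v. v \<in> I \<Longrightarrow> f v ` carrier (obj F v) = carrier (obj G v)"
    and zero: "\<And>v. v \<in> I \<Longrightarrow> f v \<zero>\<^bsub>obj F v\<^esub> = \<zero>\<^bsub>obj G v\<^esub>"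
  shows "is_vfunctor I K G"
  unfolding is_vfunctor_def
proof (intro conjI ballI impI)
  fix v assume v: "v \<in> I"
  show "vectorspace K (obj G v)"
    by (rule vectorspace_surj_image[OF is_vfunctor_vectorspace[OF F v] surj[OF v] _ _ zero[OF v]])
       (use nat_trans_hom[OF f v] in \<open>auto simp: module_hom_def\<close>)
  fix x assume "x \<in> carrier (obj G v)"
  then obtain y where "y \<in> carrier (obj F v)" "x = f v y" using surj[OF v] by blast
  thus "mor G v v x = x" using nat_trans_natural[OF f v v] is_vfunctor_mor_id[OF F v] by auto
next
  fix v u assume vu: "v \<in> I" "u \<in> I" "v \<le> u"
  interpret vectorspace K "obj F v" by (rule is_vfunctor_vectorspace[OF F vu(1)])
  note nat = nat_trans_natural[OF f vu, symmetric] and closed = is_vfunctor_mor_closed[OF F vu]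
  note homv = nat_trans_hom[OF f vu(1)] and homu = nat_trans_hom[OF f vu(2)]
  note homF = is_vfunctor_mor[OF F vu]
  show "mor G v u \<in> module_hom K (obj G v) (obj G u)"
  proof (rule module_homI)
    fix x assume "x \<in> carrier (obj G v)"
    then obtain x' where x: "x' \<in> carrier (obj F v)" "x = f v x'" using surj[OF vu(1)] by blast
    thus "mor G v u x \<in> carrier (obj G u)"
      using nat nat_trans_closed[OF f vu(2)] closed by simp
  next
    fix x y assume "x \<in> carrier (obj G v)" "y \<in> carrier (obj G v)"
    then obtain x' y' where xy: "x' \<in> carrier (obj F v)" "x = f v x'" "y' \<in> carrier (obj F v)" "y = f v y'"
      using surj[OF vu(1)] by blast
    have "x \<oplus>\<^bsub>obj G v\<^esub> y = f v (x' \<oplus>\<^bsub>obj F v\<^esub> y')" using xy module_hom_add[OF homv] by simp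
    thus "mor G v u (x \<oplus>\<^bsub>obj G v\<^esub> y) = mor G v u x \<oplus>\<^bsub>obj G u\<^esub> mor G v u y"
      using xy nat closed by (simp add: module_hom_add[OF homF] module_hom_add[OF homu])
  next
    fix c x assume c: "c \<in> carrier K" and "x \<in> carrier (obj G v)"
    then obtain x' where x: "x' \<in> carrier (obj F v)" "x = f v x'" using surj[OF vu(1)] by blast
    have "c \<odot>\<^bsub>obj G v\<^esub> x = f v (c \<odot>\<^bsub>obj F v\<^esub> x')" using c x module_hom_smult[OF homv] by simp
    thus "mor G v u (c \<odot>\<^bsub>obj G v\<^esub> x) = c \<odot>\<^bsub>obj G u\<^esub> mor G v u x"
      using c x nat closed by (simp add: module_hom_smult[OF homF] module_hom_smult[OF homu])
  qed
next
  fix v u w x assume vuw: "v \<in> I" "u \<in> I" "w \<in> I" "v \<le> u" "u \<le> w" "x \<in> carrier (obj G v)"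
  hence "v \<le> w" by simp
  obtain y where y: "y \<in> carrier (obj F v)" "x = f v y" using surj[OF vuw(1)] vuw(6) by blast
  show "mor G u w (mor G v u x) = mor G v w x"
    using y vuw \<open>v \<le> w\<close> nat_trans_natural[OF f, symmetric] is_vfunctor_mor_closed[OF F]
      is_vfunctor_mor_comp[OF F vuw(1-5)] by simp
qed

lemma subspaceI:
  assumes "vectorspace K V" "W \<subseteq> carrier V" "\<zero>\<^bsub>V\<^esub> \<in> W"
    and "\<And>x y. x \<in> W \<Longrightarrow> y \<in> W \<Longrightarrow> x \<oplus>\<^bsub>V\<^esub> y \<in> W"
    and "\<And>c x. c \<in> carrier K \<Longrightarrow> x \<in> W \<Longrightarrow> c \<odot>\<^bsub>V\<^esub> x \<in> W"
  shows "subspace K W V"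
  using assms by (auto simp: subspace_def LinearCombinations.submodule_def vectorspace_def)

lemma subspaceD:
  assumes "subspace K W V"
  shows "vectorspace K V" "W \<subseteq> carrier V" "\<zero>\<^bsub>V\<^esub> \<in> W"
    and "x \<in> W \<Longrightarrow> y \<in> W \<Longrightarrow> x \<oplus>\<^bsub>V\<^esub> y \<in> W"
    and "c \<in> carrier K \<Longrightarrow> x \<in> W \<Longrightarrow> c \<odot>\<^bsub>V\<^esub> x \<in> W"
  using assms by (auto simp: subspace_def LinearCombinations.submodule_def)

lemma restrict_functor_simps [simp]:
  "carrier (obj (restrict_functor F B) v) = B v"
  "add (obj (restrict_functor F B) v) = add (obj F v)"
  "zero (obj (restrict_functor F B) v) = zero (obj F v)"
  "smult (obj (restrict_functor F B) v) = smult (obj F v)"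
  "mor (restrict_functor F B) = mor F"
  by (simp_all add: restrict_functor_def)

lemma is_vfunctor_restrict:
  assumes F: "is_vfunctor I K F" and B: "subfunctor I K F B"
  shows "is_vfunctor I K (restrict_functor F B)"
proof -
  have sub: "subspace K (B v) (obj F v)" if "v \<in> I" for v using B that by (simp add: subfunctor_def)
  note BF = subspaceD(2)[OF sub, THEN subsetD]
  have mor: "mor F v u x \<in> B u" if "v \<in> I" "u \<in> I" "v \<le> u" "x \<in> B v" for v u x
    using B that unfolding subfunctor_def by blast
  show ?thesis
    unfolding is_vfunctor_def
  proof (intro conjI ballI impI)
    fix v assume v: "v \<in> I"
    show "vectorspace K (obj (restrict_functor F B) v)"
      using vectorspace.subspace_is_vs[OF is_vfunctor_vectorspace[OF F v] sub[OF v]]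
      by (simp add: restrict_functor_def)
  next
    fix v u assume vu: "v \<in> I" "u \<in> I" "v \<le> u"
    show "mor (restrict_functor F B) v u \<in> module_hom K (obj (restrict_functor F B) v) (obj (restrict_functor F B) u)"
      by (rule module_homI)
        (use vu mor BF module_hom_add[OF is_vfunctor_mor[OF F vu]]
          module_hom_smult[OF is_vfunctor_mor[OF F vu]] in auto)
  qed (use BF is_vfunctor_mor_id[OF F] is_vfunctor_mor_comp[OF F] in auto)
qed

lemma nat_trans_restrict_dom:
  assumes \<phi>: "nat_trans I K F G \<phi>" and B: "\<And>v. v \<in> I \<Longrightarrow> B v \<subseteq> carrier (obj F v)"
  shows "nat_trans I K (restrict_functor F B) G \<phi>"
  using assms unfolding nat_trans_def module_hom_def by (simp add: Pi_iff subset_iff)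

lemma nat_trans_restrict_cod:
  assumes \<phi>: "nat_trans I K F G \<phi>"
    and B: "\<And>v x. v \<in> I \<Longrightarrow> x \<in> carrier (obj F v) \<Longrightarrow> \<phi> v x \<in> B v"
  shows "nat_trans I K F (restrict_functor G B) \<phi>"
  using assms unfolding nat_trans_def module_hom_def by (simp add: Pi_iff)

lemma subfunctor_ker:
  assumes F: "is_vfunctor I K F" and G: "is_vfunctor I K G" and \<phi>: "nat_trans I K F G \<phi>"
  shows "subfunctor I K F (\<lambda>v. {x \<in> carrier (obj F v). \<phi> v x = \<zero>\<^bsub>obj G v\<^esub>})"
  unfolding subfunctor_def
proof (intro conjI ballI impI)
  fix v assume v: "v \<in> I"
  interpret F: vectorspace K "obj F v" by (rule is_vfunctor_vectorspace[OF F v])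
  interpret G: vectorspace K "obj G v" by (rule is_vfunctor_vectorspace[OF G v])
  note hom = nat_trans_hom[OF \<phi> v]
  show "subspace K {x \<in> carrier (obj F v). \<phi> v x = \<zero>\<^bsub>obj G v\<^esub>} (obj F v)"
    by (rule subspaceI[OF F.vectorspace_axioms])
       (auto simp: hom_zero[OF F.vectorspace_axioms G.vectorspace_axioms hom]
          module_hom_add[OF hom] module_hom_smult[OF hom])
next
  fix v u assume vu: "v \<in> I" "u \<in> I" "v \<le> u"
  note zero = hom_zero[OF is_vfunctor_vectorspace[OF G] is_vfunctor_vectorspace[OF G] is_vfunctor_mor[OF G]]
  show "mor F v u ` {x \<in> carrier (obj F v). \<phi> v x = \<zero>\<^bsub>obj G v\<^esub>}
      \<subseteq> {x \<in> carrier (obj F u). \<phi> u x = \<zero>\<^bsub>obj G u\<^esub>}"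
    using vu by (auto simp: is_vfunctor_mor_closed[OF F] nat_trans_natural[OF \<phi>] zero)
qed

lemma is_vfunctor_ker:
  assumes "is_vfunctor I K F" "is_vfunctor I K G" "nat_trans I K F G \<phi>"
  shows "is_vfunctor I K (ker_functor F G \<phi>)"
  unfolding ker_functor_def by (intro is_vfunctor_restrict subfunctor_ker assms)

lemma subfunctor_image:
  assumes F: "is_vfunctor I K F" and G: "is_vfunctor I K G" and \<phi>: "nat_trans I K F G \<phi>"
  shows "subfunctor I K G (\<lambda>v. \<phi> v ` carrier (obj F v))"
  unfolding subfunctor_def
proof (intro conjI ballI impI)
  fix v assume v: "v \<in> I"
  interpret F: vectorspace K "obj F v" by (rule is_vfunctor_vectorspace[OF F v])
  interpret G: vectorspace K "obj G v" by (rule is_vfunctor_vectorspace[OF G v])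
  note hom = nat_trans_hom[OF \<phi> v]
  show "subspace K (\<phi> v ` carrier (obj F v)) (obj G v)"
  proof (rule subspaceI[OF G.vectorspace_axioms])
    show "\<zero>\<^bsub>obj G v\<^esub> \<in> \<phi> v ` carrier (obj F v)"
      using hom_zero[OF F.vectorspace_axioms G.vectorspace_axioms hom] by (metis F.M.zero_closed imageI)
  qed (use module_hom_closed[OF hom] module_hom_add[OF hom, symmetric]
       module_hom_smult[OF hom, symmetric] in auto)
next
  fix v u assume "v \<in> I" "u \<in> I" "v \<le> u"
  thus "mor G v u ` \<phi> v ` carrier (obj F v) \<subseteq> \<phi> u ` carrier (obj F u)"
    by (auto simp: nat_trans_natural[OF \<phi>, symmetric] is_vfunctor_mor_closed[OF F])
qed

section \<open>Cokernels\<close>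

lemma (in abelian_group) minus_swap:
  "x \<in> carrier G \<Longrightarrow> y \<in> carrier G \<Longrightarrow> \<ominus> (x \<ominus> y) = y \<ominus> x"
  by (simp add: minus_eq minus_add a_comm)

lemma (in abelian_group) minus_telescope:
  "x \<in> carrier G \<Longrightarrow> y \<in> carrier G \<Longrightarrow> z \<in> carrier G \<Longrightarrow> (x \<ominus> y) \<oplus> (y \<ominus> z) = x \<ominus> z"
  by (simp add: minus_eq a_assoc r_neg1)

lemma (in abelian_group) minus_zero_right: "x \<in> carrier G \<Longrightarrow> x \<ominus> \<zero> = x"
  by (metis minus_swap minus_telescope minus_other_side zero_closed r_zero minus_eq l_zero add.inv_closed)

context
  fixes K :: "('k, 'm) ring_scheme" and V :: "('k, 'a) module" and W
  assumes V: "vectorspace K V" and W: "subspace K W V"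
begin

interpretation vectorspace K V by (rule V)

lemma mem_coset:
  assumes x: "x \<in> carrier V"
  shows "z \<in> W +>\<^bsub>V\<^esub> x \<longleftrightarrow> z \<in> carrier V \<and> z \<ominus>\<^bsub>V\<^esub> x \<in> W"
proof
  assume "z \<in> W +>\<^bsub>V\<^esub> x"
  then obtain h where h: "h \<in> W" "z = h \<oplus>\<^bsub>V\<^esub> x" by (auto simp: a_r_coset_def')
  hence "h \<in> carrier V" using subspaceD(2)[OF W] by blast
  with h x show "z \<in> carrier V \<and> z \<ominus>\<^bsub>V\<^esub> x \<in> W" by (simp add: M.minus_eq M.a_assoc M.r_neg)
next
  assume z: "z \<in> carrier V \<and> z \<ominus>\<^bsub>V\<^esub> x \<in> W"
  hence "z = (z \<ominus>\<^bsub>V\<^esub> x) \<oplus>\<^bsub>V\<^esub> x" using x by (simp add: M.minus_eq M.a_assoc M.l_neg)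
  with z show "z \<in> W +>\<^bsub>V\<^esub> x" by (auto simp: a_r_coset_def')
qed

lemma subspace_neg: "z \<in> W \<Longrightarrow> \<ominus>\<^bsub>V\<^esub> z \<in> W"
  using subspaceD(5)[OF W, of "\<ominus>\<^bsub>K\<^esub> \<one>\<^bsub>K\<^esub>" z] subspaceD(2)[OF W] smult_minus_1[of z] by auto

lemma coset_eqI:
  assumes x: "x \<in> carrier V" and y: "y \<in> carrier V" and d: "x \<ominus>\<^bsub>V\<^esub> y \<in> W"
  shows "W +>\<^bsub>V\<^esub> x = W +>\<^bsub>V\<^esub> y"
proof (rule Set.set_eqI)
  fix z
  have e: "y \<ominus>\<^bsub>V\<^esub> x \<in> W" using subspace_neg[OF d] M.minus_swap[OF x y] by simp
  show "z \<in> W +>\<^bsub>V\<^esub> x \<longleftrightarrow> z \<in> W +>\<^bsub>V\<^esub> y"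
    unfolding mem_coset[OF x] mem_coset[OF y]
    using subspaceD(4)[OF W _ d, of "z \<ominus>\<^bsub>V\<^esub> x"] subspaceD(4)[OF W _ e, of "z \<ominus>\<^bsub>V\<^esub> y"]
      M.minus_telescope[OF _ x y, of z] M.minus_telescope[OF _ y x, of z] by auto
qed

lemma coset_self: "x \<in> carrier V \<Longrightarrow> x \<in> W +>\<^bsub>V\<^esub> x"
proof -
  assume x: "x \<in> carrier V"
  hence "x \<ominus>\<^bsub>V\<^esub> x = \<zero>\<^bsub>V\<^esub>" by simp
  with subspaceD(3)[OF W] have "x \<ominus>\<^bsub>V\<^esub> x \<in> W" by (simp only:)
  with x show ?thesis by (simp only: mem_coset)
qed

lemma coset_zero: "W +>\<^bsub>V\<^esub> \<zero>\<^bsub>V\<^esub> = W"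
  using mem_coset[of "\<zero>\<^bsub>V\<^esub>"] M.minus_zero_right subspaceD(2)[OF W] by auto

lemma coset_eq_zero_iff:
  assumes x: "x \<in> carrier V" shows "W +>\<^bsub>V\<^esub> x = W \<longleftrightarrow> x \<in> W"
  using coset_self[OF x] coset_eqI[OF x M.zero_closed] coset_zero M.minus_zero_right[OF x] by auto

lemma coset_add:
  assumes x: "x \<in> carrier V" and y: "y \<in> carrier V"
  shows "(W +>\<^bsub>V\<^esub> x) <+>\<^bsub>V\<^esub> (W +>\<^bsub>V\<^esub> y) = W +>\<^bsub>V\<^esub> (x \<oplus>\<^bsub>V\<^esub> y)"
proof (rule Set.set_eqI)
  fix z
  have xy: "x \<oplus>\<^bsub>V\<^esub> y \<in> carrier V" using x y by simp
  show "z \<in> (W +>\<^bsub>V\<^esub> x) <+>\<^bsub>V\<^esub> (W +>\<^bsub>V\<^esub> y) \<longleftrightarrow> z \<in> W +>\<^bsub>V\<^esub> (x \<oplus>\<^bsub>V\<^esub> y)"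
  proof
    assume "z \<in> (W +>\<^bsub>V\<^esub> x) <+>\<^bsub>V\<^esub> (W +>\<^bsub>V\<^esub> y)"
    then obtain a b where ab: "a \<in> W +>\<^bsub>V\<^esub> x" "b \<in> W +>\<^bsub>V\<^esub> y" "z = a \<oplus>\<^bsub>V\<^esub> b"
      by (auto simp: set_add_def')
    note a = ab(1)[unfolded mem_coset[OF x]] and b = ab(2)[unfolded mem_coset[OF y]]
    have "z \<ominus>\<^bsub>V\<^esub> (x \<oplus>\<^bsub>V\<^esub> y) = (a \<ominus>\<^bsub>V\<^esub> x) \<oplus>\<^bsub>V\<^esub> (b \<ominus>\<^bsub>V\<^esub> y)"
      using a b x y by (simp add: ab(3) M.minus_eq M.minus_add M.a_ac)
    also have "\<dots> \<in> W" using a b by (intro subspaceD(4)[OF W]) auto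
    finally show "z \<in> W +>\<^bsub>V\<^esub> (x \<oplus>\<^bsub>V\<^esub> y)" unfolding mem_coset[OF xy] using a b ab(3) by simp
  next
    assume "z \<in> W +>\<^bsub>V\<^esub> (x \<oplus>\<^bsub>V\<^esub> y)"
    hence z: "z \<in> carrier V" "z \<ominus>\<^bsub>V\<^esub> (x \<oplus>\<^bsub>V\<^esub> y) \<in> W" unfolding mem_coset[OF xy] by auto
    have "(z \<ominus>\<^bsub>V\<^esub> y) \<ominus>\<^bsub>V\<^esub> x = z \<ominus>\<^bsub>V\<^esub> (x \<oplus>\<^bsub>V\<^esub> y)"
      using z x y by (simp add: M.minus_eq M.minus_add M.a_ac)
    hence "z \<ominus>\<^bsub>V\<^esub> y \<in> W +>\<^bsub>V\<^esub> x" unfolding mem_coset[OF x] using z x y by simp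
    moreover have "z = (z \<ominus>\<^bsub>V\<^esub> y) \<oplus>\<^bsub>V\<^esub> y" using z y by (simp add: M.minus_eq M.a_assoc M.l_neg)
    ultimately show "z \<in> (W +>\<^bsub>V\<^esub> x) <+>\<^bsub>V\<^esub> (W +>\<^bsub>V\<^esub> y)"
      using coset_self[OF y] unfolding set_add_def' by blast
  qed
qed

text \<open>
  The operations of a quotient space are written as unions over a coset; they are evaluated at any
  representative, provided that the result does not depend on it.
\<close>

lemma UN_coset:
  assumes x: "x \<in> carrier V" and eq: "\<And>z. z \<in> carrier V \<Longrightarrow> z \<ominus>\<^bsub>V\<^esub> x \<in> W \<Longrightarrow> f z = f x"
  shows "(\<Union>z\<in>W +>\<^bsub>V\<^esub> x. f z) = f x"
proof -
  have *: "f z = f x" if "z \<in> W +>\<^bsub>V\<^esub> x" for z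
    by (rule eq) (use that in \<open>simp_all add: mem_coset[OF x]\<close>)
  have "(\<Union>z\<in>W +>\<^bsub>V\<^esub> x. f z) = (\<Union>z\<in>W +>\<^bsub>V\<^esub> x. f x)"
    by (rule SUP_cong[OF refl *])
  also have "\<dots> = f x" using coset_self[OF x] by blast
  finally show ?thesis .
qed

end

definition coset_map :: "('i, 'k, 'a) vfunctor \<Rightarrow> ('i, 'k, 'b) vfunctor \<Rightarrow> ('i \<Rightarrow> 'a \<Rightarrow> 'b) \<Rightarrow> 'i \<Rightarrow> 'b \<Rightarrow> 'b set" where
  "coset_map H F \<phi> v y = (\<phi> v ` carrier (obj H v)) +>\<^bsub>obj F v\<^esub> y"

context
  fixes I :: "'i :: order set" and K :: "('k, 'm) ring_scheme"
    and H :: "('i, 'k, 'a) vfunctor" and F :: "('i, 'k, 'b) vfunctor" and \<phi>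
  assumes H: "is_vfunctor I K H" and F: "is_vfunctor I K F" and \<phi>: "nat_trans I K H F \<phi>"
begin

lemma nat_trans_coset_map: "nat_trans I K F (coker_functor H F \<phi>) (coset_map H F \<phi>)"
  unfolding nat_trans_def
proof (intro conjI ballI impI)
  fix v assume v: "v \<in> I"
  have Wv: "subspace K (\<phi> v ` carrier (obj H v)) (obj F v)"
    using subfunctor_image[OF H F \<phi>] v by (simp add: subfunctor_def)
  note Fv = is_vfunctor_vectorspace[OF F v]
  interpret vectorspace K "obj F v" by (rule Fv)
  show "coset_map H F \<phi> v \<in> module_hom K (obj F v) (obj (coker_functor H F \<phi>) v)"
  proof (rule module_homI)
    fix x assume "x \<in> carrier (obj F v)"
    thus "coset_map H F \<phi> v x \<in> carrier (obj (coker_functor H F \<phi>) v)"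
      by (auto simp: coset_map_def coker_functor_def quotient_space_def A_RCOSETS_def')
  next
    fix x y assume "x \<in> carrier (obj F v)" "y \<in> carrier (obj F v)"
    thus "coset_map H F \<phi> v (x \<oplus>\<^bsub>obj F v\<^esub> y) = coset_map H F \<phi> v x \<oplus>\<^bsub>obj (coker_functor H F \<phi>) v\<^esub> coset_map H F \<phi> v y"
      by (simp add: coset_map_def coker_functor_def quotient_space_def coset_add[OF Fv Wv])
  next
    fix c x assume cx: "c \<in> carrier K" "x \<in> carrier (obj F v)"
    let ?W = "\<phi> v ` carrier (obj H v)"
    have "(\<Union>z\<in>?W +>\<^bsub>obj F v\<^esub> x. ?W +>\<^bsub>obj F v\<^esub> (c \<odot>\<^bsub>obj F v\<^esub> z)) = ?W +>\<^bsub>obj F v\<^esub> (c \<odot>\<^bsub>obj F v\<^esub> x)"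
    proof (rule UN_coset[OF Fv Wv cx(2)], rule coset_eqI[OF Fv Wv])
      fix z assume z: "z \<in> carrier (obj F v)" "z \<ominus>\<^bsub>obj F v\<^esub> x \<in> ?W"
      have "(c \<odot>\<^bsub>obj F v\<^esub> z) \<ominus>\<^bsub>obj F v\<^esub> (c \<odot>\<^bsub>obj F v\<^esub> x) = c \<odot>\<^bsub>obj F v\<^esub> (z \<ominus>\<^bsub>obj F v\<^esub> x)"
        using cx z(1) by (simp add: M.minus_eq smult_r_distr smult_r_minus)
      with subspaceD(5)[OF Wv cx(1) z(2)]
      show "(c \<odot>\<^bsub>obj F v\<^esub> z) \<ominus>\<^bsub>obj F v\<^esub> (c \<odot>\<^bsub>obj F v\<^esub> x) \<in> ?W" by (simp only:)
    qed (use cx in auto)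
    thus "coset_map H F \<phi> v (c \<odot>\<^bsub>obj F v\<^esub> x) = c \<odot>\<^bsub>obj (coker_functor H F \<phi>) v\<^esub> coset_map H F \<phi> v x"
      by (simp add: coset_map_def coker_functor_def quotient_space_def)
  qed
next
  fix v u x assume vu: "v \<in> I" "u \<in> I" "v \<le> u" and x: "x \<in> carrier (obj F v)"
  let ?W = "\<lambda>v. \<phi> v ` carrier (obj H v)"
  have Wv: "subspace K (?W v) (obj F v)" and Wu: "subspace K (?W u) (obj F u)"
    and Wm: "mor F v u ` ?W v \<subseteq> ?W u"
    using subfunctor_image[OF H F \<phi>] vu by (simp_all add: subfunctor_def)
  note Fv = is_vfunctor_vectorspace[OF F vu(1)] and Fu = is_vfunctor_vectorspace[OF F vu(2)]
  note mc = is_vfunctor_mor_closed[OF F vu]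
  have "(\<Union>z\<in>?W v +>\<^bsub>obj F v\<^esub> x. ?W u +>\<^bsub>obj F u\<^esub> mor F v u z) = ?W u +>\<^bsub>obj F u\<^esub> mor F v u x"
  proof (rule UN_coset[OF Fv Wv x], rule coset_eqI[OF Fu Wu mc mc[OF x]])
    fix z assume z: "z \<in> carrier (obj F v)" "z \<ominus>\<^bsub>obj F v\<^esub> x \<in> ?W v"
    show "mor F v u z \<ominus>\<^bsub>obj F u\<^esub> mor F v u x \<in> ?W u"
      using hom_minus[OF Fv Fu is_vfunctor_mor[OF F vu] z(1) x] Wm z(2) by (metis image_subset_iff)
  qed
  thus "coset_map H F \<phi> u (mor F v u x) = mor (coker_functor H F \<phi>) v u (coset_map H F \<phi> v x)"
    by (simp add: coset_map_def coker_functor_def)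
qed

lemma coset_map_surj: "coset_map H F \<phi> v ` carrier (obj F v) = carrier (obj (coker_functor H F \<phi>) v)"
  by (auto simp: coset_map_def coker_functor_def quotient_space_def A_RCOSETS_def')

lemma coset_map_eq_zero_iff:
  assumes v: "v \<in> I" and x: "x \<in> carrier (obj F v)"
  shows "coset_map H F \<phi> v x = \<zero>\<^bsub>obj (coker_functor H F \<phi>) v\<^esub> \<longleftrightarrow> x \<in> \<phi> v ` carrier (obj H v)"
proof -
  have "subspace K (\<phi> v ` carrier (obj H v)) (obj F v)"
    using subfunctor_image[OF H F \<phi>] v by (simp add: subfunctor_def)
  from coset_eq_zero_iff[OF is_vfunctor_vectorspace[OF F v] this x] show ?thesis
    by (simp add: coset_map_def coker_functor_def quotient_space_def)
qed

lemma is_vfunctor_coker: "is_vfunctor I K (coker_functor H F \<phi>)"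
proof (rule is_vfunctor_surj_image[OF F nat_trans_coset_map coset_map_surj])
  fix v assume v: "v \<in> I"
  interpret Hv: vectorspace K "obj H v" by (rule is_vfunctor_vectorspace[OF H v])
  interpret Fv: vectorspace K "obj F v" by (rule is_vfunctor_vectorspace[OF F v])
  have "\<zero>\<^bsub>obj F v\<^esub> \<in> \<phi> v ` carrier (obj H v)"
    using hom_zero[OF Hv.vectorspace_axioms Fv.vectorspace_axioms nat_trans_hom[OF \<phi> v]]
    by (metis Hv.M.zero_closed imageI)
  thus "coset_map H F \<phi> v \<zero>\<^bsub>obj F v\<^esub> = \<zero>\<^bsub>obj (coker_functor H F \<phi>) v\<^esub>"
    using coset_map_eq_zero_iff[OF v] by simp
qed

end

text \<open>
  The fields \<open>mult\<close> and \<open>one\<close> carry no information for a vector space and are filled arbitrarily.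
\<close>

definition transport :: "('i \<Rightarrow> 'b \<Rightarrow> 'a) \<Rightarrow> ('i, 'k, 'b) vfunctor \<Rightarrow> ('i, 'k, 'a) vfunctor" where
  "transport E X = (let dec = (\<lambda>v. inv_into (carrier (obj X v)) (E v)) in
     \<lparr>obj = (\<lambda>v. \<lparr>carrier = E v ` carrier (obj X v), mult = (\<lambda>x y. x), one = undefined,
        zero = E v \<zero>\<^bsub>obj X v\<^esub>, add = (\<lambda>x y. E v (dec v x \<oplus>\<^bsub>obj X v\<^esub> dec v y)),
        smult = (\<lambda>c x. E v (c \<odot>\<^bsub>obj X v\<^esub> dec v x))\<rparr>),
      mor = (\<lambda>v u x. E u (mor X v u (dec v x)))\<rparr>)"

lemma transport:
  assumes X: "is_vfunctor I K X" and E: "\<And>v. v \<in> I \<Longrightarrow> inj_on (E v) (carrier (obj X v))"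
  shows "is_vfunctor I K (transport E X)" "nat_iso I K X (transport E X) E"
proof -
  have inv: "inv_into (carrier (obj X v)) (E v) (E v x) = x" if "v \<in> I" "x \<in> carrier (obj X v)" for v x
    by (rule inv_into_f_f[OF E[OF that(1)] that(2)])
  have nt: "nat_trans I K X (transport E X) E"
    unfolding nat_trans_def by (auto simp: transport_def inv intro!: module_homI)
  show "is_vfunctor I K (transport E X)"
    by (rule is_vfunctor_surj_image[OF X nt]) (auto simp: transport_def)
  show "nat_iso I K X (transport E X) E"
    by (rule nat_isoI_bij[OF X nt]) (use E in \<open>auto simp: bij_betw_def transport_def\<close>)
qed

text \<open>
  The elements of a cokernel are cosets. A noise system only has members with carriers in the
  universe \<open>'a\<close>, so each coset is replaced by a chosen representative.
\<close>

lemma exists_cokernel: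
  fixes H F :: "('i :: order, 'k, 'a) vfunctor"
  assumes H: "is_vfunctor I K H" and F: "is_vfunctor I K F" and \<phi>: "nat_trans I K H F \<phi>"
  shows "\<exists>(Q :: ('i, 'k, 'a) vfunctor) p. is_vfunctor I K Q \<and> nat_trans I K F Q p \<and>
    (\<forall>v\<in>I. p v ` carrier (obj F v) = carrier (obj Q v)) \<and>
    (\<forall>v\<in>I. \<forall>y\<in>carrier (obj F v). p v y = \<zero>\<^bsub>obj Q v\<^esub> \<longleftrightarrow> y \<in> \<phi> v ` carrier (obj H v))"
proof -
  let ?C = "coker_functor H F \<phi>" and ?W = "\<lambda>v. \<phi> v ` carrier (obj H v)"
  note C = is_vfunctor_coker[OF H F \<phi>] and surj = coset_map_surj[OF H F \<phi>]
  define E where "E = (\<lambda>(v :: 'i) (X :: 'a set). SOME y. y \<in> X)"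
  have coset: "X = ?W v +>\<^bsub>obj F v\<^esub> E v X" if v: "v \<in> I" and X: "X \<in> carrier (obj ?C v)" for v X
  proof -
    note Fv = is_vfunctor_vectorspace[OF F v]
    have W: "subspace K (?W v) (obj F v)" using subfunctor_image[OF H F \<phi>] v by (simp add: subfunctor_def)
    obtain x where x: "x \<in> carrier (obj F v)" "X = ?W v +>\<^bsub>obj F v\<^esub> x"
      using X surj[of v] by (auto simp: coset_map_def)
    have "E v X \<in> X" unfolding E_def by (rule someI[of _ x]) (use coset_self[OF Fv W x(1)] x(2) in simp)
    hence "E v X \<in> carrier (obj F v)" "E v X \<ominus>\<^bsub>obj F v\<^esub> x \<in> ?W v"
      unfolding x(2) mem_coset[OF Fv W x(1)] by auto
    from coset_eqI[OF Fv W this(1) x(1) this(2)] x(2) show ?thesis by simp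
  qed
  have inj: "inj_on (E v) (carrier (obj ?C v))" if "v \<in> I" for v
    using coset[OF that] by (intro inj_onI) metis
  note t = transport[OF C inj]
  let ?p = "\<lambda>v y. E v (coset_map H F \<phi> v y)"
  have "?p v y = \<zero>\<^bsub>obj (transport E ?C) v\<^esub> \<longleftrightarrow> y \<in> ?W v" if v: "v \<in> I" and y: "y \<in> carrier (obj F v)" for v y
  proof -
    have "?p v y = \<zero>\<^bsub>obj (transport E ?C) v\<^esub> \<longleftrightarrow> coset_map H F \<phi> v y = \<zero>\<^bsub>obj ?C v\<^esub>"
      using inj_on_eq_iff[OF inj[OF v] nat_trans_closed[OF nat_trans_coset_map[OF H F \<phi>] v y] is_vfunctor_zero(1)[OF C v]]
      by (simp add: transport_def)
    thus ?thesis using coset_map_eq_zero_iff[OF H F \<phi> v y] by simp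
  qed
  moreover have "?p v ` carrier (obj F v) = carrier (obj (transport E ?C) v)" for v
    using surj[of v] by (simp add: transport_def image_image[symmetric])
  moreover note t(1) nat_trans_comp[OF nat_trans_coset_map[OF H F \<phi>] nat_iso_nat_trans[OF t(2)]]
  ultimately show ?thesis by (intro exI[of _ "transport E ?C"] exI[of _ ?p]) auto
qed

section \<open>Tameness as local constancy off a grid\<close>

text \<open>
  The half-open interval from \<open>v\<close> to \<open>u\<close> contains no point of the grid \<open>\<alpha> \<nat>\<close> exactly when
  \<open>b_floor \<alpha> v = b_floor \<alpha> u\<close>. In this form tameness passes to finer grids, to kernels, to cokernels
  and to subfunctors generated by one element.
\<close>

definition grid_const :: "rat \<Rightarrow> (rat, 'k, 'a) vfunctor \<Rightarrow> bool" where
  "grid_const \<alpha> F \<longleftrightarrow> (\<forall>v u. 0 \<le> v \<longrightarrow> v \<le> u \<longrightarrow> (\<forall>k::nat. \<not> (v < \<alpha> * of_nat k \<and> \<alpha> * of_nat k \<le> u)) \<longrightarrow>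
      bij_betw (mor F v u) (carrier (obj F v)) (carrier (obj F u)))"

definition on_grid :: "rat \<Rightarrow> rat \<Rightarrow> bool" where
  "on_grid \<gamma> a \<longleftrightarrow> (\<exists>k::nat. a = \<gamma> * of_nat k)"

text \<open>
  Two rational numbers have a common denominator.
\<close>

lemma common_grid2:
  assumes "a \<ge> 0" "b \<ge> 0"
  shows "\<exists>\<gamma>>0. on_grid \<gamma> a \<and> on_grid \<gamma> b"
proof -
  obtain n d where a: "a = Fract n d" "d > 0" by (cases a) auto
  obtain m e where b: "b = Fract m e" "e > 0" by (cases b) auto
  have n: "n \<ge> 0" "m \<ge> 0" using assms a b by (auto simp: zero_le_Fract_iff)
  have "a = 1 / of_int (d * e) * of_nat (nat (n * e))" "b = 1 / of_int (d * e) * of_nat (nat (m * d))"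
    using a b n by (auto simp: Fract_of_int_quotient)
  moreover have "(0::rat) < 1 / of_int (d * e)" using a b by simp
  ultimately show ?thesis unfolding on_grid_def by blast
qed

lemma on_grid_trans: "on_grid \<gamma> \<alpha> \<Longrightarrow> on_grid \<alpha> a \<Longrightarrow> on_grid \<gamma> a"
  unfolding on_grid_def by (metis mult.assoc of_nat_mult)

lemma common_grid:
  assumes "finite A" "\<And>a. a \<in> A \<Longrightarrow> 0 \<le> a"
  shows "\<exists>\<gamma>>0. \<forall>a\<in>A. on_grid \<gamma> a"
  using assms
proof (induction A)
  case empty show ?case by (rule exI[of _ 1]) simp
next
  case (insert x A)
  then obtain \<gamma> where \<gamma>: "\<gamma> > 0" "\<forall>a\<in>A. on_grid \<gamma> a" by auto
  obtain \<delta> where "\<delta> > 0" "on_grid \<delta> \<gamma>" "on_grid \<delta> x"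
    using common_grid2[of \<gamma> x] \<gamma> insert.prems by auto
  thus ?case using \<gamma> on_grid_trans by (intro exI[of _ \<delta>]) auto
qed

lemma grid_const_refine:
  assumes F: "grid_const \<alpha> F" and "on_grid \<gamma> \<alpha>"
  shows "grid_const \<gamma> F"
proof -
  obtain k :: nat where k: "\<alpha> = \<gamma> * of_nat k" using assms(2) by (auto simp: on_grid_def)
  show ?thesis unfolding grid_const_def
  proof (intro allI impI)
    fix v u :: rat assume vu: "0 \<le> v" "v \<le> u" and n: "\<forall>j::nat. \<not> (v < \<gamma> * of_nat j \<and> \<gamma> * of_nat j \<le> u)"
    have "\<not> (v < \<alpha> * of_nat j \<and> \<alpha> * of_nat j \<le> u)" for j :: nat
      using n[rule_format, of "k * j"] by (simp add: k mult.assoc)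
    with F vu show "bij_betw (mor F v u) (carrier (obj F v)) (carrier (obj F u))"
      unfolding grid_const_def by blast
  qed
qed

lemma b_floor_bounds:
  assumes "\<alpha> > 0" "v \<ge> 0"
  shows "\<alpha> * of_nat (b_floor \<alpha> v) \<le> v" "v < \<alpha> * of_nat (Suc (b_floor \<alpha> v))"
proof -
  have le_iff: "\<alpha> * of_nat n \<le> v \<longleftrightarrow> n \<le> nat \<lfloor>v / \<alpha>\<rfloor>" for n
    using assms by (simp add: le_nat_iff le_floor_iff field_simps)
  have "b_floor \<alpha> v = nat \<lfloor>v / \<alpha>\<rfloor>"
    unfolding b_floor_def le_iff by (rule Greatest_equality) auto
  with le_iff have *: "\<alpha> * of_nat n \<le> v \<longleftrightarrow> n \<le> b_floor \<alpha> v" for n by simp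
  show "\<alpha> * of_nat (b_floor \<alpha> v) \<le> v" using * by blast
  show "v < \<alpha> * of_nat (Suc (b_floor \<alpha> v))" using *[of "Suc (b_floor \<alpha> v)"] by simp
qed

lemma b_floor_mono:
  assumes "\<alpha> > 0" "0 \<le> v" "v \<le> u"
  shows "b_floor \<alpha> v \<le> b_floor \<alpha> u"
proof -
  have "\<alpha> * of_nat (b_floor \<alpha> v) < \<alpha> * of_nat (Suc (b_floor \<alpha> u))"
    using b_floor_bounds[of \<alpha> v] b_floor_bounds[of \<alpha> u] assms by linarith
  hence "(of_nat (b_floor \<alpha> v) :: rat) < of_nat (Suc (b_floor \<alpha> u))"
    using assms(1) by (simp add: mult_less_cancel_left)
  thus ?thesis by (simp only: of_nat_less_iff less_Suc_eq_le)
qed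

lemma b_floor_grid [simp]: "\<alpha> > 0 \<Longrightarrow> b_floor \<alpha> (\<alpha> * of_nat n) = n"
  unfolding b_floor_def by (auto intro!: Greatest_equality)

text \<open>
  A tame functor is constant between grid points because \<open>\<alpha>\<^sup>!G\<close> is. Conversely the restriction of \<open>F\<close>
  to the grid recovers \<open>F\<close>: the structure map from the last grid point before \<open>v\<close> is an isomorphism.
\<close>

lemma tame_iff_grid_const:
  fixes F :: "(rat, 'k, 'a) vfunctor"
  shows "tame K F \<longleftrightarrow> is_vfunctor nnrat K F \<and> (\<exists>\<alpha>>0. grid_const \<alpha> F)"
proof safe
  assume "tame K F"
  then show F: "is_vfunctor nnrat K F" by (simp add: tame_def)
  from \<open>tame K F\<close> obtain \<alpha> \<phi> and G :: "(nat, 'k, 'a) vfunctor"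
    where \<alpha>: "\<alpha> > 0" and G: "is_vfunctor UNIV K G"
    and \<phi>: "nat_iso nnrat K F (extend_functor \<alpha> G) \<phi>"
    unfolding tame_def isomorphic_def by blast
  have "grid_const \<alpha> F" unfolding grid_const_def
  proof (intro allI impI)
    fix v u :: rat assume vu: "0 \<le> v" "v \<le> u" and n: "\<forall>k::nat. \<not> (v < \<alpha> * of_nat k \<and> \<alpha> * of_nat k \<le> u)"
    have "b_floor \<alpha> v = b_floor \<alpha> u"
    proof (rule ccontr)
      assume "b_floor \<alpha> v \<noteq> b_floor \<alpha> u"
      hence le: "Suc (b_floor \<alpha> v) \<le> b_floor \<alpha> u" using b_floor_mono[OF \<alpha> vu] by simp
      have "\<alpha> * of_nat (Suc (b_floor \<alpha> v)) \<le> \<alpha> * of_nat (b_floor \<alpha> u)"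
        using \<alpha> le by (intro mult_left_mono) (simp_all only: of_nat_le_iff less_imp_le)
      thus False using n b_floor_bounds[of \<alpha> v] b_floor_bounds[of \<alpha> u] vu \<alpha> by (meson order_trans)
    qed
    hence id: "mor (extend_functor \<alpha> G) v u x = x" "obj (extend_functor \<alpha> G) v = obj (extend_functor \<alpha> G) u"
      if "x \<in> carrier (obj (extend_functor \<alpha> G) v)" for x
      using that is_vfunctor_mor_id[OF G] by (auto simp: extend_functor_def)
    have eq: "\<phi> u (mor F v u x) = \<phi> v x" if "x \<in> carrier (obj F v)" for x
      using nat_trans_natural[OF nat_iso_nat_trans[OF \<phi>], of v u x] vu that id(1)
        nat_trans_closed[OF nat_iso_nat_trans[OF \<phi>], of v x] by simp
    note bv = nat_iso_bij[OF \<phi>, of v] and bu = nat_iso_bij[OF \<phi>, of u]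
    have oeq: "obj (extend_functor \<alpha> G) v = obj (extend_functor \<alpha> G) u"
      using \<open>b_floor \<alpha> v = b_floor \<alpha> u\<close> by (simp add: extend_functor_def)
    have "bij_betw (\<lambda>x. \<phi> u (mor F v u x)) (carrier (obj F v)) (carrier (obj (extend_functor \<alpha> G) u))"
      using bv[unfolded oeq] vu by (simp add: eq cong: bij_betw_cong)
    hence "bij_betw (\<phi> u \<circ> mor F v u) (carrier (obj F v)) (carrier (obj (extend_functor \<alpha> G) u))"
      by (simp add: comp_def)
    moreover have "mor F v u ` carrier (obj F v) \<subseteq> carrier (obj F u)"
      using is_vfunctor_mor_closed[OF F, of v u] vu by auto
    ultimately show "bij_betw (mor F v u) (carrier (obj F v)) (carrier (obj F u))"
      using bij_betw_comp_iff2[of "\<phi> u" "carrier (obj F u)" "carrier (obj (extend_functor \<alpha> G) u)" "mor F v u"]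
        bu vu by auto
  qed
  thus "\<exists>\<alpha>>0. grid_const \<alpha> F" using \<alpha> by blast
next
  fix \<alpha> assume F: "is_vfunctor nnrat K F" and \<alpha>: "0 < \<alpha>" and g: "grid_const \<alpha> F"
  define G :: "(nat, 'k, 'a) vfunctor" where
    "G = \<lparr>obj = (\<lambda>n. obj F (\<alpha> * of_nat n)), mor = (\<lambda>n m. mor F (\<alpha> * of_nat n) (\<alpha> * of_nat m))\<rparr>"
  have le: "\<alpha> * of_nat n \<le> \<alpha> * of_nat m" if "n \<le> m" for n m :: nat
    using \<alpha> that by (simp add: mult_left_mono)
  have pos: "0 \<le> \<alpha> * of_nat n" for n :: nat using \<alpha> by simp
  have G: "is_vfunctor UNIV K G"
    unfolding is_vfunctor_def G_def
    using F le pos by (auto simp: is_vfunctor_vectorspace is_vfunctor_mor is_vfunctor_mor_id is_vfunctor_mor_comp)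
  define \<phi> where "\<phi> v = mor F (\<alpha> * of_nat (b_floor \<alpha> v)) v" for v
  have b: "\<alpha> * of_nat (b_floor \<alpha> v) \<le> v" if "0 \<le> v" for v using b_floor_bounds[OF \<alpha> that] by simp
  have E: "is_vfunctor nnrat K (extend_functor \<alpha> G)"
    unfolding is_vfunctor_def
    by (auto simp: extend_functor_def is_vfunctor_vectorspace[OF G] is_vfunctor_mor[OF G]
        is_vfunctor_mor_id[OF G] is_vfunctor_mor_comp[OF G] b_floor_mono[OF \<alpha>])
  have "nat_iso nnrat K (extend_functor \<alpha> G) F \<phi>"
  proof (rule nat_isoI_bij[OF E])
    show "nat_trans nnrat K (extend_functor \<alpha> G) F \<phi>"
      unfolding nat_trans_def
    proof (intro conjI ballI impI)
      fix v :: rat assume "v \<in> nnrat"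
      thus "\<phi> v \<in> module_hom K (obj (extend_functor \<alpha> G) v) (obj F v)"
        using is_vfunctor_mor[OF F, of "\<alpha> * of_nat (b_floor \<alpha> v)" v] b pos
        by (simp add: \<phi>_def extend_functor_def G_def)
    next
      fix v u :: rat and x assume vu: "v \<in> nnrat" "u \<in> nnrat" "v \<le> u" "x \<in> carrier (obj (extend_functor \<alpha> G) v)"
      let ?a = "\<alpha> * of_nat (b_floor \<alpha> v)" and ?b = "\<alpha> * of_nat (b_floor \<alpha> u)"
      have ab: "?a \<le> ?b" using le b_floor_mono[OF \<alpha>] vu by auto
      have x: "x \<in> carrier (obj F ?a)" using vu by (simp add: extend_functor_def G_def)
      have "mor F ?b u (mor F ?a ?b x) = mor F ?a u x"
        by (rule is_vfunctor_mor_comp[OF F]) (use vu ab b pos x in auto)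
      also have "\<dots> = mor F v u (mor F ?a v x)"
        by (rule is_vfunctor_mor_comp[OF F, symmetric]) (use vu ab b pos x in auto)
      finally show "\<phi> u (mor (extend_functor \<alpha> G) v u x) = mor F v u (\<phi> v x)"
        by (simp add: \<phi>_def extend_functor_def G_def)
    qed
    fix v :: rat assume v: "v \<in> nnrat"
    have "\<not> (\<alpha> * of_nat (b_floor \<alpha> v) < \<alpha> * of_nat k \<and> \<alpha> * of_nat k \<le> v)" for k :: nat
    proof
      assume k: "\<alpha> * of_nat (b_floor \<alpha> v) < \<alpha> * of_nat k \<and> \<alpha> * of_nat k \<le> v"
      hence "b_floor \<alpha> v < k" using \<alpha> by (simp add: mult_less_cancel_left)
      hence "\<alpha> * of_nat (Suc (b_floor \<alpha> v)) \<le> \<alpha> * of_nat k" by (intro le) simp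
      thus False using k b_floor_bounds(2)[OF \<alpha>, of v] v by simp
    qed
    thus "bij_betw (\<phi> v) (carrier (obj (extend_functor \<alpha> G) v)) (carrier (obj F v))"
      using g b[of v] v pos unfolding grid_const_def \<phi>_def extend_functor_def G_def by simp
  qed
  hence "isomorphic nnrat K F (extend_functor \<alpha> G)"
    using isomorphic_sym isomorphic_def by blast
  thus "tame K F" using F G \<alpha> unfolding tame_def by blast
qed

lemma tame_vfunctor: "tame K F \<Longrightarrow> is_vfunctor nnrat K F"
  by (simp add: tame_def)

lemma tame_common_grid2:
  assumes "tame K F" "tame K G"
  shows "\<exists>\<gamma>>0. grid_const \<gamma> F \<and> grid_const \<gamma> G"
proof -
  obtain \<alpha> \<beta> where *: "\<alpha> > 0" "grid_const \<alpha> F" "\<beta> > 0" "grid_const \<beta> G"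
    using assms unfolding tame_iff_grid_const by auto
  obtain \<gamma> where \<gamma>: "\<gamma> > 0" "on_grid \<gamma> \<alpha>" "on_grid \<gamma> \<beta>" using common_grid2[of \<alpha> \<beta>] * by auto
  show ?thesis
    using \<gamma>(1) grid_const_refine[OF *(2) \<gamma>(2)] grid_const_refine[OF *(4) \<gamma>(3)] by blast
qed

lemma grid_const_ker:
  assumes F: "is_vfunctor nnrat K F" and G: "is_vfunctor nnrat K G" and \<phi>: "nat_trans nnrat K F G \<phi>"
    and "grid_const \<gamma> F" "grid_const \<gamma> G"
  shows "grid_const \<gamma> (ker_functor F G \<phi>)"
  unfolding grid_const_def
proof (intro allI impI)
  fix v u :: rat assume vu: "0 \<le> v" "v \<le> u" and n: "\<forall>k::nat. \<not> (v < \<gamma> * of_nat k \<and> \<gamma> * of_nat k \<le> u)"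
  let ?Z = "\<lambda>v. {x \<in> carrier (obj F v). \<phi> v x = \<zero>\<^bsub>obj G v\<^esub>}"
  have bF: "bij_betw (mor F v u) (carrier (obj F v)) (carrier (obj F u))"
    and bG: "bij_betw (mor G v u) (carrier (obj G v)) (carrier (obj G u))"
    using assms(4,5) vu n unfolding grid_const_def by blast+
  have v: "v \<in> nnrat" "u \<in> nnrat" using vu by auto
  have zero: "\<zero>\<^bsub>obj G v\<^esub> \<in> carrier (obj G v)" "mor G v u \<zero>\<^bsub>obj G v\<^esub> = \<zero>\<^bsub>obj G u\<^esub>"
    using is_vfunctor_vectorspace[OF G v(1)] hom_zero[OF is_vfunctor_vectorspace[OF G v(1)]
      is_vfunctor_vectorspace[OF G v(2)] is_vfunctor_mor[OF G v vu(2)]]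
    by (auto simp: vectorspace_def module_def abelian_group_def abelian_monoid.zero_closed)
  have "mor F v u ` ?Z v = ?Z u"
  proof
    show "mor F v u ` ?Z v \<subseteq> ?Z u"
      using subfunctor_ker[OF F G \<phi>] v vu unfolding subfunctor_def by blast
    show "?Z u \<subseteq> mor F v u ` ?Z v"
    proof
      fix y assume y: "y \<in> ?Z u"
      then obtain x where x: "x \<in> carrier (obj F v)" "y = mor F v u x"
        using bF unfolding bij_betw_def by blast
      have "mor G v u (\<phi> v x) = mor G v u \<zero>\<^bsub>obj G v\<^esub>"
        using nat_trans_natural[OF \<phi> v vu(2) x(1)] x y zero by simp
      hence "\<phi> v x = \<zero>\<^bsub>obj G v\<^esub>"
        using bG zero nat_trans_closed[OF \<phi> v(1) x(1)] unfolding bij_betw_def inj_on_def by blast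
      with x show "y \<in> mor F v u ` ?Z v" by blast
    qed
  qed
  moreover have "inj_on (mor F v u) (?Z v)"
    using bF by (auto simp: bij_betw_def intro: inj_on_subset)
  ultimately show "bij_betw (mor (ker_functor F G \<phi>) v u) (carrier (obj (ker_functor F G \<phi>) v))
      (carrier (obj (ker_functor F G \<phi>) u))"
    by (simp add: ker_functor_def bij_betw_def)
qed

lemma tame_ker:
  assumes F: "tame K F" and G: "tame K G" and \<phi>: "nat_trans nnrat K F G \<phi>"
  shows "tame K (ker_functor F G \<phi>)"
proof -
  note F' = tame_vfunctor[OF F] and G' = tame_vfunctor[OF G]
  obtain \<gamma> where "\<gamma> > 0" "grid_const \<gamma> F" "grid_const \<gamma> G" using tame_common_grid2[OF F G] by blast
  thus ?thesis unfolding tame_iff_grid_const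
    using is_vfunctor_ker[OF F' G' \<phi>] grid_const_ker[OF F' G' \<phi>] by blast
qed

text \<open>Where the structure maps of \<open>X\<close> and \<open>Y\<close> are bijective so is that of \<open>Q\<close>, by the five lemma.\<close>

lemma tame_cokernel:
  assumes X: "tame K X" and Y: "tame K Y" and Q: "is_vfunctor nnrat K Q"
    and f: "nat_trans nnrat K X Y f" and p: "nat_trans nnrat K Y Q p"
    and surj: "\<And>v. 0 \<le> v \<Longrightarrow> p v ` carrier (obj Y v) = carrier (obj Q v)"
    and ker: "\<And>v y. 0 \<le> v \<Longrightarrow> y \<in> carrier (obj Y v) \<Longrightarrow> p v y = \<zero>\<^bsub>obj Q v\<^esub> \<longleftrightarrow> y \<in> f v ` carrier (obj X v)"
  shows "tame K Q"
proof -
  note X' = tame_vfunctor[OF X] and Y' = tame_vfunctor[OF Y]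
  obtain \<gamma> where \<gamma>: "\<gamma> > 0" "grid_const \<gamma> X" "grid_const \<gamma> Y" using tame_common_grid2[OF X Y] by blast
  have "grid_const \<gamma> Q" unfolding grid_const_def
  proof (intro allI impI)
    fix v u :: rat assume vu: "0 \<le> v" "v \<le> u" and n: "\<forall>k::nat. \<not> (v < \<gamma> * of_nat k \<and> \<gamma> * of_nat k \<le> u)"
    have bX: "bij_betw (mor X v u) (carrier (obj X v)) (carrier (obj X u))"
      and bY: "bij_betw (mor Y v u) (carrier (obj Y v)) (carrier (obj Y u))"
      using \<gamma>(2,3) vu n unfolding grid_const_def by blast+
    have v: "v \<in> nnrat" "u \<in> nnrat" and u: "0 \<le> u" using vu by auto
    show "bij_betw (mor Q v u) (carrier (obj Q v)) (carrier (obj Q u))"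
      unfolding bij_betw_def
    proof
      show "inj_on (mor Q v u) (carrier (obj Q v))"
      proof (rule hom_inj_on[OF is_vfunctor_vectorspace[OF Q v(1)] is_vfunctor_vectorspace[OF Q v(2)]
            is_vfunctor_mor[OF Q v vu(2)]])
        fix q assume q: "q \<in> carrier (obj Q v)" "mor Q v u q = \<zero>\<^bsub>obj Q u\<^esub>"
        obtain y where y: "y \<in> carrier (obj Y v)" "q = p v y" using surj[OF vu(1)] q(1) by blast
        have my: "mor Y v u y \<in> carrier (obj Y u)" by (rule is_vfunctor_mor_closed[OF Y' v vu(2) y(1)])
        have "p u (mor Y v u y) = \<zero>\<^bsub>obj Q u\<^esub>"
          using nat_trans_natural[OF p v vu(2) y(1)] q y by simp
        then obtain x where x: "x \<in> carrier (obj X u)" "mor Y v u y = f u x" using ker[OF u my] by blast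
        obtain x' where x': "x' \<in> carrier (obj X v)" "x = mor X v u x'"
          using bX x(1) unfolding bij_betw_def by blast
        have "mor Y v u y = mor Y v u (f v x')"
          using nat_trans_natural[OF f v vu(2) x'(1)] x x' by simp
        hence "y = f v x'"
          using bY y(1) nat_trans_closed[OF f v(1) x'(1)] unfolding bij_betw_def inj_on_def by blast
        thus "q = \<zero>\<^bsub>obj Q v\<^esub>" using ker[OF vu(1) y(1)] y x' by blast
      qed
      show "mor Q v u ` carrier (obj Q v) = carrier (obj Q u)"
      proof -
        have "mor Q v u ` p v ` carrier (obj Y v) = p u ` mor Y v u ` carrier (obj Y v)"
          unfolding image_image by (intro image_cong refl) (simp add: nat_trans_natural[OF p v vu(2)])
        thus ?thesis using surj[OF vu(1)] surj[OF u] bY unfolding bij_betw_def by simp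
      qed
    qed
  qed
  thus ?thesis unfolding tame_iff_grid_const using Q \<gamma>(1) by blast
qed

section \<open>Closure properties of noise systems\<close>

lemma noise_systemD:
  assumes "noise_system K S"
  shows "\<forall>\<epsilon>\<in>nnrat. \<forall>F\<in>S \<epsilon>. tame K F"
    and "\<forall>\<epsilon>\<in>nnrat. \<forall>Z. is_vfunctor nnrat K Z \<and> zero_functor nnrat Z \<longrightarrow> Z \<in> S \<epsilon>"
    and "\<forall>\<tau>\<in>nnrat. \<forall>\<epsilon>\<in>nnrat. \<tau> < \<epsilon> \<longrightarrow> S \<tau> \<subseteq> S \<epsilon>"
    and "\<forall>F G H f g. tame K F \<and> tame K G \<and> tame K H \<and> short_exact nnrat K F G H f g \<longrightarrow>
        (\<forall>\<epsilon>\<in>nnrat. G \<in> S \<epsilon> \<longrightarrow> F \<in> S \<epsilon> \<and> H \<in> S \<epsilon>) \<and>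
        (\<forall>\<epsilon>\<in>nnrat. \<forall>\<tau>\<in>nnrat. F \<in> S \<epsilon> \<and> H \<in> S \<tau> \<longrightarrow> G \<in> S (\<epsilon> + \<tau>))"
  using assms by (unfold noise_system_def) (elim conjE, assumption)+

lemma noise_tame: "noise_system K S \<Longrightarrow> 0 \<le> \<epsilon> \<Longrightarrow> X \<in> S \<epsilon> \<Longrightarrow> tame K X"
  using noise_systemD(1) by (metis atLeast_iff)

lemma noise_zero: "noise_system K S \<Longrightarrow> 0 \<le> \<epsilon> \<Longrightarrow> is_vfunctor nnrat K Z \<Longrightarrow> zero_functor nnrat Z \<Longrightarrow> Z \<in> S \<epsilon>"
  using noise_systemD(2) by (metis atLeast_iff)

lemma noise_mono:
  assumes "noise_system K S" "0 \<le> \<tau>" "\<tau> \<le> \<epsilon>" "X \<in> S \<tau>"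
  shows "X \<in> S \<epsilon>"
  using noise_systemD(3)[OF assms(1), rule_format, of \<tau> \<epsilon>] assms(2-4) by (cases "\<tau> = \<epsilon>") auto

lemma noise_short_exact:
  assumes "noise_system K S" "tame K F" "tame K G" "tame K H" "short_exact nnrat K F G H f g"
  shows "0 \<le> \<epsilon> \<Longrightarrow> G \<in> S \<epsilon> \<Longrightarrow> F \<in> S \<epsilon>" "0 \<le> \<epsilon> \<Longrightarrow> G \<in> S \<epsilon> \<Longrightarrow> H \<in> S \<epsilon>"
    "0 \<le> \<epsilon> \<Longrightarrow> 0 \<le> \<tau> \<Longrightarrow> F \<in> S \<epsilon> \<Longrightarrow> H \<in> S \<tau> \<Longrightarrow> G \<in> S (\<epsilon> + \<tau>)"
proof -
  from noise_systemD(4)[OF assms(1), rule_format, of F G H f g] assms(2-5)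
  show "0 \<le> \<epsilon> \<Longrightarrow> G \<in> S \<epsilon> \<Longrightarrow> F \<in> S \<epsilon>" "0 \<le> \<epsilon> \<Longrightarrow> G \<in> S \<epsilon> \<Longrightarrow> H \<in> S \<epsilon>"
    "0 \<le> \<epsilon> \<Longrightarrow> 0 \<le> \<tau> \<Longrightarrow> F \<in> S \<epsilon> \<Longrightarrow> H \<in> S \<tau> \<Longrightarrow> G \<in> S (\<epsilon> + \<tau>)"
    by auto
qed

text \<open>
  \<open>X\<close> is the kernel of the cokernel of \<open>f\<close>, and this cokernel is tame.
\<close>

lemma noise_sub:
  fixes X Y :: "(rat, 'k, 'a) vfunctor"
  assumes S: "noise_system K S" "0 \<le> \<epsilon>" "Y \<in> S \<epsilon>" and X: "tame K X"
    and f: "nat_trans nnrat K X Y f" and inj: "\<And>v. 0 \<le> v \<Longrightarrow> inj_on (f v) (carrier (obj X v))"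
  shows "X \<in> S \<epsilon>"
proof -
  note Y = noise_tame[OF S]
  note X' = tame_vfunctor[OF X] and Y' = tame_vfunctor[OF Y]
  obtain Q :: "(rat, 'k, 'a) vfunctor" and p where Q': "is_vfunctor nnrat K Q" and p: "nat_trans nnrat K Y Q p"
    and surj: "\<forall>v\<in>nnrat. p v ` carrier (obj Y v) = carrier (obj Q v)"
    and zero_iff: "\<forall>v\<in>nnrat. \<forall>y\<in>carrier (obj Y v). p v y = \<zero>\<^bsub>obj Q v\<^esub> \<longleftrightarrow> y \<in> f v ` carrier (obj X v)"
    using exists_cokernel[OF X' Y' f] by blast
  have Q: "tame K Q"
    by (rule tame_cokernel[OF X Y Q' f p]) (use surj zero_iff in auto)
  have "short_exact nnrat K X Y Q f p"
    unfolding short_exact_def using f p inj zero_iff surj nat_trans_closed[OF f] by auto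
  from noise_short_exact(1)[OF S(1) X Y Q this S(2,3)] show ?thesis .
qed

lemma short_exact_ker:
  assumes Y: "is_vfunctor nnrat K Y" and X: "is_vfunctor nnrat K X" and g: "nat_trans nnrat K Y X g"
    and surj: "\<And>v. 0 \<le> v \<Longrightarrow> g v ` carrier (obj Y v) = carrier (obj X v)"
  shows "short_exact nnrat K (ker_functor Y X g) Y X (\<lambda>v x. x) g"
  unfolding short_exact_def
  using g surj nat_trans_restrict_dom[OF nat_trans_id[OF Y], of "\<lambda>v. {x \<in> carrier (obj Y v). g v x = \<zero>\<^bsub>obj X v\<^esub>}"]
  by (auto simp: ker_functor_def)

text \<open>
  \<open>X\<close> is the cokernel of the kernel of \<open>g\<close>. Because \<open>Y\<close> may have its carriers in another type, this also
  gives closure under isomorphisms; applied to the addition map it passes from a direct sum to the sum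
  of two subfunctors.
\<close>

lemma noise_quot:
  assumes S: "noise_system K S" "0 \<le> \<epsilon>" "in_upto_iso nnrat K Y (S \<epsilon>)" and X: "tame K X"
    and g: "nat_trans nnrat K Y X g"
    and surj: "\<And>v. 0 \<le> v \<Longrightarrow> carrier (obj X v) \<subseteq> g v ` carrier (obj Y v)"
  shows "X \<in> S \<epsilon>"
proof -
  obtain Y' \<phi> where Y': "Y' \<in> S \<epsilon>" and \<phi>: "nat_iso nnrat K Y' Y \<phi>"
    using S(3) isomorphic_sym unfolding in_upto_iso_def isomorphic_def by blast
  note tY' = noise_tame[OF S(1,2) Y']
  let ?g = "\<lambda>v x. g v (\<phi> v x)"
  have g': "nat_trans nnrat K Y' X ?g" by (rule nat_trans_comp[OF nat_iso_nat_trans[OF \<phi>] g])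
  have "?g v ` carrier (obj Y' v) = carrier (obj X v)" if v: "0 \<le> v" for v
  proof
    show "?g v ` carrier (obj Y' v) \<subseteq> carrier (obj X v)" using nat_trans_closed[OF g'] v by auto
    have "\<phi> v ` carrier (obj Y' v) = carrier (obj Y v)" using nat_iso_bij[OF \<phi>, of v] v by (simp add: bij_betw_def)
    thus "carrier (obj X v) \<subseteq> ?g v ` carrier (obj Y' v)" using surj[OF v] by (auto simp: image_image[symmetric])
  qed
  from noise_short_exact(2)[OF S(1) tame_ker[OF tY' X g'] tY' X
      short_exact_ker[OF tame_vfunctor[OF tY'] tame_vfunctor[OF X] g' this] S(2) Y']
  show ?thesis by simp
qed

lemma in_upto_iso_self:
  "noise_system K S \<Longrightarrow> 0 \<le> \<epsilon> \<Longrightarrow> X \<in> S \<epsilon> \<Longrightarrow> in_upto_iso nnrat K X (S \<epsilon>)"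
  unfolding in_upto_iso_def using isomorphic_refl[OF tame_vfunctor[OF noise_tame]] by blast

section \<open>Combinations of elements born at different times\<close>

text \<open>
  The combination at time \<open>q\<close> of elements \<open>x b \<in> F (s b)\<close>; the coefficients of elements that are not yet
  born at time \<open>q\<close> do not count.
\<close>

definition comb :: "(rat, 'k, 'a) vfunctor \<Rightarrow> 'b set \<Rightarrow> ('b \<Rightarrow> rat) \<Rightarrow> ('b \<Rightarrow> 'a) \<Rightarrow> rat \<Rightarrow> ('b \<Rightarrow> 'k) \<Rightarrow> 'a" where
  "comb F B s x q c = (\<Oplus>\<^bsub>obj F q\<^esub>b\<in>{b \<in> B. s b \<le> q}. c b \<odot>\<^bsub>obj F q\<^esub> mor F (s b) q (x b))"

locale family =
  fixes K :: "('k, 'm) ring_scheme" and F :: "(rat, 'k, 'a) vfunctor"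
    and B :: "'b set" and s :: "'b \<Rightarrow> rat" and x :: "'b \<Rightarrow> 'a"
  assumes vf: "is_vfunctor nnrat K F" and finite_B: "finite B"
    and s_nonneg: "\<And>b. b \<in> B \<Longrightarrow> 0 \<le> s b"
    and x_closed: "\<And>b. b \<in> B \<Longrightarrow> x b \<in> carrier (obj F (s b))"
begin

lemma vs: "0 \<le> q \<Longrightarrow> vectorspace K (obj F q)"
  using is_vfunctor_vectorspace[OF vf] by simp

lemma field_K: "field K"
  using vs[of 0] by (simp add: vectorspace_def)

lemma mor_x_closed: "b \<in> B \<Longrightarrow> s b \<le> q \<Longrightarrow> mor F (s b) q (x b) \<in> carrier (obj F q)"
  using is_vfunctor_mor_closed[OF vf _ _ _ x_closed] s_nonneg[of b] by simp

lemma comb_closed: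
  assumes "0 \<le> q" "c \<in> B \<rightarrow> carrier K"
  shows "comb F B s x q c \<in> carrier (obj F q)"
proof -
  interpret vectorspace K "obj F q" using vs assms by simp
  show ?thesis unfolding comb_def
    by (rule M.finsum_closed) (use assms mor_x_closed in auto)
qed

lemma comb_cong:
  assumes "0 \<le> q" "d \<in> B \<rightarrow> carrier K" "\<And>b. b \<in> B \<Longrightarrow> s b \<le> q \<Longrightarrow> c b = d b"
  shows "comb F B s x q c = comb F B s x q d"
proof -
  interpret vectorspace K "obj F q" using vs assms by simp
  show ?thesis unfolding comb_def
    by (rule M.finsum_cong') (use assms mor_x_closed in \<open>auto simp: Pi_iff\<close>)
qed

lemma comb_add:
  assumes "0 \<le> q" "c \<in> B \<rightarrow> carrier K" "d \<in> B \<rightarrow> carrier K"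
  shows "comb F B s x q (\<lambda>b. c b \<oplus>\<^bsub>K\<^esub> d b) = comb F B s x q c \<oplus>\<^bsub>obj F q\<^esub> comb F B s x q d"
proof -
  interpret vectorspace K "obj F q" using vs assms by simp
  have "comb F B s x q (\<lambda>b. c b \<oplus>\<^bsub>K\<^esub> d b) = (\<Oplus>\<^bsub>obj F q\<^esub>b\<in>{b \<in> B. s b \<le> q}.
      c b \<odot>\<^bsub>obj F q\<^esub> mor F (s b) q (x b) \<oplus>\<^bsub>obj F q\<^esub> d b \<odot>\<^bsub>obj F q\<^esub> mor F (s b) q (x b))"
    unfolding comb_def
    by (rule M.finsum_cong') (use assms mor_x_closed in \<open>auto simp: Pi_iff smult_l_distr\<close>)
  also have "\<dots> = comb F B s x q c \<oplus>\<^bsub>obj F q\<^esub> comb F B s x q d"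
    unfolding comb_def by (rule M.finsum_addf) (use assms mor_x_closed in \<open>auto simp: Pi_iff\<close>)
  finally show ?thesis .
qed

lemma comb_smult:
  assumes "0 \<le> q" "c \<in> B \<rightarrow> carrier K" "a \<in> carrier K"
  shows "comb F B s x q (\<lambda>b. a \<otimes>\<^bsub>K\<^esub> c b) = a \<odot>\<^bsub>obj F q\<^esub> comb F B s x q c"
proof -
  interpret vectorspace K "obj F q" using vs assms by simp
  show ?thesis unfolding comb_def using assms mor_x_closed finite_B
    by (subst finsum_smult_ldistr) (auto simp: Pi_iff smult_assoc1 intro!: M.finsum_cong')
qed

lemma comb_zero: 
  assumes "0 \<le> q" shows "comb F B s x q (\<lambda>b. \<zero>\<^bsub>K\<^esub>) = \<zero>\<^bsub>obj F q\<^esub>"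
proof -
  interpret vectorspace K "obj F q" using vs assms by simp
  show ?thesis unfolding comb_def by (rule M.finsum_all0) (use mor_x_closed in auto)
qed

lemma comb_unit:
  assumes "k \<in> B" "s k \<le> q"
  shows "comb F B s x q (\<lambda>b. if b = k then \<one>\<^bsub>K\<^esub> else \<zero>\<^bsub>K\<^esub>) = mor F (s k) q (x k)"
proof -
  have "0 \<le> q" using s_nonneg[OF assms(1)] assms(2) by simp
  interpret vectorspace K "obj F q" using vs \<open>0 \<le> q\<close> by simp
  have "comb F B s x q (\<lambda>b. if b = k then \<one>\<^bsub>K\<^esub> else \<zero>\<^bsub>K\<^esub>)
      = (\<Oplus>\<^bsub>obj F q\<^esub>b\<in>{b \<in> B. s b \<le> q}. if k = b then mor F (s b) q (x b) else \<zero>\<^bsub>obj F q\<^esub>)"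
    unfolding comb_def by (rule M.finsum_cong') (use mor_x_closed in auto)
  also have "\<dots> = mor F (s k) q (x k)"
    by (rule M.add.finprod_singleton) (use assms finite_B mor_x_closed in auto)
  finally show ?thesis .
qed

lemma comb_mor:
  assumes q: "0 \<le> q" "q \<le> q'" and c: "c \<in> B \<rightarrow> carrier K"
  shows "mor F q q' (comb F B s x q c) = comb F B s x q' (\<lambda>b. if s b \<le> q then c b else \<zero>\<^bsub>K\<^esub>)"
proof -
  have q': "0 \<le> q'" using q by simp
  interpret q: vectorspace K "obj F q" using vs q by simp
  interpret q': vectorspace K "obj F q'" using vs q' by simp
  have hom: "mor F q q' \<in> module_hom K (obj F q) (obj F q')"
    using is_vfunctor_mor[OF vf] q q' by simp
  have comp: "mor F q q' (mor F (s b) q (x b)) = mor F (s b) q' (x b)" if "b \<in> B" "s b \<le> q" for b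
    using is_vfunctor_mor_comp[OF vf _ _ _ that(2) q(2) x_closed[OF that(1)]] s_nonneg[OF that(1)] q q' by simp
  have "mor F q q' (comb F B s x q c)
      = (\<Oplus>\<^bsub>obj F q'\<^esub>b\<in>{b \<in> B. s b \<le> q}. mor F q q' (c b \<odot>\<^bsub>obj F q\<^esub> mor F (s b) q (x b)))"
    unfolding comb_def
    by (rule hom_finsum[OF q.vectorspace_axioms q'.vectorspace_axioms hom]) (use c mor_x_closed in auto)
  also have "\<dots> = comb F B s x q' (\<lambda>b. if s b \<le> q then c b else \<zero>\<^bsub>K\<^esub>)"
    unfolding comb_def
    by (rule q'.M.add.finprod_mono_neutral_cong_left)
      (use q c mor_x_closed finite_B comp in \<open>auto simp: Pi_iff module_hom_smult[OF hom]\<close>)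
  finally show ?thesis .
qed

lemma family_image:
  assumes G: "is_vfunctor nnrat K G" and \<phi>: "nat_trans nnrat K F G \<phi>"
  shows "family K G B s (\<lambda>b. \<phi> (s b) (x b))"
  using finite_B s_nonneg nat_trans_closed[OF \<phi> _ x_closed] G by unfold_locales auto

lemma comb_image:
  assumes G: "is_vfunctor nnrat K G" and \<phi>: "nat_trans nnrat K F G \<phi>"
    and q: "0 \<le> q" and c: "c \<in> B \<rightarrow> carrier K"
  shows "\<phi> q (comb F B s x q c) = comb G B s (\<lambda>b. \<phi> (s b) (x b)) q c"
proof -
  interpret F: vectorspace K "obj F q" using vs q by simp
  interpret G: vectorspace K "obj G q" using is_vfunctor_vectorspace[OF G] q by simp
  have hom: "\<phi> q \<in> module_hom K (obj F q) (obj G q)" using nat_trans_hom[OF \<phi>] q by simp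
  have nat: "\<phi> q (mor F (s b) q (x b)) = mor G (s b) q (\<phi> (s b) (x b))" if "b \<in> B" "s b \<le> q" for b
    using nat_trans_natural[OF \<phi> _ _ that(2) x_closed[OF that(1)]] s_nonneg[OF that(1)] q by simp
  interpret im: family K G B s "\<lambda>b. \<phi> (s b) (x b)" by (rule family_image[OF G \<phi>])
  have "\<phi> q (comb F B s x q c)
      = (\<Oplus>\<^bsub>obj G q\<^esub>b\<in>{b \<in> B. s b \<le> q}. \<phi> q (c b \<odot>\<^bsub>obj F q\<^esub> mor F (s b) q (x b)))"
    unfolding comb_def
    by (rule hom_finsum[OF F.vectorspace_axioms G.vectorspace_axioms hom]) (use c mor_x_closed in auto)
  also have "\<dots> = comb G B s (\<lambda>b. \<phi> (s b) (x b)) q c"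
    unfolding comb_def
    by (rule G.M.finsum_cong') (use c mor_x_closed im.mor_x_closed nat in \<open>auto simp: Pi_iff module_hom_smult[OF hom]\<close>)
  finally show ?thesis .
qed

lemma comb_in_subspace:
  assumes q: "0 \<le> q" and W: "subspace K W (obj F q)" and c: "c \<in> B \<rightarrow> carrier K"
    and x: "\<And>b. b \<in> B \<Longrightarrow> s b \<le> q \<Longrightarrow> c b \<noteq> \<zero>\<^bsub>K\<^esub> \<Longrightarrow> mor F (s b) q (x b) \<in> W"
  shows "comb F B s x q c \<in> W"
proof -
  interpret vectorspace K "obj F q" using vs q by simp
  note W = subspaceD[OF W]
  have summand: "c b \<odot>\<^bsub>obj F q\<^esub> mor F (s b) q (x b) \<in> W" if "b \<in> B" "s b \<le> q" for b
    using x[OF that] W(3,5) c mor_x_closed[OF that] that by (cases "c b = \<zero>\<^bsub>K\<^esub>") auto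
  have "(\<Oplus>\<^bsub>obj F q\<^esub>b\<in>A. c b \<odot>\<^bsub>obj F q\<^esub> mor F (s b) q (x b)) \<in> W"
    if "A \<subseteq> {b \<in> B. s b \<le> q}" for A
  proof -
    have "finite A" using that finite_B by (auto intro: finite_subset)
    thus ?thesis using that
    proof (induction A)
      case (insert b A)
      hence "(\<Oplus>\<^bsub>obj F q\<^esub>b\<in>insert b A. c b \<odot>\<^bsub>obj F q\<^esub> mor F (s b) q (x b)) =
          c b \<odot>\<^bsub>obj F q\<^esub> mor F (s b) q (x b) \<oplus>\<^bsub>obj F q\<^esub> (\<Oplus>\<^bsub>obj F q\<^esub>b\<in>A. c b \<odot>\<^bsub>obj F q\<^esub> mor F (s b) q (x b))"
        by (intro M.finsum_insert) (use W(2) summand in auto)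
      thus ?case using insert summand W(4) by auto
    qed (use W(3) in simp)
  qed
  thus ?thesis unfolding comb_def by simp
qed

lemma comb_lincomb:
  assumes q: "0 \<le> q" and A: "finite A" and c: "c \<in> A \<rightarrow> carrier K"
    and a: "\<And>i. i \<in> A \<Longrightarrow> a i \<in> B \<rightarrow> carrier K"
  shows "(\<Oplus>\<^bsub>obj F q\<^esub>i\<in>A. c i \<odot>\<^bsub>obj F q\<^esub> comb F B s x q (a i))
    = comb F B s x q (\<lambda>b. \<Oplus>\<^bsub>K\<^esub>i\<in>A. c i \<otimes>\<^bsub>K\<^esub> a i b)"
proof -
  interpret vectorspace K "obj F q" using vs q by simp
  from A c a show ?thesis
  proof (induction A)
    case empty
    show ?case using comb_zero[OF q] by simp
  next
    case (insert j A)
    have closed: "(\<lambda>b. c j \<otimes>\<^bsub>K\<^esub> a j b) \<in> B \<rightarrow> carrier K"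
      "(\<lambda>b. \<Oplus>\<^bsub>K\<^esub>i\<in>A. c i \<otimes>\<^bsub>K\<^esub> a i b) \<in> B \<rightarrow> carrier K" 
      using insert.prems by (auto simp: Pi_iff intro!: R.finsum_closed)
    have "comb F B s x q (\<lambda>b. \<Oplus>\<^bsub>K\<^esub>i\<in>insert j A. c i \<otimes>\<^bsub>K\<^esub> a i b)
      = comb F B s x q (\<lambda>b. c j \<otimes>\<^bsub>K\<^esub> a j b \<oplus>\<^bsub>K\<^esub> (\<Oplus>\<^bsub>K\<^esub>i\<in>A. c i \<otimes>\<^bsub>K\<^esub> a i b))"
    proof (rule comb_cong[OF q])
      fix b assume "b \<in> B"
      thus "(\<Oplus>\<^bsub>K\<^esub>i\<in>insert j A. c i \<otimes>\<^bsub>K\<^esub> a i b) = c j \<otimes>\<^bsub>K\<^esub> a j b \<oplus>\<^bsub>K\<^esub> (\<Oplus>\<^bsub>K\<^esub>i\<in>A. c i \<otimes>\<^bsub>K\<^esub> a i b)"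
        using insert by (intro R.finsum_insert) (auto simp: Pi_iff)
    qed (use closed in \<open>auto simp: Pi_iff\<close>)
    also have "\<dots> = c j \<odot>\<^bsub>obj F q\<^esub> comb F B s x q (a j) \<oplus>\<^bsub>obj F q\<^esub> comb F B s x q (\<lambda>b. \<Oplus>\<^bsub>K\<^esub>i\<in>A. c i \<otimes>\<^bsub>K\<^esub> a i b)"
      using comb_add[OF q closed] comb_smult[OF q, of "a j" "c j"] insert.prems by simp
    also have "\<dots> = (\<Oplus>\<^bsub>obj F q\<^esub>i\<in>insert j A. c i \<odot>\<^bsub>obj F q\<^esub> comb F B s x q (a i))"
      using insert comb_closed[OF q] by (subst M.finsum_insert) (auto simp: Pi_iff)
    finally show ?case by simp
  qed
qed

text \<open>
  A family is the same as a natural transformation to \<open>F\<close> from the free functor with generators born at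
  the times \<open>s b\<close>. It is generating if this map is an epimorphism, independent if it is a monomorphism,
  and reduced if its kernel lies in the radical: a relation at time \<open>q\<close> only involves elements that are
  born strictly before \<open>q\<close>.
\<close>

definition generating :: bool where
  "generating \<longleftrightarrow> (\<forall>q\<ge>0. \<forall>y\<in>carrier (obj F q). \<exists>c\<in>B \<rightarrow> carrier K. y = comb F B s x q c)"

definition reduced :: bool where
  "reduced \<longleftrightarrow> (\<forall>q\<ge>0. \<forall>c\<in>B \<rightarrow> carrier K. comb F B s x q c = \<zero>\<^bsub>obj F q\<^esub> \<longrightarrow>
      (\<forall>b\<in>B. s b = q \<longrightarrow> c b = \<zero>\<^bsub>K\<^esub>))"

definition independent :: bool where
  "independent \<longleftrightarrow> (\<forall>q\<ge>0. \<forall>c\<in>B \<rightarrow> carrier K. comb F B s x q c = \<zero>\<^bsub>obj F q\<^esub> \<longrightarrow>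
      (\<forall>b\<in>B. s b \<le> q \<longrightarrow> c b = \<zero>\<^bsub>K\<^esub>))"

end

section \<open>Counting\<close>

text \<open>
  Gaussian elimination: more rows than columns are linearly dependent.
\<close>

lemma (in field) dependent_rows:
  assumes "finite B" "finite A" "card B < card A" "\<And>i b. i \<in> A \<Longrightarrow> b \<in> B \<Longrightarrow> M i b \<in> carrier R"
  shows "\<exists>c\<in>A \<rightarrow> carrier R. (\<exists>i\<in>A. c i \<noteq> \<zero>) \<and> (\<forall>b\<in>B. (\<Oplus>i\<in>A. c i \<otimes> M i b) = \<zero>)"
  using assms
proof (induction B arbitrary: A M)
  case empty
  hence "A \<noteq> {}" by auto
  thus ?case by (intro bexI[of _ "\<lambda>_. \<one>"]) auto
next
  case (insert b B A M)
  note M = insert.prems(3)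
  show ?case
  proof (cases "\<forall>i\<in>A. M i b = \<zero>")
    case True
    obtain c where c: "c \<in> A \<rightarrow> carrier R" "\<exists>i\<in>A. c i \<noteq> \<zero>" "\<forall>b\<in>B. (\<Oplus>i\<in>A. c i \<otimes> M i b) = \<zero>"
      using insert.IH[of A M] insert.prems insert.hyps by auto
    moreover have "(\<Oplus>i\<in>A. c i \<otimes> M i b) = \<zero>"
      by (rule finsum_all0) (use True c in \<open>auto simp: Pi_iff\<close>)
    ultimately show ?thesis by auto
  next
    case False
    then obtain k where k: "k \<in> A" "M k b \<noteq> \<zero>" by blast
    define A' where "A' = A - {k}"
    have A': "finite A'" "k \<notin> A'" "A = insert k A'" "card B < card A'"
      using insert.prems insert.hyps k unfolding A'_def by (auto simp: card_Diff_singleton)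
    have Mk: "M k b \<in> carrier R" "inv (M k b) \<in> carrier R" "M k b \<otimes> inv (M k b) = \<one>"
      using M k by (auto simp: field_Units)
    \<comment> \<open>Eliminate the column \<open>b\<close> with the pivot row \<open>k\<close>.\<close>
    define r where "r i = M i b \<otimes> inv (M k b)" for i
    have r: "r i \<in> carrier R" if "i \<in> A" for i using M that Mk unfolding r_def by auto
    define M' where "M' i b' = M i b' \<ominus> r i \<otimes> M k b'" for i b'
    have "\<And>i b. i \<in> A' \<Longrightarrow> b \<in> B \<Longrightarrow> M' i b \<in> carrier R"
      using M r k A' unfolding M'_def by auto
    then obtain c where c: "c \<in> A' \<rightarrow> carrier R" "\<exists>i\<in>A'. c i \<noteq> \<zero>" "\<forall>b\<in>B. (\<Oplus>i\<in>A'. c i \<otimes> M' i b) = \<zero>"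
      using insert.IH[of A' M'] A' by auto
    define d where "d i = (if i = k then \<ominus> (\<Oplus>i\<in>A'. c i \<otimes> r i) else c i)" for i
    have cr: "(\<lambda>i. c i \<otimes> r i) \<in> A' \<rightarrow> carrier R" using c r A' by auto
    have S: "(\<Oplus>i\<in>A'. c i \<otimes> r i) \<in> carrier R" by (rule finsum_closed[OF cr])
    have d: "d \<in> A \<rightarrow> carrier R" using c S A' unfolding d_def by auto
    have dA': "d i = c i" if "i \<in> A'" for i using that A' unfolding d_def by auto
    have eq: "(\<Oplus>i\<in>A. d i \<otimes> M i b') = (\<Oplus>i\<in>A'. c i \<otimes> M' i b')" if b': "b' \<in> insert b B" for b'
    proof -
      have Mc: "M i b' \<in> carrier R" if "i \<in> A" for i using M that b' by auto
      have cc: "c i \<in> carrier R" if "i \<in> A'" for i using c that by auto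
      have "(\<Oplus>i\<in>A. d i \<otimes> M i b') = d k \<otimes> M k b' \<oplus> (\<Oplus>i\<in>A'. d i \<otimes> M i b')"
        unfolding A'(3) by (rule finsum_insert) (use A' d Mc in auto)
      also have "(\<Oplus>i\<in>A'. d i \<otimes> M i b') = (\<Oplus>i\<in>A'. c i \<otimes> M i b')"
        by (rule finsum_cong') (use dA' cc Mc A' in auto)
      also have "d k \<otimes> M k b' = (\<Oplus>i\<in>A'. c i \<otimes> r i) \<otimes> (\<ominus> M k b')"
        using S Mc k unfolding d_def by (simp add: l_minus r_minus)
      also have "\<dots> = (\<Oplus>i\<in>A'. c i \<otimes> r i \<otimes> (\<ominus> M k b'))"
        by (rule finsum_ldistr) (use A' cr Mc k in auto)
      also have "\<dots> \<oplus> (\<Oplus>i\<in>A'. c i \<otimes> M i b') = (\<Oplus>i\<in>A'. c i \<otimes> r i \<otimes> (\<ominus> M k b') \<oplus> c i \<otimes> M i b')"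
        by (rule finsum_addf[symmetric]) (use cc r Mc k A' in auto)
      also have "\<dots> = (\<Oplus>i\<in>A'. c i \<otimes> M' i b')"
      proof (rule finsum_cong')
        fix i assume i: "i \<in> A'"
        hence "i \<in> A" using A' by auto
        thus "c i \<otimes> r i \<otimes> (\<ominus> M k b') \<oplus> c i \<otimes> M i b' = c i \<otimes> M' i b'"
          using cc[OF i] r Mc Mc[OF k(1)] unfolding M'_def
          by (simp add: minus_eq r_distr r_minus m_assoc a_comm)
      qed (use cc Mc A' r k in \<open>auto simp: M'_def\<close>)
      finally show ?thesis .
    qed
    have "M' i b = \<zero>" if "i \<in> A'" for i
    proof -
      have "M i b \<in> carrier R" using M that A' by auto
      hence "r i \<otimes> M k b = M i b" using Mk unfolding r_def by (simp add: m_assoc m_comm[of "inv (M k b)"])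
      with \<open>M i b \<in> carrier R\<close> show ?thesis unfolding M'_def by simp
    qed
    hence "(\<Oplus>i\<in>A'. c i \<otimes> M' i b) = \<zero>" by (intro finsum_all0) (use c in \<open>auto simp: Pi_iff\<close>)
    with c(3) eq have "\<forall>b'\<in>insert b B. (\<Oplus>i\<in>A. d i \<otimes> M i b') = \<zero>" by auto
    moreover have "\<exists>i\<in>A. d i \<noteq> \<zero>" using c(2) dA' A'(3) by auto
    ultimately show ?thesis using d by blast
  qed
qed

text \<open>
  Write the \<open>y i\<close> in terms of the generators. If there were more \<open>y i\<close> than generators, the coefficient
  rows would be dependent, which is a relation between the \<open>y i\<close>, valid as soon as all of them with a
  nonzero coefficient are born. At the first such time it involves an element born just then,
  which is impossible in a reduced family. This replaces the monotonicity of the rank under passage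
  to subfunctors and quotients.
\<close>

theorem reduced_card_le_generating:
  assumes y: "family K G A p y" "family.reduced K G A p y"
    and x: "family K G B s x" "family.generating K G B s x"
  shows "card A \<le> card B"
proof (rule ccontr)
  assume "\<not> card A \<le> card B"
  hence card: "card B < card A" by simp
  interpret y: family K G A p y by fact
  interpret x: family K G B s x by fact
  interpret field K by (rule y.field_K)
  have "\<exists>c\<in>B \<rightarrow> carrier K. y i = comb G B s x (p i) c" if "i \<in> A" for i
    using x(2) y.x_closed[OF that] y.s_nonneg[OF that] unfolding x.generating_def by blast
  then obtain a where a: "\<And>i. i \<in> A \<Longrightarrow> a i \<in> B \<rightarrow> carrier K"
    and ya: "\<And>i. i \<in> A \<Longrightarrow> y i = comb G B s x (p i) (a i)" by metis
  \<comment> \<open>Coefficients of generators not yet born at \<open>p i\<close> are set to zero, so that they stay correct later.\<close>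
  define M where "M i b = (if s b \<le> p i then a i b else \<zero>\<^bsub>K\<^esub>)" for i b
  have M: "M i \<in> B \<rightarrow> carrier K" if "i \<in> A" for i using a[OF that] unfolding M_def by auto
  obtain c where c: "c \<in> A \<rightarrow> carrier K" "\<exists>i\<in>A. c i \<noteq> \<zero>\<^bsub>K\<^esub>"
    and dep: "\<forall>b\<in>B. (\<Oplus>\<^bsub>K\<^esub>i\<in>A. c i \<otimes>\<^bsub>K\<^esub> M i b) = \<zero>\<^bsub>K\<^esub>"
    using dependent_rows[OF x.finite_B y.finite_B card, of M] M by blast
  define q where "q = Max (p ` {i \<in> A. c i \<noteq> \<zero>\<^bsub>K\<^esub>})"
  have "q \<in> p ` {i \<in> A. c i \<noteq> \<zero>\<^bsub>K\<^esub>}"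
    unfolding q_def using c(2) y.finite_B by (intro Max_in) auto
  then obtain k where k: "k \<in> A" "c k \<noteq> \<zero>\<^bsub>K\<^esub>" "p k = q" by auto
  have le: "p i \<le> q" if "i \<in> A" "c i \<noteq> \<zero>\<^bsub>K\<^esub>" for i
    unfolding q_def using y.finite_B that by (intro Max_ge) auto
  hence late: "c i = \<zero>\<^bsub>K\<^esub>" if "i \<in> A" "\<not> p i \<le> q" for i using that by blast
  have q: "0 \<le> q" using y.s_nonneg[OF k(1)] k(3) by simp
  interpret q: vectorspace K "obj G q" by (rule y.vs[OF q])
  let ?A = "{i \<in> A. p i \<le> q}"
  have "comb G A p y q c = (\<Oplus>\<^bsub>obj G q\<^esub>i\<in>?A. c i \<odot>\<^bsub>obj G q\<^esub> comb G B s x q (M i))"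
    unfolding comb_def[of G A]
  proof (rule q.M.finsum_cong')
    fix i assume i: "i \<in> ?A"
    hence "mor G (p i) q (y i) = comb G B s x q (M i)"
      using x.comb_mor[OF y.s_nonneg _ a, of i q i] ya[of i] unfolding M_def by simp
    thus "c i \<odot>\<^bsub>obj G q\<^esub> mor G (p i) q (y i) = c i \<odot>\<^bsub>obj G q\<^esub> comb G B s x q (M i)" by simp
  qed (use c x.comb_closed[OF q M] in auto)
  also have "\<dots> = comb G B s x q (\<lambda>b. \<Oplus>\<^bsub>K\<^esub>i\<in>?A. c i \<otimes>\<^bsub>K\<^esub> M i b)"
    by (rule x.comb_lincomb[OF q]) (use y.finite_B c M in auto)
  also have "\<dots> = comb G B s x q (\<lambda>b. \<zero>\<^bsub>K\<^esub>)"
  proof (rule x.comb_cong[OF q])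
    fix b assume b: "b \<in> B"
    have "(\<Oplus>\<^bsub>K\<^esub>i\<in>?A. c i \<otimes>\<^bsub>K\<^esub> M i b) = (\<Oplus>\<^bsub>K\<^esub>i\<in>A. c i \<otimes>\<^bsub>K\<^esub> M i b)"
      by (rule add.finprod_mono_neutral_cong_left) (use y.finite_B c M b late in \<open>auto simp: Pi_iff\<close>)
    thus "(\<Oplus>\<^bsub>K\<^esub>i\<in>?A. c i \<otimes>\<^bsub>K\<^esub> M i b) = \<zero>\<^bsub>K\<^esub>" using dep b by simp
  qed simp
  also have "\<dots> = \<zero>\<^bsub>obj G q\<^esub>" by (rule x.comb_zero[OF q])
  finally have "c k = \<zero>\<^bsub>K\<^esub>" using y(2) q c(1) k unfolding y.reduced_def by blast
  with k(2) show False by simp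
qed

section \<open>Cyclic subfunctors\<close>

definition cyc_set :: "('k, 'm) ring_scheme \<Rightarrow> (rat, 'k, 'a) vfunctor \<Rightarrow> rat \<Rightarrow> 'a \<Rightarrow> rat \<Rightarrow> 'a set" where
  "cyc_set K F s x q = (if s \<le> q then (\<lambda>c. c \<odot>\<^bsub>obj F q\<^esub> mor F s q x) ` carrier K else {\<zero>\<^bsub>obj F q\<^esub>})"

definition cyclic :: "('k, 'm) ring_scheme \<Rightarrow> (rat, 'k, 'a) vfunctor \<Rightarrow> rat \<Rightarrow> 'a \<Rightarrow> (rat, 'k, 'a) vfunctor" where
  "cyclic K F s x = restrict_functor F (cyc_set K F s x)"

context
  fixes K :: "('k, 'm) ring_scheme" and F :: "(rat, 'k, 'a) vfunctor" and s x
  assumes F: "is_vfunctor nnrat K F" and s: "0 \<le> s" and x: "x \<in> carrier (obj F s)"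
begin

lemma cyc_set_sub:
  assumes q: "0 \<le> q" shows "subspace K (cyc_set K F s x q) (obj F q)"
proof -
  interpret vectorspace K "obj F q" using is_vfunctor_vectorspace[OF F] q by simp
  show ?thesis
  proof (cases "s \<le> q")
    case True
    have m: "mor F s q x \<in> carrier (obj F q)" using is_vfunctor_mor_closed[OF F] s q x True by simp
    have "\<zero>\<^bsub>obj F q\<^esub> = \<zero>\<^bsub>K\<^esub> \<odot>\<^bsub>obj F q\<^esub> mor F s q x" using m by simp
    hence z: "\<zero>\<^bsub>obj F q\<^esub> \<in> (\<lambda>c. c \<odot>\<^bsub>obj F q\<^esub> mor F s q x) ` carrier K" by blast
    show ?thesis unfolding cyc_set_def using True m z
      by (auto intro!: subspaceI[OF vectorspace_axioms]
          simp: smult_l_distr[symmetric] smult_assoc1[symmetric])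
  qed (auto intro!: subspaceI[OF vectorspace_axioms] simp: cyc_set_def)
qed

lemma mor_in_cyc_set:
  assumes q: "s \<le> q" shows "mor F s q x \<in> cyc_set K F s x q"
proof -
  have "0 \<le> q" using s q by simp
  interpret vectorspace K "obj F q" using is_vfunctor_vectorspace[OF F] \<open>0 \<le> q\<close> by simp
  have m: "mor F s q x \<in> carrier (obj F q)" using is_vfunctor_mor_closed[OF F] s \<open>0 \<le> q\<close> x q by simp
  hence "mor F s q x = \<one>\<^bsub>K\<^esub> \<odot>\<^bsub>obj F q\<^esub> mor F s q x" by simp
  thus ?thesis unfolding cyc_set_def using q by auto
qed

lemma cyc_set_mor:
  assumes v: "0 \<le> v" "v \<le> u"
  shows "mor F v u ` cyc_set K F s x v = (if s \<le> v then cyc_set K F s x u else {\<zero>\<^bsub>obj F u\<^esub>})"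
proof -
  have u: "0 \<le> u" using v by simp
  have hom: "mor F v u \<in> module_hom K (obj F v) (obj F u)"
    using is_vfunctor_mor[OF F] v u by simp
  show ?thesis
  proof (cases "s \<le> v")
    case True
    have m: "mor F s v x \<in> carrier (obj F v)" using is_vfunctor_mor_closed[OF F] s v x True by simp
    have "mor F v u (c \<odot>\<^bsub>obj F v\<^esub> mor F s v x) = c \<odot>\<^bsub>obj F u\<^esub> mor F s u x" if "c \<in> carrier K" for c
      using module_hom_smult[OF hom that m] is_vfunctor_mor_comp[OF F _ _ _ True v(2) x] s v u by simp
    thus ?thesis using True v by (simp add: cyc_set_def image_image cong: image_cong)
  next
    case False
    thus ?thesis using hom_zero[OF _ _ hom] is_vfunctor_vectorspace[OF F] v u by (simp add: cyc_set_def)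
  qed
qed

lemma subfunctor_cyc: "subfunctor nnrat K F (cyc_set K F s x)"
  unfolding subfunctor_def
proof (intro conjI ballI impI)
  fix v u :: rat assume vu: "v \<in> nnrat" "u \<in> nnrat" "v \<le> u"
  show "mor F v u ` cyc_set K F s x v \<subseteq> cyc_set K F s x u"
    using cyc_set_mor[of v u] vu subspaceD(3)[OF cyc_set_sub[of u]] by auto
qed (use cyc_set_sub in auto)

lemma is_vfunctor_cyclic: "is_vfunctor nnrat K (cyclic K F s x)"
  unfolding cyclic_def by (rule is_vfunctor_restrict[OF F subfunctor_cyc])

lemma nat_trans_cyclic_incl: "nat_trans nnrat K (cyclic K F s x) F (\<lambda>v x. x)"
  unfolding cyclic_def
  by (rule nat_trans_restrict_dom[OF nat_trans_id[OF F]]) (use subspaceD(2)[OF cyc_set_sub] in auto)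

text \<open>
  The birth time \<open>s\<close> has to be put on the grid, since the functor jumps there.
\<close>

lemma grid_const_cyclic:
  assumes g: "grid_const \<gamma> F" "on_grid \<gamma> s"
  shows "grid_const \<gamma> (cyclic K F s x)"
  unfolding grid_const_def
proof (intro allI impI)
  fix v u :: rat assume vu: "0 \<le> v" "v \<le> u" and n: "\<forall>k::nat. \<not> (v < \<gamma> * of_nat k \<and> \<gamma> * of_nat k \<le> u)"
  have "bij_betw (mor F v u) (carrier (obj F v)) (carrier (obj F u))"
    using g(1) vu n unfolding grid_const_def by blast
  hence "inj_on (mor F v u) (cyc_set K F s x v)"
    using subspaceD(2)[OF cyc_set_sub[OF vu(1)]] unfolding bij_betw_def by (auto intro: inj_on_subset)
  moreover have "\<not> (v < s \<and> s \<le> u)" using n g(2) unfolding on_grid_def by blast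
  hence "mor F v u ` cyc_set K F s x v = cyc_set K F s x u"
    using cyc_set_mor[OF vu] by (auto simp: cyc_set_def)
  ultimately show "bij_betw (mor (cyclic K F s x) v u) (carrier (obj (cyclic K F s x) v)) (carrier (obj (cyclic K F s x) u))"
    by (simp add: cyclic_def bij_betw_def)
qed

lemma tame_cyclic:
  assumes "tame K F" shows "tame K (cyclic K F s x)"
proof -
  obtain \<alpha> where \<alpha>: "\<alpha> > 0" "grid_const \<alpha> F" using assms unfolding tame_iff_grid_const by auto
  obtain \<gamma> where "\<gamma> > 0" "on_grid \<gamma> \<alpha>" "on_grid \<gamma> s" using common_grid2[of \<alpha> s] \<alpha> s by auto
  thus ?thesis unfolding tame_iff_grid_const
    using is_vfunctor_cyclic grid_const_cyclic grid_const_refine[OF \<alpha>(2)] by blast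
qed

lemma noise_cyclic:
  assumes S: "noise_system K S" "0 \<le> \<epsilon>" "F \<in> S \<epsilon>"
  shows "cyclic K F s x \<in> S \<epsilon>"
  by (rule noise_sub[OF S tame_cyclic[OF noise_tame[OF S]] nat_trans_cyclic_incl]) simp

text \<open>
  The image of a functor generated by \<open>x\<close> is generated by the image of \<open>x\<close>. This computes all images
  in the lower bound and the bars.
\<close>

lemma image_cyc_set:
  assumes G: "is_vfunctor nnrat K G" and \<phi>: "nat_trans nnrat K F G \<phi>" and q: "0 \<le> q"
  shows "\<phi> q ` cyc_set K F s x q = cyc_set K G s (\<phi> s x) q"
proof -
  have hom: "\<phi> q \<in> module_hom K (obj F q) (obj G q)" using nat_trans_hom[OF \<phi>] q by simp
  show ?thesis
  proof (cases "s \<le> q")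
    case True
    have m: "mor F s q x \<in> carrier (obj F q)" using is_vfunctor_mor_closed[OF F] s q x True by simp
    have "\<phi> q (c \<odot>\<^bsub>obj F q\<^esub> mor F s q x) = c \<odot>\<^bsub>obj G q\<^esub> mor G s q (\<phi> s x)" if "c \<in> carrier K" for c
      using module_hom_smult[OF hom that m] nat_trans_natural[OF \<phi> _ _ True x] s q by simp
    thus ?thesis using True by (simp add: cyc_set_def image_image cong: image_cong)
  next
    case False
    thus ?thesis using hom_zero[OF _ _ hom] is_vfunctor_vectorspace[OF F] is_vfunctor_vectorspace[OF G] q
      by (simp add: cyc_set_def)
  qed
qed

end

section \<open>Direct sums\<close>

lemma module_sum_simps [simp]:
  "zero (module_sum J M) = (\<lambda>j\<in>J. \<zero>\<^bsub>M j\<^esub>)"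
  "add (module_sum J M) f g = (\<lambda>j\<in>J. f j \<oplus>\<^bsub>M j\<^esub> g j)"
  "smult (module_sum J M) c f = (\<lambda>j\<in>J. c \<odot>\<^bsub>M j\<^esub> f j)"
  by (simp_all add: module_sum_def)

lemma module_sum_carrier:
  "f \<in> carrier (module_sum J M) \<longleftrightarrow> f \<in> (\<Pi>\<^sub>E j\<in>J. carrier (M j)) \<and> finite {j \<in> J. f j \<noteq> \<zero>\<^bsub>M j\<^esub>}"
  by (simp add: module_sum_def)

lemma module_sum_carrierD:
  assumes "f \<in> carrier (module_sum J M)"
  shows "j \<in> J \<Longrightarrow> f j \<in> carrier (M j)" "f \<in> extensional J" "finite {j \<in> J. f j \<noteq> \<zero>\<^bsub>M j\<^esub>}"
  using assms by (auto simp: module_sum_carrier PiE_def)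

lemma module_sum_carrierI:
  assumes "\<And>j. j \<in> J \<Longrightarrow> f j \<in> carrier (M j)" "finite T" "\<And>j. j \<in> J \<Longrightarrow> j \<notin> T \<Longrightarrow> f j = \<zero>\<^bsub>M j\<^esub>"
  shows "restrict f J \<in> carrier (module_sum J M)"
proof -
  have "{j \<in> J. restrict f J j \<noteq> \<zero>\<^bsub>M j\<^esub>} \<subseteq> T" using assms(3) by auto
  with assms show ?thesis unfolding module_sum_carrier by (auto intro: finite_subset)
qed

lemma vectorspace_module_sum:
  assumes K: "field K" and M: "\<And>j. j \<in> J \<Longrightarrow> vectorspace K (M j)"
  shows "vectorspace K (module_sum J M)"
proof -
  have ab: "abelian_group (M j)" and md: "module K (M j)" if "j \<in> J" for j
    using M[OF that] by (simp_all add: vectorspace_def module_def)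
  note z = abelian_monoid.zero_closed[OF abelian_group.axioms(1)[OF ab]]
    and cl = abelian_monoid.a_closed[OF abelian_group.axioms(1)[OF ab]]
  note l0 = abelian_monoid.l_zero[OF abelian_group.axioms(1)[OF ab]]
    and r0 = abelian_monoid.r_zero[OF abelian_group.axioms(1)[OF ab]]
    and ac = abelian_monoid.a_comm[OF abelian_group.axioms(1)[OF ab]]
    and as = abelian_monoid.a_assoc[OF abelian_group.axioms(1)[OF ab]]
  note neg = abelian_group.a_inv_closed[OF ab] abelian_group.r_neg[OF ab]
  note sm = module.smult_closed[OF md] module.smult_r_null[OF md] module.smult_l_distr[OF md]
    module.smult_r_distr[OF md] module.smult_assoc1[OF md] module.smult_one[OF md]
  note D = module_sum_carrierD
  show ?thesis
  proof (rule vs_criteria[OF K])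
    show "\<zero>\<^bsub>module_sum J M\<^esub> \<in> carrier (module_sum J M)"
      using module_sum_carrierI[of J "\<lambda>j. \<zero>\<^bsub>M j\<^esub>" M "{}"] z by simp
    show "\<forall>v w. v \<in> carrier (module_sum J M) \<and> w \<in> carrier (module_sum J M) \<longrightarrow>
        v \<oplus>\<^bsub>module_sum J M\<^esub> w \<in> carrier (module_sum J M)"
    proof (intro allI impI)
      fix f g assume fg: "f \<in> carrier (module_sum J M) \<and> g \<in> carrier (module_sum J M)"
      have fgj: "f j \<in> carrier (M j)" "g j \<in> carrier (M j)" if "j \<in> J" for j
        using D(1)[of f] D(1)[of g] fg that by blast+
      show "f \<oplus>\<^bsub>module_sum J M\<^esub> g \<in> carrier (module_sum J M)"
        unfolding module_sum_simps
        by (rule module_sum_carrierI[of _ _ _ "{j \<in> J. f j \<noteq> \<zero>\<^bsub>M j\<^esub>} \<union> {j \<in> J. g j \<noteq> \<zero>\<^bsub>M j\<^esub>}"])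
          (use D(3)[of f] D(3)[of g] fg fgj z cl l0 in auto)
    qed
    show "\<forall>v\<in>carrier (module_sum J M). \<exists>neg_v\<in>carrier (module_sum J M). v \<oplus>\<^bsub>module_sum J M\<^esub> neg_v = \<zero>\<^bsub>module_sum J M\<^esub>"
    proof
      fix f assume f: "f \<in> carrier (module_sum J M)"
      have "\<ominus>\<^bsub>M j\<^esub> \<zero>\<^bsub>M j\<^esub> = \<zero>\<^bsub>M j\<^esub>" if "j \<in> J" for j
        using neg[OF that z[OF that]] l0[OF that neg(1)[OF that z[OF that]]] by simp
      hence "(\<lambda>j\<in>J. \<ominus>\<^bsub>M j\<^esub> f j) \<in> carrier (module_sum J M)"
        by (intro module_sum_carrierI[of _ _ _ "{j \<in> J. f j \<noteq> \<zero>\<^bsub>M j\<^esub>}"])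
          (use D[OF f] neg in auto)
      moreover have "f \<oplus>\<^bsub>module_sum J M\<^esub> (\<lambda>j\<in>J. \<ominus>\<^bsub>M j\<^esub> f j) = \<zero>\<^bsub>module_sum J M\<^esub>"
        using D(1)[OF f] neg by (auto simp: restrict_def)
      ultimately show "\<exists>neg_v\<in>carrier (module_sum J M). f \<oplus>\<^bsub>module_sum J M\<^esub> neg_v = \<zero>\<^bsub>module_sum J M\<^esub>" by blast
    qed
    show "\<forall>c v. c \<in> carrier K \<and> v \<in> carrier (module_sum J M) \<longrightarrow>
        c \<odot>\<^bsub>module_sum J M\<^esub> v \<in> carrier (module_sum J M)"
    proof (intro allI impI)
      fix c f assume cf: "c \<in> carrier K \<and> f \<in> carrier (module_sum J M)"
      have fj: "f j \<in> carrier (M j)" if "j \<in> J" for j using D(1)[of f] cf that by blast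
      show "c \<odot>\<^bsub>module_sum J M\<^esub> f \<in> carrier (module_sum J M)"
        unfolding module_sum_simps
        by (rule module_sum_carrierI[of _ _ _ "{j \<in> J. f j \<noteq> \<zero>\<^bsub>M j\<^esub>}"])
          (use D(3)[of f] cf fj sm(1,2) in auto)
    qed
    show "\<forall>v w. v \<in> carrier (module_sum J M) \<and> w \<in> carrier (module_sum J M) \<longrightarrow>
        v \<oplus>\<^bsub>module_sum J M\<^esub> w = w \<oplus>\<^bsub>module_sum J M\<^esub> v"
      using ac by (auto simp: module_sum_carrier PiE_iff intro!: restrict_ext)
    show "\<forall>v w x. v \<in> carrier (module_sum J M) \<and> w \<in> carrier (module_sum J M) \<and> x \<in> carrier (module_sum J M) \<longrightarrow>
        v \<oplus>\<^bsub>module_sum J M\<^esub> w \<oplus>\<^bsub>module_sum J M\<^esub> x = v \<oplus>\<^bsub>module_sum J M\<^esub> (w \<oplus>\<^bsub>module_sum J M\<^esub> x)"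
      using as by (auto simp: module_sum_carrier PiE_iff intro!: restrict_ext)
    show "\<forall>v\<in>carrier (module_sum J M). v \<oplus>\<^bsub>module_sum J M\<^esub> \<zero>\<^bsub>module_sum J M\<^esub> = v"
      using r0 by (auto simp: module_sum_carrier PiE_iff intro!: extensionalityI[OF restrict_extensional])
    show "\<forall>a b v. a \<in> carrier K \<and> b \<in> carrier K \<and> v \<in> carrier (module_sum J M) \<longrightarrow>
        (a \<otimes>\<^bsub>K\<^esub> b) \<odot>\<^bsub>module_sum J M\<^esub> v = a \<odot>\<^bsub>module_sum J M\<^esub> (b \<odot>\<^bsub>module_sum J M\<^esub> v)"
      using sm(5) by (auto simp: module_sum_carrier PiE_iff intro!: restrict_ext)
    show "\<forall>v\<in>carrier (module_sum J M). \<one>\<^bsub>K\<^esub> \<odot>\<^bsub>module_sum J M\<^esub> v = v"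
      using sm(6) by (auto simp: module_sum_carrier PiE_iff intro!: extensionalityI[OF restrict_extensional])
    show "\<forall>a b v. a \<in> carrier K \<and> b \<in> carrier K \<and> v \<in> carrier (module_sum J M) \<longrightarrow>
        (a \<oplus>\<^bsub>K\<^esub> b) \<odot>\<^bsub>module_sum J M\<^esub> v = a \<odot>\<^bsub>module_sum J M\<^esub> v \<oplus>\<^bsub>module_sum J M\<^esub> b \<odot>\<^bsub>module_sum J M\<^esub> v"
      using sm(3) by (auto simp: module_sum_carrier PiE_iff intro!: restrict_ext)
    show "\<forall>a v w. a \<in> carrier K \<and> v \<in> carrier (module_sum J M) \<and> w \<in> carrier (module_sum J M) \<longrightarrow>
        a \<odot>\<^bsub>module_sum J M\<^esub> (v \<oplus>\<^bsub>module_sum J M\<^esub> w) = a \<odot>\<^bsub>module_sum J M\<^esub> v \<oplus>\<^bsub>module_sum J M\<^esub> a \<odot>\<^bsub>module_sum J M\<^esub> w"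
      using sm(4) by (auto simp: module_sum_carrier PiE_iff intro!: restrict_ext)
  qed
qed

lemma module_sum_eval_hom:
  "j \<in> J \<Longrightarrow> (\<lambda>f. f j) \<in> module_hom K (module_sum J M) (M j)"
  by (rule module_homI) (auto dest: module_sum_carrierD(1))

lemma dsum_simps [simp]:
  "obj (dsum J X) v = module_sum J (\<lambda>j. obj (X j) v)"
  "mor (dsum J X) v u f = (\<lambda>j\<in>J. mor (X j) v u (f j))"
  by (simp_all add: dsum_def)

lemma is_vfunctor_dsum:
  assumes K: "field K" and X: "\<And>j. j \<in> J \<Longrightarrow> is_vfunctor I K (X j)"
  shows "is_vfunctor I K (dsum J X)"
  unfolding is_vfunctor_def
proof (intro conjI ballI impI)
  fix v assume v: "v \<in> I"
  show "vectorspace K (obj (dsum J X) v)"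
    unfolding dsum_simps by (rule vectorspace_module_sum[OF K is_vfunctor_vectorspace[OF X v]])
  fix f assume f: "f \<in> carrier (obj (dsum J X) v)"
  hence "f \<in> extensional J" by (simp add: module_sum_carrierD(2))
  moreover have "f j \<in> carrier (obj (X j) v)" if "j \<in> J" for j
    using module_sum_carrierD(1)[OF f[unfolded dsum_simps] that] .
  ultimately show "mor (dsum J X) v v f = f"
    using is_vfunctor_mor_id[OF X v] by (auto intro!: extensionalityI[OF restrict_extensional])
next
  fix v u assume vu: "v \<in> I" "u \<in> I" "v \<le> u"
  have cl: "mor (dsum J X) v u f \<in> carrier (obj (dsum J X) u)" if "f \<in> carrier (obj (dsum J X) v)" for f
  proof -
    have f: "f \<in> carrier (module_sum J (\<lambda>j. obj (X j) v))" using that by simp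
    show ?thesis unfolding dsum_simps
      by (rule module_sum_carrierI[of _ _ _ "{j \<in> J. f j \<noteq> \<zero>\<^bsub>obj (X j) v\<^esub>}"])
        (use module_sum_carrierD[OF f] is_vfunctor_mor_closed[OF X vu]
          hom_zero[OF is_vfunctor_vectorspace[OF X vu(1)] is_vfunctor_vectorspace[OF X vu(2)] is_vfunctor_mor[OF X vu]] in auto)
  qed
  show "mor (dsum J X) v u \<in> module_hom K (obj (dsum J X) v) (obj (dsum J X) u)"
    by (rule module_homI[OF cl])
      (use module_hom_add[OF is_vfunctor_mor[OF X vu]] module_hom_smult[OF is_vfunctor_mor[OF X vu]]
        in \<open>auto simp: module_sum_carrier PiE_iff intro!: restrict_ext\<close>)
next
  fix v u w f assume "v \<in> I" "u \<in> I" "w \<in> I" "v \<le> u" "u \<le> w" "f \<in> carrier (obj (dsum J X) v)"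
  thus "mor (dsum J X) u w (mor (dsum J X) v u f) = mor (dsum J X) v w f"
    using is_vfunctor_mor_comp[OF X]
    by (auto simp: module_sum_carrier PiE_iff intro!: restrict_ext)
qed

lemma direct_sum_simps [simp]:
  "carrier (direct_sum V W) = carrier V \<times> carrier W"
  "zero (direct_sum V W) = (\<zero>\<^bsub>V\<^esub>, \<zero>\<^bsub>W\<^esub>)"
  "add (direct_sum V W) (a, b) (a', b') = (a \<oplus>\<^bsub>V\<^esub> a', b \<oplus>\<^bsub>W\<^esub> b')"
  "smult (direct_sum V W) c (a, b) = (c \<odot>\<^bsub>V\<^esub> a, c \<odot>\<^bsub>W\<^esub> b)"
  by (simp_all add: direct_sum_def)

lemma dsum2_simps [simp]:
  "obj (dsum2 F G) v = direct_sum (obj F v) (obj G v)"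
  "mor (dsum2 F G) v u = map_prod (mor F v u) (mor G v u)"
  by (simp_all add: dsum2_def)

lemma is_vfunctor_dsum2:
  assumes F: "is_vfunctor I K F" and G: "is_vfunctor I K G"
  shows "is_vfunctor I K (dsum2 F G)"
  unfolding is_vfunctor_def
proof (intro conjI ballI impI)
  fix v u assume vu: "v \<in> I" "u \<in> I" "v \<le> u"
  note hF = is_vfunctor_mor[OF F vu] and hG = is_vfunctor_mor[OF G vu]
  show "mor (dsum2 F G) v u \<in> module_hom K (obj (dsum2 F G) v) (obj (dsum2 F G) u)"
    by (rule module_homI)
      (auto simp: is_vfunctor_mor_closed[OF F vu] is_vfunctor_mor_closed[OF G vu]
        module_hom_add[OF hF] module_hom_add[OF hG] module_hom_smult[OF hF] module_hom_smult[OF hG])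
qed (auto simp: direct_sum_is_vs is_vfunctor_vectorspace[OF F] is_vfunctor_vectorspace[OF G]
      is_vfunctor_mor_id[OF F] is_vfunctor_mor_id[OF G] is_vfunctor_mor_comp[OF F] is_vfunctor_mor_comp[OF G])

section \<open>Free functors on one generator\<close>

lemma is_vfunctor_gen:
  assumes V: "vectorspace K V" shows "is_vfunctor I K (gen_functor v V)"
proof -
  interpret vectorspace K V by fact
  have "subspace K {\<zero>\<^bsub>V\<^esub>} V" by (rule subspaceI[OF V]) auto
  hence "vectorspace K (V\<lparr>carrier := {\<zero>\<^bsub>V\<^esub>}\<rparr>)" by (rule subspace_is_vs)
  with V show ?thesis unfolding is_vfunctor_def gen_functor_def
    by (auto simp: module_hom_def)
qed

lemma gen_functor_simps [simp]:
  "zero (obj (gen_functor v V) q) = \<zero>\<^bsub>V\<^esub>"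
  "add (obj (gen_functor v V) q) = add V"
  "smult (obj (gen_functor v V) q) = smult V"
  "carrier (obj (gen_functor v V) q) = (if v \<le> q then carrier V else {\<zero>\<^bsub>V\<^esub>})"
  "mor (gen_functor v V) q r x = x"
  by (simp_all add: gen_functor_def)

lemma self_module_simps [simp]:
  "carrier (self_module K) = carrier K" "zero (self_module K) = \<zero>\<^bsub>K\<^esub>"
  "add (self_module K) = add K" "smult (self_module K) = mult K"
  by (simp_all add: self_module_def)

lemma vectorspace_self_module:
  assumes "field K" shows "vectorspace K (self_module K)"
proof -
  interpret field K by fact
  show ?thesis
    by (rule vs_criteria[OF assms])
      (auto simp: a_ac m_assoc l_distr r_distr intro!: bexI[of _ "\<ominus>\<^bsub>K\<^esub> _"] r_neg)
qed

lemma is_vfunctor_K_functor: "field K \<Longrightarrow> is_vfunctor I K (K_functor K v)"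
  unfolding K_functor_def by (rule is_vfunctor_gen[OF vectorspace_self_module])

section \<open>Bases of functors\<close>

locale basis = family K F B s x
  for K :: "('k, 'm) ring_scheme" and F :: "(rat, 'k, 'a) vfunctor"
    and B :: "'b set" and s :: "'b \<Rightarrow> rat" and x :: "'b \<Rightarrow> 'a" +
  assumes gen: generating and indep: independent
begin

lemma basis_self: "basis K F B s x" ..

lemma comb_inj:
  assumes q: "0 \<le> q" and c: "c \<in> B \<rightarrow> carrier K" and d: "d \<in> B \<rightarrow> carrier K"
    and eq: "comb F B s x q c = comb F B s x q d" and b: "b \<in> B" "s b \<le> q"
  shows "c b = d b"
proof -
  interpret vectorspace K "obj F q" using vs q by simp
  let ?d = "\<lambda>b. (\<ominus>\<^bsub>K\<^esub> \<one>\<^bsub>K\<^esub>) \<otimes>\<^bsub>K\<^esub> d b"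
  have d': "?d \<in> B \<rightarrow> carrier K" using d by auto
  have "comb F B s x q (\<lambda>b. c b \<oplus>\<^bsub>K\<^esub> ?d b) = comb F B s x q c \<oplus>\<^bsub>obj F q\<^esub> (\<ominus>\<^bsub>K\<^esub> \<one>\<^bsub>K\<^esub>) \<odot>\<^bsub>obj F q\<^esub> comb F B s x q d"
    unfolding comb_add[OF q c d'] by (subst comb_smult[OF q d]) auto
  also have "\<dots> = \<zero>\<^bsub>obj F q\<^esub>"
    using comb_closed[OF q d] by (simp add: eq smult_minus_1 M.r_neg)
  finally have "c b \<oplus>\<^bsub>K\<^esub> ?d b = \<zero>\<^bsub>K\<^esub>"
    using indep q c d' b unfolding independent_def by blast
  moreover have cd: "c b \<in> carrier K" "d b \<in> carrier K" using c d b by auto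
  moreover have "?d b = \<ominus>\<^bsub>K\<^esub> d b" using cd R.l_minus R.one_closed by simp
  ultimately show "c b = d b" using R.minus_other_side[of "c b" "d b"] by (simp add: R.minus_eq)
qed

text \<open>
  Coordinates of elements not yet born are set to zero, which makes \<open>coord\<close> linear and natural in \<open>q\<close> for
  every basis element.
\<close>

definition coord :: "rat \<Rightarrow> 'a \<Rightarrow> 'b \<Rightarrow> 'k" where
  "coord q y = (SOME c. c \<in> B \<rightarrow> carrier K \<and> (\<forall>b\<in>B. q < s b \<longrightarrow> c b = \<zero>\<^bsub>K\<^esub>) \<and> y = comb F B s x q c)"

lemma coord_props:
  assumes q: "0 \<le> q" and y: "y \<in> carrier (obj F q)"
  shows "coord q y \<in> B \<rightarrow> carrier K" "b \<in> B \<Longrightarrow> q < s b \<Longrightarrow> coord q y b = \<zero>\<^bsub>K\<^esub>"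
    and "comb F B s x q (coord q y) = y"
proof -
  interpret vectorspace K "obj F q" using vs q by simp
  obtain c where c: "c \<in> B \<rightarrow> carrier K" "y = comb F B s x q c"
    using gen q y unfolding generating_def by blast
  let ?c = "\<lambda>b. if q < s b then \<zero>\<^bsub>K\<^esub> else c b"
  have "y = comb F B s x q ?c" unfolding c(2) by (rule comb_cong[OF q]) (use c in auto)
  moreover have "?c \<in> B \<rightarrow> carrier K" using c by auto
  ultimately have "\<exists>c. c \<in> B \<rightarrow> carrier K \<and> (\<forall>b\<in>B. q < s b \<longrightarrow> c b = \<zero>\<^bsub>K\<^esub>) \<and> y = comb F B s x q c"
    by (intro exI[of _ ?c]) auto
  from someI_ex[OF this, folded coord_def]
  show "coord q y \<in> B \<rightarrow> carrier K" "b \<in> B \<Longrightarrow> q < s b \<Longrightarrow> coord q y b = \<zero>\<^bsub>K\<^esub>"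
    "comb F B s x q (coord q y) = y" by auto
qed

lemma coord_comb:
  assumes q: "0 \<le> q" and c: "c \<in> B \<rightarrow> carrier K" and b: "b \<in> B"
  shows "coord q (comb F B s x q c) b = (if s b \<le> q then c b else \<zero>\<^bsub>K\<^esub>)"
  using coord_props[OF q comb_closed[OF q c]] comb_inj[OF q _ c] b by auto

lemma coord_add:
  assumes q: "0 \<le> q" and y: "y \<in> carrier (obj F q)" "z \<in> carrier (obj F q)" and b: "b \<in> B"
  shows "coord q (y \<oplus>\<^bsub>obj F q\<^esub> z) b = coord q y b \<oplus>\<^bsub>K\<^esub> coord q z b"
proof -
  interpret vectorspace K "obj F q" using vs q by simp
  note cy = coord_props[OF q y(1)] and cz = coord_props[OF q y(2)]
  have "y \<oplus>\<^bsub>obj F q\<^esub> z = comb F B s x q (\<lambda>b. coord q y b \<oplus>\<^bsub>K\<^esub> coord q z b)"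
    using comb_add[OF q cy(1) cz(1)] cy(3) cz(3) by simp
  thus ?thesis using coord_comb[OF q, of "\<lambda>b. coord q y b \<oplus>\<^bsub>K\<^esub> coord q z b" b] b cy(1,2) cz(1,2)
    by (auto simp: Pi_iff)
qed

lemma coord_smult:
  assumes q: "0 \<le> q" and a: "a \<in> carrier K" and y: "y \<in> carrier (obj F q)" and b: "b \<in> B"
  shows "coord q (a \<odot>\<^bsub>obj F q\<^esub> y) b = a \<otimes>\<^bsub>K\<^esub> coord q y b"
proof -
  interpret vectorspace K "obj F q" using vs q by simp
  note cy = coord_props[OF q y]
  have "a \<odot>\<^bsub>obj F q\<^esub> y = comb F B s x q (\<lambda>b. a \<otimes>\<^bsub>K\<^esub> coord q y b)"
    using comb_smult[OF q cy(1) a] cy(3) by simp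
  thus ?thesis using coord_comb[OF q, of "\<lambda>b. a \<otimes>\<^bsub>K\<^esub> coord q y b" b] b cy(1,2) a
    by (auto simp: Pi_iff)
qed

lemma coord_hom:
  "0 \<le> q \<Longrightarrow> b \<in> B \<Longrightarrow> (\<lambda>y. coord q y b) \<in> module_hom K (obj F q) (self_module K)"
  by (rule module_homI) (use coord_props(1) in \<open>auto simp: coord_add coord_smult Pi_iff\<close>)

lemma coord_mor:
  assumes q: "0 \<le> q" "q \<le> q'" and y: "y \<in> carrier (obj F q)" and b: "b \<in> B"
  shows "coord q' (mor F q q' y) b = coord q y b"
proof -
  interpret field K by (rule field_K)
  have q': "0 \<le> q'" using q by simp
  note cy = coord_props[OF q(1) y]
  have "mor F q q' y = comb F B s x q' (\<lambda>b. if s b \<le> q then coord q y b else \<zero>\<^bsub>K\<^esub>)"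
    using comb_mor[OF q cy(1)] cy(3) by simp
  hence "coord q' (mor F q q' y) b = (if s b \<le> q' then if s b \<le> q then coord q y b else \<zero>\<^bsub>K\<^esub> else \<zero>\<^bsub>K\<^esub>)"
    using coord_comb[OF q', of "\<lambda>b. if s b \<le> q then coord q y b else \<zero>\<^bsub>K\<^esub>" b] b cy(1) by (auto simp: Pi_iff)
  thus ?thesis using cy(2)[OF b] q by auto
qed

text \<open>
  The universal property of a free functor: a family in \<open>G\<close> extends from the basis.
\<close>

lemma nat_trans_lift:
  assumes g: "family K G B s g"
  shows "nat_trans nnrat K F G (\<lambda>q y. comb G B s g q (coord q y))"
proof -
  interpret g: family K G B s g by fact
  show ?thesis unfolding nat_trans_def
  proof (intro conjI ballI impI)
    fix q :: rat assume "q \<in> nnrat"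
    hence q: "0 \<le> q" by simp
    interpret F: vectorspace K "obj F q" using vs q by simp
    note c = coord_props(1)[OF q]
    show "(\<lambda>y. comb G B s g q (coord q y)) \<in> module_hom K (obj F q) (obj G q)"
    proof (rule module_homI)
      fix y assume "y \<in> carrier (obj F q)"
      thus "comb G B s g q (coord q y) \<in> carrier (obj G q)" using g.comb_closed[OF q c] by simp
    next
      fix y z assume yz: "y \<in> carrier (obj F q)" "z \<in> carrier (obj F q)"
      have "comb G B s g q (coord q (y \<oplus>\<^bsub>obj F q\<^esub> z)) = comb G B s g q (\<lambda>b. coord q y b \<oplus>\<^bsub>K\<^esub> coord q z b)"
        by (rule g.comb_cong[OF q]) (use c yz coord_add[OF q yz] in \<open>auto simp: Pi_iff\<close>)
      thus "comb G B s g q (coord q (y \<oplus>\<^bsub>obj F q\<^esub> z)) = comb G B s g q (coord q y) \<oplus>\<^bsub>obj G q\<^esub> comb G B s g q (coord q z)"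
        using g.comb_add[OF q c c] yz by simp
    next
      fix a y assume ay: "a \<in> carrier K" "y \<in> carrier (obj F q)"
      have "comb G B s g q (coord q (a \<odot>\<^bsub>obj F q\<^esub> y)) = comb G B s g q (\<lambda>b. a \<otimes>\<^bsub>K\<^esub> coord q y b)"
        by (rule g.comb_cong[OF q]) (use c ay coord_smult[OF q ay] in \<open>auto simp: Pi_iff\<close>)
      thus "comb G B s g q (coord q (a \<odot>\<^bsub>obj F q\<^esub> y)) = a \<odot>\<^bsub>obj G q\<^esub> comb G B s g q (coord q y)"
        using g.comb_smult[OF q c] ay by simp
    qed
  next
    fix q q' :: rat and y assume "q \<in> nnrat" "q' \<in> nnrat" and qq': "q \<le> q'" and y: "y \<in> carrier (obj F q)"
    hence q: "0 \<le> q" "0 \<le> q'" by auto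
    interpret field K by (rule field_K)
    note cy = coord_props[OF q(1) y]
    have "comb G B s g q' (coord q' (mor F q q' y)) = comb G B s g q' (\<lambda>b. if s b \<le> q then coord q y b else \<zero>\<^bsub>K\<^esub>)"
      by (rule g.comb_cong[OF q(2)]) (use cy(1,2) coord_mor[OF q(1) qq' y] in \<open>auto simp: Pi_iff not_le\<close>)
    thus "comb G B s g q' (coord q' (mor F q q' y)) = mor G q q' (comb G B s g q (coord q y))"
      using g.comb_mor[OF q(1) qq' cy(1)] by simp
  qed
qed

lemma lift_comb:
  assumes g: "family K G B s g" and q: "0 \<le> q" and c: "c \<in> B \<rightarrow> carrier K"
  shows "comb G B s g q (coord q (comb F B s x q c)) = comb G B s g q c"
proof -
  interpret g: family K G B s g by fact
  show ?thesis by (rule g.comb_cong[OF q c]) (use coord_comb[OF q c] in auto)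
qed

lemma lift_surj:
  assumes g: "family K G B s g" "family.generating K G B s g" and q: "0 \<le> q"
  shows "(\<lambda>y. comb G B s g q (coord q y)) ` carrier (obj F q) = carrier (obj G q)"
proof
  interpret g: family K G B s g by fact
  show "(\<lambda>y. comb G B s g q (coord q y)) ` carrier (obj F q) \<subseteq> carrier (obj G q)"
    using g.comb_closed[OF q coord_props(1)[OF q]] by auto
  show "carrier (obj G q) \<subseteq> (\<lambda>y. comb G B s g q (coord q y)) ` carrier (obj F q)"
  proof
    fix z assume "z \<in> carrier (obj G q)"
    then obtain c where c: "c \<in> B \<rightarrow> carrier K" "z = comb G B s g q c"
      using g(2) q unfolding g.generating_def by blast
    thus "z \<in> (\<lambda>y. comb G B s g q (coord q y)) ` carrier (obj F q)"
      using lift_comb[OF g(1) q c(1)] comb_closed[OF q c(1)] by (metis imageI)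
  qed
qed

end

lemma basis_iso_shape:
  assumes "basis K F B s x" "basis K G B s g"
  shows "isomorphic nnrat K F G"
proof -
  interpret F: basis K F B s x by fact
  interpret G: basis K G B s g by fact
  let ?\<phi> = "\<lambda>q y. comb G B s g q (F.coord q y)"
  note nt = F.nat_trans_lift[OF G.family_axioms]
  have "nat_iso nnrat K F G ?\<phi>"
  proof (rule nat_isoI_bij[OF F.vf nt])
    fix q :: rat assume "q \<in> nnrat"
    hence q: "0 \<le> q" by simp
    have "inj_on (?\<phi> q) (carrier (obj F q))"
    proof (rule inj_onI)
      fix y z assume yz: "y \<in> carrier (obj F q)" "z \<in> carrier (obj F q)" "?\<phi> q y = ?\<phi> q z"
      note cy = F.coord_props[OF q yz(1)] and cz = F.coord_props[OF q yz(2)]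
      have "comb F B s x q (F.coord q y) = comb F B s x q (F.coord q z)"
        by (rule F.comb_cong[OF q cz(1)]) (rule G.comb_inj[OF q cy(1) cz(1) yz(3)])
      thus "y = z" using cy(3) cz(3) by simp
    qed
    thus "bij_betw (?\<phi> q) (carrier (obj F q)) (carrier (obj G q))"
      unfolding bij_betw_def using F.lift_surj[OF G.family_axioms G.gen q] by simp
  qed
  thus ?thesis unfolding isomorphic_def by blast
qed

lemma basis_transfer:
  assumes "basis K F B s x" and G: "is_vfunctor nnrat K G" and \<phi>: "nat_iso nnrat K F G \<phi>"
  shows "basis K G B s (\<lambda>b. \<phi> (s b) (x b))"
proof -
  interpret F: basis K F B s x by fact
  note nt = nat_iso_nat_trans[OF \<phi>] and bij = nat_iso_bij[OF \<phi>]
  interpret G: family K G B s "\<lambda>b. \<phi> (s b) (x b)" by (rule F.family_image[OF G nt])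
  show ?thesis
  proof
    show G.generating unfolding G.generating_def
    proof (intro allI impI ballI)
      fix q :: rat and y assume q: "0 \<le> q" and y: "y \<in> carrier (obj G q)"
      obtain z where z: "z \<in> carrier (obj F q)" "y = \<phi> q z" using bij[of q] q y by (auto simp: bij_betw_def)
      show "\<exists>c\<in>B \<rightarrow> carrier K. y = comb G B s (\<lambda>b. \<phi> (s b) (x b)) q c"
        using F.comb_image[OF G nt q F.coord_props(1)[OF q z(1)]] F.coord_props(1,3)[OF q z(1)] z(2) by metis
    qed
    show G.independent unfolding G.independent_def
    proof (intro allI ballI impI)
      fix q :: rat and c b assume q: "0 \<le> q" and c: "c \<in> B \<rightarrow> carrier K"
        and z: "comb G B s (\<lambda>b. \<phi> (s b) (x b)) q c = \<zero>\<^bsub>obj G q\<^esub>" and b: "b \<in> B" "s b \<le> q"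
      interpret Fq: vectorspace K "obj F q" by (rule F.vs[OF q])
      have q': "q \<in> nnrat" using q by simp
      have "\<phi> q (comb F B s x q c) = \<phi> q \<zero>\<^bsub>obj F q\<^esub>"
        using F.comb_image[OF G nt q c] z hom_zero[OF F.vs[OF q] G.vs[OF q] nat_trans_hom[OF nt q']] by simp
      hence "comb F B s x q c = \<zero>\<^bsub>obj F q\<^esub>"
        using bij[OF q'] F.comb_closed[OF q c] by (auto simp: bij_betw_def inj_on_def)
      thus "c b = \<zero>\<^bsub>K\<^esub>" using F.indep q c b unfolding F.independent_def by blast
    qed
  qed
qed

section \<open>Free functors of finite rank are the functors with a finite basis\<close>

text \<open>
  Evaluation at an index \<open>v\<close> is linear and only sees the elements placed at \<open>v\<close>, so both generation and
  independence of the family can be checked in each \<open>V v\<close>. The index set is arbitrary because the lemma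
  serves two sums: the one over all times that defines freeness, and the one over a finite set of
  generators that gives existence.
\<close>

lemma basis_dsum_gen:
  fixes V :: "'j \<Rightarrow> ('k, 'a) module" and e :: "'b \<Rightarrow> 'a"
  assumes K: "field K" and V: "\<And>v. v \<in> J \<Longrightarrow> vectorspace K (V v)"
    and B: "finite B" "\<And>b. b \<in> B \<Longrightarrow> s b \<in> J" "\<And>b. b \<in> B \<Longrightarrow> 0 \<le> \<sigma> (s b)"
    and e: "\<And>b. b \<in> B \<Longrightarrow> e b \<in> carrier (V (s b))"
    and gen: "\<And>v y. v \<in> J \<Longrightarrow> y \<in> carrier (V v) \<Longrightarrow>
      \<exists>c\<in>B \<rightarrow> carrier K. y = (\<Oplus>\<^bsub>V v\<^esub>b\<in>{b \<in> B. s b = v}. c b \<odot>\<^bsub>V v\<^esub> e b)"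
    and indep: "\<And>v c b. v \<in> J \<Longrightarrow> c \<in> B \<rightarrow> carrier K \<Longrightarrow>
      (\<Oplus>\<^bsub>V v\<^esub>b\<in>{b \<in> B. s b = v}. c b \<odot>\<^bsub>V v\<^esub> e b) = \<zero>\<^bsub>V v\<^esub> \<Longrightarrow> b \<in> B \<Longrightarrow> s b = v \<Longrightarrow> c b = \<zero>\<^bsub>K\<^esub>"
  shows "basis K (dsum J (\<lambda>v. gen_functor (\<sigma> v) (V v))) B (\<lambda>b. \<sigma> (s b))
    (\<lambda>b. \<lambda>v\<in>J. if v = s b then e b else \<zero>\<^bsub>V v\<^esub>)"
proof -
  let ?D = "dsum J (\<lambda>v. gen_functor (\<sigma> v) (V v))"
  let ?g = "\<lambda>b. \<lambda>v\<in>J. if v = s b then e b else \<zero>\<^bsub>V v\<^esub>"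
  have zero: "\<zero>\<^bsub>V v\<^esub> \<in> carrier (V v)" if "v \<in> J" for v
    using V[OF that] by (simp add: vectorspace_def module_def abelian_group_def abelian_monoid.zero_closed)
  have vgen: "is_vfunctor nnrat K (gen_functor (\<sigma> v) (V v))" if "v \<in> J" for v
    by (rule is_vfunctor_gen[OF V[OF that]])
  interpret D: family K ?D B "\<lambda>b. \<sigma> (s b)" ?g
  proof
    show "is_vfunctor nnrat K ?D" by (rule is_vfunctor_dsum[OF K vgen]) simp
    fix b assume b: "b \<in> B"
    show "?g b \<in> carrier (obj ?D (\<sigma> (s b)))" unfolding dsum_simps
      by (rule module_sum_carrierI[of _ _ _ "{s b}"]) (use e[OF b] zero in auto)
  qed (use B in auto)
  have mor_g: "mor ?D v u (?g b) = ?g b" for v u b by (auto simp: restrict_def)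
  \<comment> \<open>Only the elements placed at \<open>v\<close> contribute to the component at \<open>v\<close>.\<close>
  have eval: "comb ?D B (\<lambda>b. \<sigma> (s b)) ?g q c v =
      (if \<sigma> v \<le> q then \<Oplus>\<^bsub>V v\<^esub>b\<in>{b \<in> B. s b = v}. c b \<odot>\<^bsub>V v\<^esub> e b else \<zero>\<^bsub>V v\<^esub>)"
    if q: "0 \<le> q" and v: "v \<in> J" and c: "c \<in> B \<rightarrow> carrier K" for q v c
  proof -
    let ?W = "obj (gen_functor (\<sigma> v) (V v)) q"
    have W: "vectorspace K ?W" using is_vfunctor_vectorspace[OF vgen[OF v]] q by simp
    have hom: "(\<lambda>f. f v) \<in> module_hom K (obj ?D q) ?W"
      using module_sum_eval_hom[of v J K "\<lambda>v. obj (gen_functor (\<sigma> v) (V v)) q"] v by simp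
    show ?thesis
    proof (cases "\<sigma> v \<le> q")
      case False
      have "comb ?D B (\<lambda>b. \<sigma> (s b)) ?g q c v \<in> carrier ?W"
        using module_hom_closed[OF hom] D.comb_closed[OF q c] by blast
      thus ?thesis using False by simp
    next
      case True
      hence WV: "?W = V v" by (simp add: gen_functor_def)
      interpret V: vectorspace K "V v" by (rule V[OF v])
      have cl: "c b \<odot>\<^bsub>obj ?D q\<^esub> mor ?D (\<sigma> (s b)) q (?g b) \<in> carrier (obj ?D q)" if "b \<in> B" "\<sigma> (s b) \<le> q" for b
      proof -
        interpret Dq: vectorspace K "obj ?D q" by (rule D.vs[OF q])
        show ?thesis using c that by (intro Dq.smult_closed D.mor_x_closed) auto
      qed
      have "comb ?D B (\<lambda>b. \<sigma> (s b)) ?g q c v = (\<Oplus>\<^bsub>?W\<^esub>b\<in>{b \<in> B. \<sigma> (s b) \<le> q}. (c b \<odot>\<^bsub>obj ?D q\<^esub> mor ?D (\<sigma> (s b)) q (?g b)) v)"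
        unfolding comb_def by (rule hom_finsum[OF D.vs[OF q] W hom]) (use cl in auto)
      also have "\<dots> = (\<Oplus>\<^bsub>V v\<^esub>b\<in>{b \<in> B. \<sigma> (s b) \<le> q}. c b \<odot>\<^bsub>V v\<^esub> (if v = s b then e b else \<zero>\<^bsub>V v\<^esub>))"
        unfolding WV by (rule V.M.finsum_cong') (use c v e in \<open>auto simp: Pi_iff\<close>)
      also have "\<dots> = (\<Oplus>\<^bsub>V v\<^esub>b\<in>{b \<in> B. s b = v}. c b \<odot>\<^bsub>V v\<^esub> e b)"
        by (rule V.M.add.finprod_mono_neutral_cong_right) (use B c e True in \<open>auto simp: Pi_iff\<close>)
      finally show ?thesis using True by simp
    qed
  qed
  show ?thesis
  proof
    show D.generating unfolding D.generating_def
    proof (intro allI impI ballI)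
      fix q :: rat and y assume q: "0 \<le> q" and y: "y \<in> carrier (obj ?D q)"
      hence yc: "y v \<in> (if \<sigma> v \<le> q then carrier (V v) else {\<zero>\<^bsub>V v\<^esub>})" if "v \<in> J" for v
        using that by (auto simp: module_sum_carrier PiE_iff)
      have "\<forall>v. \<exists>c. v \<in> J \<and> \<sigma> v \<le> q \<longrightarrow> c \<in> B \<rightarrow> carrier K \<and> y v = (\<Oplus>\<^bsub>V v\<^esub>b\<in>{b \<in> B. s b = v}. c b \<odot>\<^bsub>V v\<^esub> e b)"
      proof
        fix v
        show "\<exists>c. v \<in> J \<and> \<sigma> v \<le> q \<longrightarrow> c \<in> B \<rightarrow> carrier K \<and> y v = (\<Oplus>\<^bsub>V v\<^esub>b\<in>{b \<in> B. s b = v}. c b \<odot>\<^bsub>V v\<^esub> e b)"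
        proof (cases "v \<in> J \<and> \<sigma> v \<le> q")
          case True
          hence "y v \<in> carrier (V v)" using yc[of v] by simp
          from gen[OF _ this] True show ?thesis by blast
        qed blast
      qed
      from choice[OF this] obtain C where C: "\<And>v. v \<in> J \<Longrightarrow> \<sigma> v \<le> q \<Longrightarrow> C v \<in> B \<rightarrow> carrier K"
        "\<And>v. v \<in> J \<Longrightarrow> \<sigma> v \<le> q \<Longrightarrow> y v = (\<Oplus>\<^bsub>V v\<^esub>b\<in>{b \<in> B. s b = v}. C v b \<odot>\<^bsub>V v\<^esub> e b)"
        by blast
      interpret field K by (rule K)
      define c where "c b = (if \<sigma> (s b) \<le> q then C (s b) b else \<zero>\<^bsub>K\<^esub>)" for b
      have c: "c \<in> B \<rightarrow> carrier K" using C(1) B(2) by (auto simp: c_def Pi_iff)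
      have "y = comb ?D B (\<lambda>b. \<sigma> (s b)) ?g q c"
      proof (rule extensionalityI[of y J])
        show "y \<in> extensional J" using y by (simp add: module_sum_carrierD(2))
        show "comb ?D B (\<lambda>b. \<sigma> (s b)) ?g q c \<in> extensional J"
          using D.comb_closed[OF q c] by (simp add: module_sum_carrierD(2))
        fix v assume v: "v \<in> J"
        interpret V: vectorspace K "V v" by (rule V[OF v])
        show "y v = comb ?D B (\<lambda>b. \<sigma> (s b)) ?g q c v"
        proof (cases "\<sigma> v \<le> q")
          case True
          have "y v = (\<Oplus>\<^bsub>V v\<^esub>b\<in>{b \<in> B. s b = v}. c b \<odot>\<^bsub>V v\<^esub> e b)"
            unfolding C(2)[OF v True]
          proof (rule V.M.finsum_cong')
            show "(\<lambda>b. c b \<odot>\<^bsub>V v\<^esub> e b) \<in> {b \<in> B. s b = v} \<rightarrow> carrier (V v)"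
            proof
              fix b assume "b \<in> {b \<in> B. s b = v}"
              hence b: "b \<in> B" "s b = v" by auto
              have "e b \<in> carrier (V v)" using e[OF b(1)] b(2) by simp
              moreover have "c b \<in> carrier K" using c b(1) by auto
              ultimately show "c b \<odot>\<^bsub>V v\<^esub> e b \<in> carrier (V v)" by (intro V.smult_closed)
            qed
          qed (use True in \<open>auto simp: c_def\<close>)
          thus ?thesis using eval[OF q v c] True by simp
        next
          case False
          thus ?thesis using eval[OF q v c] yc[OF v] by simp
        qed
      qed
      thus "\<exists>c\<in>B \<rightarrow> carrier K. y = comb ?D B (\<lambda>b. \<sigma> (s b)) ?g q c" using c by blast
    qed
    show D.independent unfolding D.independent_def
    proof (intro allI impI ballI)
      fix q :: rat and c b assume q: "0 \<le> q" and c: "c \<in> B \<rightarrow> carrier K"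
        and z: "comb ?D B (\<lambda>b. \<sigma> (s b)) ?g q c = \<zero>\<^bsub>obj ?D q\<^esub>" and b: "b \<in> B" "\<sigma> (s b) \<le> q"
      have "comb ?D B (\<lambda>b. \<sigma> (s b)) ?g q c (s b) = \<zero>\<^bsub>V (s b)\<^esub>" unfolding z using B(2)[OF b(1)] by simp
      thus "c b = \<zero>\<^bsub>K\<^esub>"
        using eval[OF q B(2)[OF b(1)] c] b indep[OF B(2)[OF b(1)] c _ b(1)] by simp
    qed
  qed
qed

text \<open>
  The dimension in terms of indexed families: independence makes the family injective, so that its
  range is a basis.
\<close>

lemma (in vectorspace) dim_family:
  assumes T: "finite T" and e: "\<And>b. b \<in> T \<Longrightarrow> e b \<in> carrier V"
    and gen: "\<And>y. y \<in> carrier V \<Longrightarrow> \<exists>c\<in>T \<rightarrow> carrier K. y = (\<Oplus>\<^bsub>V\<^esub>b\<in>T. c b \<odot>\<^bsub>V\<^esub> e b)"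
    and indep: "\<And>c b. c \<in> T \<rightarrow> carrier K \<Longrightarrow> (\<Oplus>\<^bsub>V\<^esub>b\<in>T. c b \<odot>\<^bsub>V\<^esub> e b) = \<zero>\<^bsub>V\<^esub> \<Longrightarrow> b \<in> T \<Longrightarrow> c b = \<zero>\<^bsub>K\<^esub>"
  shows "fin_dim" "dim = card T"
proof -
  have inj: "inj_on e T"
  proof (rule inj_onI, rule ccontr)
    fix a b assume ab: "a \<in> T" "b \<in> T" "e a = e b" "a \<noteq> b"
    define c where "c i = (if i = a then \<one>\<^bsub>K\<^esub> else if i = b then \<ominus>\<^bsub>K\<^esub> \<one>\<^bsub>K\<^esub> else \<zero>\<^bsub>K\<^esub>)" for i
    have c: "c \<in> T \<rightarrow> carrier K" by (auto simp: c_def)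
    define f where "f i = c i \<odot>\<^bsub>V\<^esub> e i" for i
    have f: "f i \<in> carrier V" if "i \<in> T" for i using e[OF that] c that by (auto simp: f_def)
    have fa: "f a = e b" and fb: "f b = \<ominus>\<^bsub>V\<^esub> e b"
      using ab e[OF ab(2)] by (simp_all add: f_def c_def smult_minus_1)
    have T': "insert a (insert b (T - {a, b})) = T" using ab by auto
    have "finsum V f (insert a (insert b (T - {a, b}))) = f a \<oplus>\<^bsub>V\<^esub> finsum V f (insert b (T - {a, b}))"
      by (rule M.finsum_insert) (use T ab f in auto)
    also have "finsum V f (insert b (T - {a, b})) = f b \<oplus>\<^bsub>V\<^esub> finsum V f (T - {a, b})"
      by (rule M.finsum_insert) (use T ab f in auto)
    also have "finsum V f (T - {a, b}) = \<zero>\<^bsub>V\<^esub>"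
      by (rule M.finsum_all0) (use e in \<open>auto simp: f_def c_def\<close>)
    finally have "finsum V f T = \<zero>\<^bsub>V\<^esub>"
      unfolding T' fa fb using e[OF ab(2)] by (simp add: M.r_neg)
    from indep[OF c this[unfolded f_def] ab(1)] show False by (simp add: c_def)
  qed
  let ?A = "e ` T"
  have A: "finite ?A" "?A \<subseteq> carrier V" using T e by auto
  have lc: "lincomb a ?A = (\<Oplus>\<^bsub>V\<^esub>b\<in>T. a (e b) \<odot>\<^bsub>V\<^esub> e b)" if "a \<in> ?A \<rightarrow> carrier K" for a
    unfolding lincomb_def by (rule M.add.finprod_reindex[OF _ inj]) (use that e in auto)
  have "lin_indpt ?A"
  proof (rule finite_lin_indpt2[OF A])
    fix a assume a: "a \<in> ?A \<rightarrow> carrier K" "lincomb a ?A = \<zero>\<^bsub>V\<^esub>"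
    have "(\<lambda>b. a (e b)) \<in> T \<rightarrow> carrier K" using a(1) by auto
    note zero = indep[OF this trans[OF lc[OF a(1), symmetric] a(2)]]
    show "\<forall>v\<in>?A. a v = \<zero>\<^bsub>K\<^esub>" by (intro ballI, elim imageE, hypsubst, rule zero)
  qed
  moreover have gA: "gen_set ?A"
  proof
    show "span ?A \<subseteq> carrier V" by (rule span_is_subset2[OF A(2)])
    show "carrier V \<subseteq> span ?A"
    proof
      fix y assume "y \<in> carrier V"
      then obtain c where c: "c \<in> T \<rightarrow> carrier K" "y = (\<Oplus>\<^bsub>V\<^esub>b\<in>T. c b \<odot>\<^bsub>V\<^esub> e b)" using gen by blast
      let ?a = "\<lambda>v. c (inv_into T e v)"
      have a: "?a \<in> ?A \<rightarrow> carrier K" using c(1) inj by (auto simp: inv_into_f_f)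
      have "lincomb ?a ?A = y"
        unfolding lc[OF a] c(2) by (rule M.finsum_cong') (use inj c(1) e in \<open>auto simp: inv_into_f_f\<close>)
      thus "y \<in> span ?A" using a finite_span[OF A] by blast
    qed
  qed
  ultimately have "basis ?A" using A unfolding basis_def by simp
  thus "dim = card T" using dim_basis[OF A(1)] card_image[OF inj] by simp
  show fin_dim unfolding fin_dim_def using A gA by blast
qed

text \<open>
  Bases of the spaces \<open>V v\<close>, indexed by their elements together with the time \<open>v\<close>, form a basis.
\<close>

lemma free_of_rank_imp_basis:
  fixes P :: "(rat, 'k, 'a) vfunctor"
  assumes "free_of_rank K P n"
  shows "\<exists>(B :: (rat \<times> 'a) set) s e. basis K P B s e \<and> card B = n"
proof -
  obtain V where free: "free_on K P V"
    and fd': "\<forall>v\<in>nnrat. vectorspace.fin_dim K (V v)"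
    and supp: "finite {v\<in>nnrat. vectorspace.dim K (V v) \<noteq> 0}"
    and n: "n = (\<Sum>v\<in>{v\<in>nnrat. vectorspace.dim K (V v) \<noteq> 0}. vectorspace.dim K (V v))"
    using assms unfolding free_of_rank_def by blast
  have fd: "vectorspace.fin_dim K (V v)" if "0 \<le> v" for v using fd' that by simp
  have P: "is_vfunctor nnrat K P" and V: "\<And>v. 0 \<le> v \<Longrightarrow> vectorspace K (V v)"
    and iso: "isomorphic nnrat K P (dsum nnrat (\<lambda>v. gen_functor v (V v)))"
    using free by (simp_all add: free_on_def)
  have K: "field K" using V[of 0] by (simp add: vectorspace_def)
  have "\<exists>\<beta>. finite \<beta> \<and> vectorspace.basis K (V v) \<beta>" if "0 \<le> v" for v
    using vectorspace.finite_basis_exists[OF V[OF that] fd[OF that]] .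
  then obtain \<beta> where \<beta>: "\<And>v. 0 \<le> v \<Longrightarrow> finite (\<beta> v)" "\<And>v. 0 \<le> v \<Longrightarrow> vectorspace.basis K (V v) (\<beta> v)"
    by metis
  have dim: "vectorspace.dim K (V v) = card (\<beta> v)" if "0 \<le> v" for v
    using vectorspace.dim_basis[OF V[OF that] \<beta>(1)[OF that] \<beta>(2)[OF that]] .
  define B where "B = Sigma nnrat \<beta>"
  have Bs: "B = Sigma {v\<in>nnrat. vectorspace.dim K (V v) \<noteq> 0} \<beta>"
    unfolding B_def using dim \<beta>(1) by (auto simp: card_gt_0_iff)
  have finB: "finite B" unfolding Bs using supp \<beta>(1) by (intro finite_SigmaI) auto
  have cardB: "card B = n"
    unfolding Bs n using supp \<beta>(1) dim by (subst card_SigmaI) auto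
  have fiber: "{b \<in> B. fst b = v} = Pair v ` \<beta> v" if "0 \<le> v" for v
    unfolding B_def using that by auto
  have sum: "(\<Oplus>\<^bsub>V v\<^esub>b\<in>{b \<in> B. fst b = v}. c b \<odot>\<^bsub>V v\<^esub> snd b) = module.lincomb (V v) (\<lambda>a. c (v, a)) (\<beta> v)"
    if v: "0 \<le> v" and c: "\<And>a. a \<in> \<beta> v \<Longrightarrow> c (v, a) \<in> carrier K" for v c
  proof -
    interpret vectorspace K "V v" by (rule V[OF v])
    have "\<beta> v \<subseteq> carrier (V v)" using \<beta>(2)[OF v] by (simp add: basis_def)
    thus ?thesis unfolding fiber[OF v] lincomb_def
      using c by (subst M.add.finprod_reindex) (auto simp: inj_on_def)
  qed
  have "basis K (dsum nnrat (\<lambda>v. gen_functor v (V v))) B fst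
    (\<lambda>b. \<lambda>v\<in>nnrat. if v = fst b then snd b else \<zero>\<^bsub>V v\<^esub>)"
  proof (rule basis_dsum_gen[where \<sigma> = "\<lambda>v. v" and s = fst, OF K _ finB])
    fix b assume "b \<in> B"
    thus "0 \<le> fst b" "fst b \<in> nnrat" by (auto simp: B_def)
    then interpret vectorspace K "V (fst b)" by (intro V)
    show "snd b \<in> carrier (V (fst b))"
      using \<beta>(2)[OF \<open>0 \<le> fst b\<close>] \<open>b \<in> B\<close> by (auto simp: B_def basis_def)
  next
    fix v y assume "v \<in> nnrat" and y: "y \<in> carrier (V v)"
    hence v: "0 \<le> v" by simp
    interpret vectorspace K "V v" by (rule V[OF v])
    have \<beta>v: "finite (\<beta> v)" "\<beta> v \<subseteq> carrier (V v)" "gen_set (\<beta> v)" using \<beta>[OF v] by (auto simp: basis_def)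
    obtain a where a: "a \<in> \<beta> v \<rightarrow> carrier K" "lincomb a (\<beta> v) = y"
      using finite_in_span[OF \<beta>v(1,2)] \<beta>v(3) y by blast
    let ?c = "\<lambda>b. if fst b = v then a (snd b) else \<zero>\<^bsub>K\<^esub>"
    have "?c \<in> B \<rightarrow> carrier K" using a(1) by (auto simp: B_def Pi_iff)
    moreover have "y = (\<Oplus>\<^bsub>V v\<^esub>b\<in>{b \<in> B. fst b = v}. ?c b \<odot>\<^bsub>V v\<^esub> snd b)"
      using sum[OF v, of ?c] a by (auto simp: Pi_iff)
    ultimately show "\<exists>c\<in>B \<rightarrow> carrier K. y = (\<Oplus>\<^bsub>V v\<^esub>b\<in>{b \<in> B. fst b = v}. c b \<odot>\<^bsub>V v\<^esub> snd b)"
      by (intro bexI[of _ ?c])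
  next
    fix v c b assume "v \<in> nnrat" and c: "c \<in> B \<rightarrow> carrier K"
      and z: "(\<Oplus>\<^bsub>V v\<^esub>b\<in>{b \<in> B. fst b = v}. c b \<odot>\<^bsub>V v\<^esub> snd b) = \<zero>\<^bsub>V v\<^esub>" and b: "b \<in> B" "fst b = v"
    hence v: "0 \<le> v" by simp
    interpret vectorspace K "V v" by (rule V[OF v])
    have \<beta>v: "finite (\<beta> v)" "\<beta> v \<subseteq> carrier (V v)" "lin_indpt (\<beta> v)" using \<beta>[OF v] by (auto simp: basis_def)
    have cv: "c (v, a) \<in> carrier K" if "a \<in> \<beta> v" for a using c that v by (auto simp: B_def)
    have "lincomb (\<lambda>a. c (v, a)) (\<beta> v) = \<zero>\<^bsub>V v\<^esub>" using sum[of v c, OF v cv] z by simp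
    moreover have "snd b \<in> \<beta> v" using b by (auto simp: B_def)
    ultimately have "c (v, snd b) = \<zero>\<^bsub>K\<^esub>"
      using lin_dep_crit[OF \<beta>v(1) order_refl, of "\<lambda>a. c (v, a)" "snd b"] \<beta>v(3) cv by auto
    thus "c b = \<zero>\<^bsub>K\<^esub>" using b(2) by (metis prod.collapse)
  qed (simp add: V)
  moreover obtain \<theta> where "nat_iso nnrat K (dsum nnrat (\<lambda>v. gen_functor v (V v))) P \<theta>"
    using isomorphic_sym[OF iso] by (auto simp: isomorphic_def)
  ultimately have "basis K P B fst (\<lambda>b. \<theta> (fst b) (\<lambda>v\<in>nnrat. if v = fst b then snd b else \<zero>\<^bsub>V v\<^esub>))"
    using basis_transfer[OF _ P] by blast
  with cardB show ?thesis by blast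
qed

text \<open>Conversely \<open>V v\<close> can be taken to be the span in \<open>F v\<close> of the basis elements born at \<open>v\<close>.\<close>

lemma (in basis) free_of_rank_card: "free_of_rank K F (card B)"
proof -
  define W where "W v = {comb F B s x v c | c. c \<in> B \<rightarrow> carrier K \<and> (\<forall>b\<in>B. s b \<noteq> v \<longrightarrow> c b = \<zero>\<^bsub>K\<^esub>)}" for v
  define V where "V v = (obj F v)\<lparr>carrier := W v\<rparr>" for v
  have Vs: "carrier (V v) = W v" "smult (V v) = smult (obj F v)" "zero (V v) = zero (obj F v)"
    "add (V v) = add (obj F v)" for v by (simp_all add: V_def)
  interpret K: field K by (rule field_K)
  have sub: "subspace K (W v) (obj F v)" if v: "0 \<le> v" for v
  proof (rule subspaceI[OF vs[OF v]])
    show "W v \<subseteq> carrier (obj F v)" unfolding W_def using comb_closed[OF v] by auto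
    show "\<zero>\<^bsub>obj F v\<^esub> \<in> W v" unfolding W_def using comb_zero[OF v]
      by (auto intro!: exI[of _ "\<lambda>b. \<zero>\<^bsub>K\<^esub>"])
  next
    fix y z assume "y \<in> W v" "z \<in> W v"
    then obtain c d where cd: "c \<in> B \<rightarrow> carrier K" "\<forall>b\<in>B. s b \<noteq> v \<longrightarrow> c b = \<zero>\<^bsub>K\<^esub>" "y = comb F B s x v c"
      "d \<in> B \<rightarrow> carrier K" "\<forall>b\<in>B. s b \<noteq> v \<longrightarrow> d b = \<zero>\<^bsub>K\<^esub>" "z = comb F B s x v d" unfolding W_def by blast
    thus "y \<oplus>\<^bsub>obj F v\<^esub> z \<in> W v" unfolding W_def
      using comb_add[OF v cd(1,4)] by (auto intro!: exI[of _ "\<lambda>b. c b \<oplus>\<^bsub>K\<^esub> d b"])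
  next
    fix a y assume a: "a \<in> carrier K" and "y \<in> W v"
    then obtain c where c: "c \<in> B \<rightarrow> carrier K" "\<forall>b\<in>B. s b \<noteq> v \<longrightarrow> c b = \<zero>\<^bsub>K\<^esub>" "y = comb F B s x v c"
      unfolding W_def by blast
    thus "a \<odot>\<^bsub>obj F v\<^esub> y \<in> W v" unfolding W_def
      using comb_smult[OF v c(1) a] a by (auto intro!: exI[of _ "\<lambda>b. a \<otimes>\<^bsub>K\<^esub> c b"])
  qed
  have VV: "vectorspace K (V v)" if "0 \<le> v" for v
    unfolding V_def by (rule vectorspace.subspace_is_vs[OF vs[OF that] sub[OF that]])
  have xW: "x b \<in> W (s b)" if b: "b \<in> B" for b
  proof -
    have "x b = comb F B s x (s b) (\<lambda>b'. if b' = b then \<one>\<^bsub>K\<^esub> else \<zero>\<^bsub>K\<^esub>)"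
      using comb_unit[OF b order_refl] is_vfunctor_mor_id[OF vf _ x_closed[OF b]] s_nonneg[OF b] by simp
    thus ?thesis unfolding W_def using b by (auto intro!: exI[of _ "\<lambda>b'. if b' = b then \<one>\<^bsub>K\<^esub> else \<zero>\<^bsub>K\<^esub>"])
  qed
  have fib: "(\<Oplus>\<^bsub>V v\<^esub>b\<in>{b \<in> B. s b = v}. c b \<odot>\<^bsub>V v\<^esub> x b)
      = comb F B s x v (\<lambda>b. if s b = v then c b else \<zero>\<^bsub>K\<^esub>)"
    if v: "0 \<le> v" and c: "\<And>b. b \<in> B \<Longrightarrow> s b = v \<Longrightarrow> c b \<in> carrier K" for v c
  proof -
    interpret V: vectorspace K "V v" by (rule VV[OF v])
    interpret Fv: vectorspace K "obj F v" by (rule vs[OF v])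
    have hom: "(\<lambda>y. y) \<in> module_hom K (V v) (obj F v)"
      by (rule module_homI) (use subspaceD(2)[OF sub[OF v]] in \<open>auto simp: Vs\<close>)
    have mid: "mor F v v (x b) = x b" if "b \<in> B" "s b = v" for b
      using is_vfunctor_mor_id[OF vf _ x_closed[OF that(1)]] that v by simp
    have xc: "x b \<in> carrier (obj F v)" if "b \<in> B" "s b = v" for b using x_closed[OF that(1)] that(2) by simp
    have "(\<Oplus>\<^bsub>V v\<^esub>b\<in>{b \<in> B. s b = v}. c b \<odot>\<^bsub>V v\<^esub> x b) = (\<Oplus>\<^bsub>obj F v\<^esub>b\<in>{b \<in> B. s b = v}. c b \<odot>\<^bsub>V v\<^esub> x b)"
    proof (rule hom_finsum[OF VV[OF v] vs[OF v] hom])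
      show "(\<lambda>b. c b \<odot>\<^bsub>V v\<^esub> x b) \<in> {b \<in> B. s b = v} \<rightarrow> carrier (V v)"
      proof
        fix b assume "b \<in> {b \<in> B. s b = v}"
        hence b: "b \<in> B" "s b = v" by auto
        have "x b \<in> carrier (V v)" using xW[OF b(1)] b(2) by (simp add: Vs(1))
        thus "c b \<odot>\<^bsub>V v\<^esub> x b \<in> carrier (V v)" by (rule V.smult_closed[OF c[OF b]])
      qed
    qed
    also have "\<dots> = comb F B s x v (\<lambda>b. if s b = v then c b else \<zero>\<^bsub>K\<^esub>)"
      unfolding comb_def
      by (rule Fv.M.add.finprod_mono_neutral_cong_left)
        (use finite_B c mid xc mor_x_closed in \<open>auto simp: Vs\<close>)
    finally show ?thesis .
  qed
  have gen_V: "\<exists>c\<in>B \<rightarrow> carrier K. y = (\<Oplus>\<^bsub>V v\<^esub>b\<in>{b \<in> B. s b = v}. c b \<odot>\<^bsub>V v\<^esub> x b)"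
    if v: "0 \<le> v" and y: "y \<in> carrier (V v)" for v y
  proof -
    from y[unfolded Vs(1) W_def mem_Collect_eq] obtain c where c: "c \<in> B \<rightarrow> carrier K" "\<forall>b\<in>B. s b \<noteq> v \<longrightarrow> c b = \<zero>\<^bsub>K\<^esub>" "y = comb F B s x v c"
      by (elim exE conjE)
    have cK: "c b \<in> carrier K" if "b \<in> B" "s b = v" for b using c(1) that by blast
    have "y = comb F B s x v (\<lambda>b. if s b = v then c b else \<zero>\<^bsub>K\<^esub>)"
      unfolding c(3) by (rule comb_cong[OF v]) (use c(2) cK in auto)
    also have "\<dots> = (\<Oplus>\<^bsub>V v\<^esub>b\<in>{b \<in> B. s b = v}. c b \<odot>\<^bsub>V v\<^esub> x b)"
      by (rule fib[OF v cK, symmetric])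
    finally show ?thesis using c(1) ..
  qed
  have indep_V: "c b = \<zero>\<^bsub>K\<^esub>"
    if v: "0 \<le> v" and c: "\<And>b. b \<in> B \<Longrightarrow> s b = v \<Longrightarrow> c b \<in> carrier K"
      and z: "(\<Oplus>\<^bsub>V v\<^esub>b\<in>{b \<in> B. s b = v}. c b \<odot>\<^bsub>V v\<^esub> x b) = \<zero>\<^bsub>V v\<^esub>" and b: "b \<in> B" "s b = v" for v c b
  proof -
    let ?c = "\<lambda>b. if s b = v then c b else \<zero>\<^bsub>K\<^esub>"
    have "?c \<in> B \<rightarrow> carrier K" using c by auto
    moreover have "comb F B s x v ?c = \<zero>\<^bsub>obj F v\<^esub>"
      using trans[OF fib[OF v c, symmetric] z] by (simp only: Vs(3))
    moreover have "s b \<le> v" using b(2) by simp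
    ultimately have "?c b = \<zero>\<^bsub>K\<^esub>"
      using indep[unfolded independent_def, rule_format, of v ?c b] v b(1) by blast
    thus ?thesis using b(2) by simp
  qed
  have "basis K (dsum nnrat (\<lambda>v. gen_functor v (V v))) B s (\<lambda>b. \<lambda>v\<in>nnrat. if v = s b then x b else \<zero>\<^bsub>V v\<^esub>)"
  proof (rule basis_dsum_gen[where \<sigma> = "\<lambda>v. v" and s = s, OF field_K _ finite_B])
    show "\<exists>c\<in>B \<rightarrow> carrier K. y = (\<Oplus>\<^bsub>V v\<^esub>b\<in>{b \<in> B. s b = v}. c b \<odot>\<^bsub>V v\<^esub> x b)"
      if "v \<in> nnrat" "y \<in> carrier (V v)" for v y by (rule gen_V) (use that in auto)
    show "c b = \<zero>\<^bsub>K\<^esub>" if "v \<in> nnrat" "c \<in> B \<rightarrow> carrier K"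
      "(\<Oplus>\<^bsub>V v\<^esub>b\<in>{b \<in> B. s b = v}. c b \<odot>\<^bsub>V v\<^esub> x b) = \<zero>\<^bsub>V v\<^esub>" "b \<in> B" "s b = v" for v c b
      by (rule indep_V[OF _ _ that(3-5)]) (use that(1,2) in auto)
  qed (use xW VV s_nonneg in \<open>auto simp: Vs(1)\<close>)
  hence iso: "isomorphic nnrat K F (dsum nnrat (\<lambda>v. gen_functor v (V v)))"
    using basis_iso_shape[OF basis_self] by blast
  have dim: "vectorspace.fin_dim K (V v)" "vectorspace.dim K (V v) = card {b \<in> B. s b = v}" if v: "0 \<le> v" for v
  proof -
    interpret V: vectorspace K "V v" by (rule VV[OF v])
    let ?T = "{b \<in> B. s b = v}"
    have 1: "finite ?T" using finite_B by simp
    have 2: "x b \<in> carrier (V v)" if "b \<in> ?T" for b using that xW by (auto simp: Vs(1))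
    have 3: "\<exists>c\<in>?T \<rightarrow> carrier K. y = (\<Oplus>\<^bsub>V v\<^esub>b\<in>?T. c b \<odot>\<^bsub>V v\<^esub> x b)" if y: "y \<in> carrier (V v)" for y
    proof -
      from gen_V[OF v y] obtain c where c: "c \<in> B \<rightarrow> carrier K" "y = (\<Oplus>\<^bsub>V v\<^esub>b\<in>?T. c b \<odot>\<^bsub>V v\<^esub> x b)"
        by (elim bexE)
      from c(1) have "c \<in> ?T \<rightarrow> carrier K" by auto
      with c(2) show ?thesis by (intro bexI[of _ c])
    qed
    have 4: "c b = \<zero>\<^bsub>K\<^esub>" if c: "c \<in> ?T \<rightarrow> carrier K"
      and z: "(\<Oplus>\<^bsub>V v\<^esub>b\<in>?T. c b \<odot>\<^bsub>V v\<^esub> x b) = \<zero>\<^bsub>V v\<^esub>" and b: "b \<in> ?T" for c b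
    proof (rule indep_V[OF v _ z])
      fix b assume "b \<in> B" "s b = v"
      with c show "c b \<in> carrier K" by auto
    qed (use b in auto)
    show "V.fin_dim" "V.dim = card ?T"
      by (rule V.dim_family[where T = ?T and e = x];
          (rule 1 | (rule 2, assumption) | (rule 3, assumption) | (rule 4, assumption, assumption, assumption)))+
  qed
  have supp: "{v\<in>nnrat. vectorspace.dim K (V v) \<noteq> 0} = s ` B"
    using dim(2) s_nonneg finite_B by (auto simp: card_gt_0_iff)
  have "card B = (\<Sum>v\<in>s ` B. card {b \<in> B. s b = v})"
    using sum.image_gen[OF finite_B, of "\<lambda>_. 1 :: nat" s] by simp
  also have "\<dots> = (\<Sum>v\<in>s ` B. vectorspace.dim K (V v))"
    using dim(2) s_nonneg by (intro sum.cong) auto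
  finally have "card B = (\<Sum>v\<in>{v\<in>nnrat. vectorspace.dim K (V v) \<noteq> 0}. vectorspace.dim K (V v))"
    by (simp only: supp)
  moreover have "finite {v\<in>nnrat. vectorspace.dim K (V v) \<noteq> 0}" unfolding supp using finite_B by simp
  ultimately show ?thesis
    unfolding free_of_rank_def free_on_def using vf VV iso dim(1) by (intro exI[of _ V]) auto
qed

section \<open>Existence of free functors in the universe\<close>

lemma basis_dsum_K_functor:
  assumes K: "field K" and B: "finite B" "\<And>b. b \<in> B \<Longrightarrow> 0 \<le> s b"
  shows "basis K (dsum B (\<lambda>b. K_functor K (s b))) B s (\<lambda>b. \<lambda>b'\<in>B. if b' = b then \<one>\<^bsub>K\<^esub> else \<zero>\<^bsub>K\<^esub>)"
proof -
  interpret V: vectorspace K "self_module K" by (rule vectorspace_self_module[OF K])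
  have sum: "(\<Oplus>\<^bsub>self_module K\<^esub>b\<in>{b \<in> B. b = j}. c b \<odot>\<^bsub>self_module K\<^esub> \<one>\<^bsub>K\<^esub>) = c j"
    if j: "j \<in> B" and c: "c \<in> B \<rightarrow> carrier K" for j c
  proof -
    have "{b \<in> B. b = j} = {j}" using j by auto
    moreover have "c j \<in> carrier K" using c j by auto
    ultimately show ?thesis using V.M.finsum_insert[of "{}" j "\<lambda>b. c b \<odot>\<^bsub>self_module K\<^esub> \<one>\<^bsub>K\<^esub>"] V.M.r_zero by simp
  qed
  have "basis K (dsum B (\<lambda>b. gen_functor (s b) (self_module K))) B (\<lambda>b. s b)
    (\<lambda>b. \<lambda>b'\<in>B. if b' = b then \<one>\<^bsub>K\<^esub> else \<zero>\<^bsub>self_module K\<^esub>)"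
  proof (rule basis_dsum_gen[OF K vectorspace_self_module[OF K] B(1)])
    fix j y assume "j \<in> B" "y \<in> carrier (self_module K)"
    thus "\<exists>c\<in>B \<rightarrow> carrier K. y = (\<Oplus>\<^bsub>self_module K\<^esub>b\<in>{b \<in> B. b = j}. c b \<odot>\<^bsub>self_module K\<^esub> \<one>\<^bsub>K\<^esub>)"
      using sum[of j "\<lambda>_. y"] by (intro bexI[of _ "\<lambda>_. y"]) auto
  next
    fix j c b assume "j \<in> B" "c \<in> B \<rightarrow> carrier K" "b \<in> B" "b = j"
      "(\<Oplus>\<^bsub>self_module K\<^esub>b\<in>{b \<in> B. b = j}. c b \<odot>\<^bsub>self_module K\<^esub> \<one>\<^bsub>K\<^esub>) = \<zero>\<^bsub>self_module K\<^esub>"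
    thus "c b = \<zero>\<^bsub>K\<^esub>" using sum[of j c] by simp
  qed (use B in auto)
  thus ?thesis unfolding K_functor_def self_module_simps .
qed

text \<open>
  By induction on \<open>B\<close>, with \<open>'a \<times> 'a\<close> embedded in the infinite type \<open>'a\<close>.
\<close>

lemma exists_inj_PiE:
  fixes K :: "('k, 'm) ring_scheme" and B :: "'b set"
  assumes "adequate_universe K TYPE('a)" and "finite B"
  shows "\<exists>E :: ('b \<Rightarrow> 'k) \<Rightarrow> 'a. inj_on E (B \<rightarrow>\<^sub>E carrier K)"
  using assms(2)
proof (induction B)
  case empty
  show ?case by (intro exI) simp
next
  case (insert b B)
  then obtain E :: "('b \<Rightarrow> 'k) \<Rightarrow> 'a" where E: "inj_on E (B \<rightarrow>\<^sub>E carrier K)" by blast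
  obtain e :: "'k \<Rightarrow> 'a" where e: "inj_on e (carrier K)" and inf: "infinite (UNIV :: 'a set)"
    using assms(1) by (auto simp: adequate_universe_def)
  obtain p :: "'a \<times> 'a \<Rightarrow> 'a" where "bij_betw p (UNIV \<times> UNIV) UNIV"
    using card_of_Times_same_infinite[OF inf] card_of_ordIso by blast
  hence p: "inj p" by (simp add: bij_betw_def)
  have "inj_on (\<lambda>f. p (e (f b), E (restrict f B))) (insert b B \<rightarrow>\<^sub>E carrier K)"
  proof (rule inj_onI)
    fix f g assume fg: "f \<in> insert b B \<rightarrow>\<^sub>E carrier K" "g \<in> insert b B \<rightarrow>\<^sub>E carrier K"
      "p (e (f b), E (restrict f B)) = p (e (g b), E (restrict g B))"
    hence eq: "e (f b) = e (g b)" "E (restrict f B) = E (restrict g B)" using p by (auto dest: injD)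
    have "f b = g b" by (rule inj_onD[OF e, OF eq(1)]) (use fg in auto)
    moreover have "restrict f B = restrict g B" by (rule inj_onD[OF E, OF eq(2)]) (use fg in auto)
    ultimately show "f = g"
      by (intro PiE_ext[OF fg(1,2)]) (metis insert_iff restrict_apply')
  qed
  thus ?case by blast
qed

lemma exists_free_functor:
  fixes K :: "('k, 'm) ring_scheme" and B :: "'b set"
  assumes K: "field K" and u: "adequate_universe K TYPE('a)"
    and B: "finite B" "\<And>b. b \<in> B \<Longrightarrow> 0 \<le> s b"
  shows "\<exists>(P :: (rat, 'k, 'a) vfunctor) e. basis K P B s e"
proof -
  obtain E :: "('b \<Rightarrow> 'k) \<Rightarrow> 'a" where E: "inj_on E (B \<rightarrow>\<^sub>E carrier K)"
    using exists_inj_PiE[OF u B(1)] by blast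
  interpret D: basis K "dsum B (\<lambda>b. K_functor K (s b))" B s "\<lambda>b. \<lambda>b'\<in>B. if b' = b then \<one>\<^bsub>K\<^esub> else \<zero>\<^bsub>K\<^esub>"
    by (rule basis_dsum_K_functor[OF K B])
  interpret K: field K by (rule K)
  have "carrier (obj (dsum B (\<lambda>b. K_functor K (s b))) v) \<subseteq> B \<rightarrow>\<^sub>E carrier K" for v
  proof
    fix f assume "f \<in> carrier (obj (dsum B (\<lambda>b. K_functor K (s b))) v)"
    hence f: "f b \<in> (if s b \<le> v then carrier K else {\<zero>\<^bsub>K\<^esub>})" "f \<in> extensional B" if "b \<in> B" for b
      using that by (auto simp: module_sum_carrier K_functor_def PiE_iff split: if_splits)
    have "f \<in> extensional B"
      using \<open>f \<in> carrier _\<close> by (simp add: module_sum_carrierD(2))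
    moreover have "f b \<in> carrier K" if "b \<in> B" for b using f(1)[OF that] by (simp split: if_splits)
    ultimately show "f \<in> B \<rightarrow>\<^sub>E carrier K" by (simp add: PiE_iff)
  qed
  hence "inj_on E (carrier (obj (dsum B (\<lambda>b. K_functor K (s b))) v))" for v by (rule inj_on_subset[OF E])
  note tr = transport[where E = "\<lambda>_. E", OF D.vf this]
  show ?thesis using basis_transfer[OF D.basis_self tr] by blast
qed

section \<open>Rank\<close>

text \<open>
  An endomorphism over \<open>G\<close> of the free functor on a reduced family changes a basis element only by
  basis elements that are born strictly earlier, so it is unitriangular.
\<close>

lemma (in basis) endomorphism_over_reduced_is_iso:
  assumes G: "is_vfunctor nnrat K G" and \<phi>: "nat_trans nnrat K F G \<phi>"
    and red: "family.reduced K G B s (\<lambda>b. \<phi> (s b) (x b))"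
    and f: "nat_trans nnrat K F F f" and over: "nt_eq nnrat F (\<lambda>v. \<phi> v \<circ> f v) \<phi>"
  shows "nat_iso nnrat K F F f"
proof -
  interpret K: field K by (rule field_K)
  interpret g: family K G B s "\<lambda>b. \<phi> (s b) (x b)" by (rule family_image[OF G \<phi>])
  interpret fx: family K F B s "\<lambda>b. f (s b) (x b)" by (rule family_image[OF vf f])
  have \<phi>f: "\<phi> q (f q y) = \<phi> q y" if "0 \<le> q" "y \<in> carrier (obj F q)" for q y
    using over that by (simp add: nt_eq_def)
  have f_closed: "f q y \<in> carrier (obj F q)" if "0 \<le> q" "y \<in> carrier (obj F q)" for q y
    using nat_trans_closed[OF f] that by simp
  have f_hom: "f q \<in> module_hom K (obj F q) (obj F q)" if "0 \<le> q" for q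
    using nat_trans_hom[OF f] that by simp
  \<comment> \<open>The displacement of the basis element \<open>x b\<close> under \<open>f\<close>, with coordinates \<open>d b\<close>; it lies in the kernel of \<open>\<phi>\<close>.\<close>
  define r where "r b = f (s b) (x b) \<ominus>\<^bsub>obj F (s b)\<^esub> x b" for b
  define d where "d b = coord (s b) (r b)" for b
  have r: "r b \<in> carrier (obj F (s b))" "f (s b) (x b) = x b \<oplus>\<^bsub>obj F (s b)\<^esub> r b" if b: "b \<in> B" for b
  proof -
    interpret vectorspace K "obj F (s b)" by (rule vs[OF s_nonneg[OF b]])
    note c = x_closed[OF b] fx.x_closed[OF b]
    show "r b \<in> carrier (obj F (s b))" using c unfolding r_def by simp
    show "f (s b) (x b) = x b \<oplus>\<^bsub>obj F (s b)\<^esub> r b"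
      using c unfolding r_def by (simp add: M.minus_eq M.a_lcomm[of "x b"] M.r_neg)
  qed
  have d: "d b \<in> B \<rightarrow> carrier K" "comb F B s x (s b) (d b) = r b" if b: "b \<in> B" for b
    using coord_props[OF s_nonneg[OF b] r(1)[OF b]] unfolding d_def by auto
  have d0: "d b k = \<zero>\<^bsub>K\<^esub>" if b: "b \<in> B" and k: "k \<in> B" and le: "s b \<le> s k" for b k
  proof (cases "s b = s k")
    case False
    with le have "s b < s k" by simp
    thus ?thesis unfolding d_def by (rule coord_props(2)[OF s_nonneg[OF b] r(1)[OF b] k])
  next
    case True
    note q = s_nonneg[OF b]
    interpret Fq: vectorspace K "obj F (s b)" by (rule vs[OF q])
    interpret Gq: vectorspace K "obj G (s b)" by (rule g.vs[OF q])
    have hom: "\<phi> (s b) \<in> module_hom K (obj F (s b)) (obj G (s b))" using nat_trans_hom[OF \<phi>] q by simp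
    have "comb G B s (\<lambda>b. \<phi> (s b) (x b)) (s b) (d b) = \<phi> (s b) (r b)"
      using comb_image[OF G \<phi> q d(1)[OF b]] d(2)[OF b] by simp
    also have "\<dots> = \<phi> (s b) (f (s b) (x b)) \<ominus>\<^bsub>obj G (s b)\<^esub> \<phi> (s b) (x b)"
      unfolding r_def by (rule hom_minus[OF Fq.vectorspace_axioms Gq.vectorspace_axioms hom fx.x_closed[OF b] x_closed[OF b]])
    also have "\<dots> = \<zero>\<^bsub>obj G (s b)\<^esub>"
      using \<phi>f[OF q x_closed[OF b]] g.x_closed[OF b] by simp
    finally show ?thesis
      by (rule red[unfolded g.reduced_def, rule_format, OF q d(1)[OF b] _ k True[symmetric]])
  qed
  have W: "subspace K (f q ` carrier (obj F q)) (obj F q)" if "0 \<le> q" for q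
    using subfunctor_image[OF vf vf f] that by (simp add: subfunctor_def)
  have W_mor: "mor F q q' y \<in> f q' ` carrier (obj F q')"
    if "0 \<le> q" "q \<le> q'" "y \<in> f q ` carrier (obj F q)" for q q' y
  proof -
    have "mor F q q' ` (f q ` carrier (obj F q)) \<subseteq> f q' ` carrier (obj F q')"
      using subfunctor_image[OF vf vf f] that(1,2) unfolding subfunctor_def by simp
    with that(3) show ?thesis by blast
  qed
  \<comment> \<open>By induction on the birth time, since \<open>x b\<close> is \<open>f (x b)\<close> minus a combination of earlier elements.\<close>
  have x_im: "x b \<in> f (s b) ` carrier (obj F (s b))" if "b \<in> B" for b
    using that
  proof (induction "card {b' \<in> B. s b' < s b}" arbitrary: b rule: less_induct)
    case (less b)
    note q = s_nonneg[OF less.prems] and b = less.prems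
    interpret vectorspace K "obj F (s b)" by (rule vs[OF q])
    note W' = subspaceD[OF W[OF q]]
    have "r b \<in> f (s b) ` carrier (obj F (s b))"
      unfolding d(2)[OF b, symmetric]
    proof (rule comb_in_subspace[OF q W[OF q] d(1)[OF b]])
      fix k assume k: "k \<in> B" "s k \<le> s b" "d b k \<noteq> \<zero>\<^bsub>K\<^esub>"
      hence lt: "s k < s b" using d0[OF b k(1)] by fastforce
      have "{b' \<in> B. s b' < s k} \<subset> {b' \<in> B. s b' < s b}" using lt k(1) by auto
      hence "card {b' \<in> B. s b' < s k} < card {b' \<in> B. s b' < s b}"
        using finite_B by (intro psubset_card_mono) auto
      from less.hyps[OF this k(1)] show "mor F (s k) (s b) (x k) \<in> f (s b) ` carrier (obj F (s b))"
        by (rule W_mor[OF s_nonneg[OF k(1)] k(2)])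
    qed
    hence "(\<ominus>\<^bsub>K\<^esub> \<one>\<^bsub>K\<^esub>) \<odot>\<^bsub>obj F (s b)\<^esub> r b \<in> f (s b) ` carrier (obj F (s b))"
      by (intro W'(5)) auto
    hence neg: "\<ominus>\<^bsub>obj F (s b)\<^esub> r b \<in> f (s b) ` carrier (obj F (s b))"
      using smult_minus_1[OF r(1)[OF b]] by simp
    have "f (s b) (x b) \<in> f (s b) ` carrier (obj F (s b))" using x_closed[OF b] by simp
    from W'(4)[OF this neg] show ?case
      using r[OF b] x_closed[OF b] by (simp add: M.a_assoc M.r_neg)
  qed
  show ?thesis
  proof (rule nat_isoI_bij[OF vf f])
    fix q :: rat assume "q \<in> nnrat" hence q: "0 \<le> q" by simp
    interpret Fq: vectorspace K "obj F q" by (rule vs[OF q])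
    have "f q ` carrier (obj F q) = carrier (obj F q)"
    proof
      show "carrier (obj F q) \<subseteq> f q ` carrier (obj F q)"
      proof
        fix y assume y: "y \<in> carrier (obj F q)"
        have "comb F B s x q (coord q y) \<in> f q ` carrier (obj F q)"
          by (rule comb_in_subspace[OF q W[OF q] coord_props(1)[OF q y]]) (rule W_mor[OF s_nonneg _ x_im])
        thus "y \<in> f q ` carrier (obj F q)" using coord_props(3)[OF q y] by simp
      qed
    qed (use f_closed[OF q] in auto)
    moreover have "inj_on (f q) (carrier (obj F q))"
    proof (rule hom_inj_on[OF vs[OF q] vs[OF q] f_hom[OF q]])
      fix y assume y: "y \<in> carrier (obj F q)" "f q y = \<zero>\<^bsub>obj F q\<^esub>"
      define c where "c = coord q y"
      note c = coord_props[OF q y(1), folded c_def]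
      show "y = \<zero>\<^bsub>obj F q\<^esub>"
      proof (rule ccontr)
        assume ne: "y \<noteq> \<zero>\<^bsub>obj F q\<^esub>"
        let ?T = "{b \<in> B. c b \<noteq> \<zero>\<^bsub>K\<^esub>}"
        have "?T \<noteq> {}"
        proof
          assume "?T = {}"
          hence "comb F B s x q c = comb F B s x q (\<lambda>b. \<zero>\<^bsub>K\<^esub>)" by (intro comb_cong[OF q]) auto
          thus False using comb_zero[OF q] c(3) ne by simp
        qed
        moreover have finT: "finite ?T" using finite_B by simp
        ultimately have "Max (s ` ?T) \<in> s ` ?T" by (intro Max_in) auto
        \<comment> \<open>At an element of latest birth in the support the coordinate is not changed by \<open>f\<close>.\<close>
        then obtain k where k: "k \<in> B" "c k \<noteq> \<zero>\<^bsub>K\<^esub>" "s k = Max (s ` ?T)" by auto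
        have max: "s b \<le> s k" if "b \<in> B" "c b \<noteq> \<zero>\<^bsub>K\<^esub>" for b
          unfolding k(3) using finT that by (intro Max_ge) auto
        have kq: "s k \<le> q" using c(2)[OF k(1)] k(2) by force
        interpret SK: vectorspace K "self_module K" by (rule vectorspace_self_module[OF field_K])
        have coord_f: "coord q (mor F (s b) q (f (s b) (x b))) k = (if k = b then \<one>\<^bsub>K\<^esub> else \<zero>\<^bsub>K\<^esub>) \<oplus>\<^bsub>K\<^esub> d b k"
          if b: "b \<in> B" "s b \<le> q" for b
        proof -
          note sb = s_nonneg[OF b(1)]
          have xb: "x b = comb F B s x (s b) (\<lambda>b'. if b' = b then \<one>\<^bsub>K\<^esub> else \<zero>\<^bsub>K\<^esub>)"
            using comb_unit[OF b(1) order_refl] is_vfunctor_mor_id[OF vf _ x_closed[OF b(1)]] sb by simp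
          have "coord (s b) (x b) k = (if k = b then \<one>\<^bsub>K\<^esub> else \<zero>\<^bsub>K\<^esub>)"
            by (subst xb, subst coord_comb[OF sb _ k(1)]) auto
          thus ?thesis
            using coord_mor[OF sb b(2) fx.x_closed[OF b(1)] k(1)] r[OF b(1)]
              coord_add[OF sb x_closed[OF b(1)] r(1)[OF b(1)] k(1)] by (simp add: d_def)
        qed
        have closed: "c b \<odot>\<^bsub>obj F q\<^esub> mor F (s b) q (f (s b) (x b)) \<in> carrier (obj F q)" if "b \<in> B" "s b \<le> q" for b
          using c(1) fx.mor_x_closed[OF that] that by auto
        have "coord q (f q y) k = coord q (comb F B s (\<lambda>b. f (s b) (x b)) q c) k"
          using comb_image[OF vf f q c(1)] c(3) by simp
        also have "\<dots> = (\<Oplus>\<^bsub>self_module K\<^esub>b\<in>{b \<in> B. s b \<le> q}. coord q (c b \<odot>\<^bsub>obj F q\<^esub> mor F (s b) q (f (s b) (x b))) k)"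
          unfolding comb_def
          by (rule hom_finsum[OF vs[OF q] SK.vectorspace_axioms coord_hom[OF q k(1)]]) (use closed in auto)
        also have "\<dots> = (\<Oplus>\<^bsub>self_module K\<^esub>b\<in>{b \<in> B. s b \<le> q}. if k = b then c b else \<zero>\<^bsub>self_module K\<^esub>)"
        proof (rule SK.M.finsum_cong')
          fix b assume "b \<in> {b \<in> B. s b \<le> q}" hence b: "b \<in> B" "s b \<le> q" by auto
          have cb: "c b \<in> carrier K" using c(1) b(1) by auto
          have "coord q (c b \<odot>\<^bsub>obj F q\<^esub> mor F (s b) q (f (s b) (x b))) k
              = c b \<otimes>\<^bsub>K\<^esub> ((if k = b then \<one>\<^bsub>K\<^esub> else \<zero>\<^bsub>K\<^esub>) \<oplus>\<^bsub>K\<^esub> d b k)"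
            using coord_smult[OF q cb fx.mor_x_closed[OF b] k(1)] coord_f[OF b] by simp
          also have "\<dots> = (if k = b then c b else \<zero>\<^bsub>K\<^esub>)"
          proof (cases "c b = \<zero>\<^bsub>K\<^esub>")
            case True
            thus ?thesis using d(1)[OF b(1)] k(1) by (auto simp: Pi_iff)
          next
            case False
            hence "d b k = \<zero>\<^bsub>K\<^esub>" using d0[OF b(1) k(1) max[OF b(1)]] by simp
            thus ?thesis using cb by simp
          qed
          finally show "coord q (c b \<odot>\<^bsub>obj F q\<^esub> mor F (s b) q (f (s b) (x b))) k = (if k = b then c b else \<zero>\<^bsub>self_module K\<^esub>)"
            by simp
        qed (use c(1) in auto)
        also have "\<dots> = c k"
          by (rule SK.M.add.finprod_singleton) (use finite_B k(1) kq c(1) in auto)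
        finally have "coord q (f q y) k = c k" .
        moreover have "coord q \<zero>\<^bsub>obj F q\<^esub> k = \<zero>\<^bsub>K\<^esub>"
          using hom_zero[OF vs[OF q] SK.vectorspace_axioms coord_hom[OF q k(1)]] by simp
        ultimately show False using y(2) k(2) by simp
      qed
    qed
    ultimately show "bij_betw (f q) (carrier (obj F q)) (carrier (obj F q))" by (simp add: bij_betw_def)
  qed
qed

text \<open>
  The free functor on the family is a minimal cover, because a reduced family leaves its endomorphisms
  over \<open>G\<close> no other choice than to be unitriangular.
\<close>

theorem has_rank_of_reduced_generating:
  fixes G :: "(rat, 'k, 'a) vfunctor"
  assumes u: "adequate_universe K TYPE('a)" and g: "family K G B s g"
    and gen: "family.generating K G B s g" and red: "family.reduced K G B s g"
  shows "has_rank K G (card B)"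
proof -
  interpret g: family K G B s g by (rule g)
  obtain P :: "(rat, 'k, 'a) vfunctor" and e where "basis K P B s e"
    using exists_free_functor[where B = B and s = s, OF g.field_K u g.finite_B g.s_nonneg] by blast
  then interpret P: basis K P B s e .
  let ?\<phi> = "\<lambda>q y. comb G B s g q (P.coord q y)"
  have nt: "nat_trans nnrat K P G ?\<phi>" by (rule P.nat_trans_lift[OF g])
  interpret g': family K G B s "\<lambda>b. ?\<phi> (s b) (e b)" by (rule P.family_image[OF g.vf nt])
  have comb_eq: "comb G B s (\<lambda>b. ?\<phi> (s b) (e b)) q c = comb G B s g q c"
    if "0 \<le> q" "c \<in> B \<rightarrow> carrier K" for q c
    using P.comb_image[OF g.vf nt that] P.lift_comb[OF g that] by simp
  have red': "g'.reduced"
    using red unfolding g'.reduced_def g.reduced_def by (simp add: comb_eq)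
  have "minimal_cover K P G ?\<phi>" unfolding minimal_cover_def
  proof (intro conjI allI impI)
    show "free_functor K P"
      using P.free_of_rank_card unfolding free_of_rank_def free_functor_def by blast
    show "epimorphism nnrat K P G ?\<phi>"
      unfolding epimorphism_def using nt P.lift_surj[OF g gen] by simp
    fix f assume "nat_trans nnrat K P P f \<and> nt_eq nnrat P (\<lambda>v. ?\<phi> v \<circ> f v) ?\<phi>"
    thus "nat_iso nnrat K P P f"
      using P.endomorphism_over_reduced_is_iso[OF g.vf nt red'] by blast
  qed
  with P.free_of_rank_card show ?thesis unfolding has_rank_def by blast
qed

text \<open>
  If the images of a basis under a minimal cover satisfied a relation with an invertible coefficient
  at an element born at the time of the relation, that basis element could be eliminated: subtracting
  its coordinate times the relation is an endomorphism over \<open>G\<close> with the relation in its kernel.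
\<close>

lemma (in basis) minimal_cover_reduced:
  assumes G: "is_vfunctor nnrat K G" and mc: "minimal_cover K F G \<phi>"
  shows "family K G B s (\<lambda>b. \<phi> (s b) (x b))"
    "family.generating K G B s (\<lambda>b. \<phi> (s b) (x b))"
    "family.reduced K G B s (\<lambda>b. \<phi> (s b) (x b))"
proof -
  have \<phi>: "nat_trans nnrat K F G \<phi>" and surj: "\<And>v. 0 \<le> v \<Longrightarrow> \<phi> v ` carrier (obj F v) = carrier (obj G v)"
    and min: "\<And>f. nat_trans nnrat K F F f \<Longrightarrow> nt_eq nnrat F (\<lambda>v. \<phi> v \<circ> f v) \<phi> \<Longrightarrow> nat_iso nnrat K F F f"
    using mc by (auto simp: minimal_cover_def epimorphism_def)
  interpret g: family K G B s "\<lambda>b. \<phi> (s b) (x b)" by (rule family_image[OF G \<phi>])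
  show "family K G B s (\<lambda>b. \<phi> (s b) (x b))" ..
  show g.generating unfolding g.generating_def
  proof (intro allI impI ballI)
    fix q :: rat and y assume q: "0 \<le> q" and "y \<in> carrier (obj G q)"
    then obtain p where p: "p \<in> carrier (obj F q)" "y = \<phi> q p" using surj by blast
    note c = coord_props[OF q p(1)]
    have "y = comb G B s (\<lambda>b. \<phi> (s b) (x b)) q (coord q p)"
      using comb_image[OF G \<phi> q c(1)] c(3) p(2) by simp
    thus "\<exists>c\<in>B \<rightarrow> carrier K. y = comb G B s (\<lambda>b. \<phi> (s b) (x b)) q c" using c(1) by blast
  qed
  show g.reduced unfolding g.reduced_def
  proof (intro allI impI ballI, rule ccontr)
    fix q :: rat and c k assume q: "0 \<le> q" and c: "c \<in> B \<rightarrow> carrier K"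
      and zero: "comb G B s (\<lambda>b. \<phi> (s b) (x b)) q c = \<zero>\<^bsub>obj G q\<^esub>"
      and k: "k \<in> B" "s k = q" and ck: "c k \<noteq> \<zero>\<^bsub>K\<^esub>"
    interpret Fq: vectorspace K "obj F q" by (rule vs[OF q])
    interpret Gq: vectorspace K "obj G q" by (rule g.vs[OF q])
    have a: "inv\<^bsub>K\<^esub> c k \<in> carrier K" "inv\<^bsub>K\<^esub> c k \<otimes>\<^bsub>K\<^esub> c k = \<one>\<^bsub>K\<^esub>"
      using c k ck by (auto simp: Fq.field_Units Pi_iff)
    \<comment> \<open>The relation, normalised to have coordinate one at \<open>k\<close>, so that the endomorphism \<open>f\<close> maps it to zero.\<close>
    define r where "r = inv\<^bsub>K\<^esub> c k \<odot>\<^bsub>obj F q\<^esub> comb F B s x q c"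
    note cc = comb_closed[OF q c]
    have r: "r \<in> carrier (obj F q)" unfolding r_def using a(1) cc by simp
    have rk: "coord q r k = \<one>\<^bsub>K\<^esub>"
      unfolding r_def using coord_smult[OF q a(1) cc k(1)] coord_comb[OF q c k(1)] k(2) a(2) by simp
    have \<phi>r: "\<phi> q r = \<zero>\<^bsub>obj G q\<^esub>"
      unfolding r_def using module_hom_smult[OF nat_trans_hom[OF \<phi>] a(1) cc] comb_image[OF G \<phi> q c] zero q a(1)
      by simp
    define f where "f p y = (if q \<le> p then y \<ominus>\<^bsub>obj F p\<^esub> coord p y k \<odot>\<^bsub>obj F p\<^esub> mor F q p r else y)" for p y
    have mr: "mor F q p r \<in> carrier (obj F p)" if "q \<le> p" for p
      using is_vfunctor_mor_closed[OF vf _ _ that r] q that by simp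
    have ck: "coord p y k \<in> carrier K" if "0 \<le> p" "y \<in> carrier (obj F p)" for p y
      using coord_props(1)[OF that] k(1) by auto
    have "nat_trans nnrat K F F f" unfolding nat_trans_def
    proof (intro conjI ballI impI)
      fix p :: rat assume "p \<in> nnrat" hence p: "0 \<le> p" by simp
      interpret Fp: vectorspace K "obj F p" by (rule vs[OF p])
      show "f p \<in> module_hom K (obj F p) (obj F p)"
      proof (cases "q \<le> p")
        case True
        note m = mr[OF True]
        show ?thesis
        proof (rule module_homI)
          fix y assume "y \<in> carrier (obj F p)"
          thus "f p y \<in> carrier (obj F p)" using True m ck[OF p] by (simp add: f_def)
        next
          fix y z assume yz: "y \<in> carrier (obj F p)" "z \<in> carrier (obj F p)"
          note cy = ck[OF p yz(1)] and cz = ck[OF p yz(2)]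
          show "f p (y \<oplus>\<^bsub>obj F p\<^esub> z) = f p y \<oplus>\<^bsub>obj F p\<^esub> f p z"
            using True m cy cz yz coord_add[OF p yz k(1)]
            by (simp add: f_def Fp.M.minus_eq Fp.smult_l_distr Fp.M.minus_add Fp.M.a_ac)
        next
          fix a y assume ay: "a \<in> carrier K" "y \<in> carrier (obj F p)"
          note cy = ck[OF p ay(2)]
          show "f p (a \<odot>\<^bsub>obj F p\<^esub> y) = a \<odot>\<^bsub>obj F p\<^esub> f p y"
            using True m cy ay coord_smult[OF p ay k(1)]
            by (simp add: f_def Fp.M.minus_eq Fp.smult_r_distr Fp.smult_r_minus Fp.smult_assoc1)
        qed
      qed (simp add: f_def module_hom_def)
    next
      fix p p' :: rat and y assume "p \<in> nnrat" "p' \<in> nnrat" and pp': "p \<le> p'" and y: "y \<in> carrier (obj F p)"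
      hence p: "0 \<le> p" "0 \<le> p'" "p \<in> nnrat" "p' \<in> nnrat" by auto
      interpret Fp: vectorspace K "obj F p" by (rule vs[OF p(1)])
      interpret Fp': vectorspace K "obj F p'" by (rule vs[OF p(2)])
      have hom: "mor F p p' \<in> module_hom K (obj F p) (obj F p')" by (rule is_vfunctor_mor[OF vf p(3,4) pp'])
      have my: "mor F p p' y \<in> carrier (obj F p')" by (rule is_vfunctor_mor_closed[OF vf p(3,4) pp' y])
      have cm: "coord p' (mor F p p' y) k = coord p y k" by (rule coord_mor[OF p(1) pp' y k(1)])
      show "f p' (mor F p p' y) = mor F p p' (f p y)"
      proof (cases "q \<le> p")
        case True
        hence qp': "q \<le> p'" using pp' by simp
        have comp: "mor F p p' (mor F q p r) = mor F q p' r"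
          using is_vfunctor_mor_comp[OF vf _ p(3,4) True pp' r] q by simp
        have sm: "coord p y k \<odot>\<^bsub>obj F p\<^esub> mor F q p r \<in> carrier (obj F p)"
          using ck[OF p(1) y] mr[OF True] by simp
        have "mor F p p' (f p y) = mor F p p' y \<ominus>\<^bsub>obj F p'\<^esub> mor F p p' (coord p y k \<odot>\<^bsub>obj F p\<^esub> mor F q p r)"
          using hom_minus[OF vs[OF p(1)] vs[OF p(2)] hom y sm] True by (simp add: f_def)
        also have "mor F p p' (coord p y k \<odot>\<^bsub>obj F p\<^esub> mor F q p r) = coord p y k \<odot>\<^bsub>obj F p'\<^esub> mor F q p' r"
          using module_hom_smult[OF hom ck[OF p(1) y] mr[OF True]] comp by simp
        finally show ?thesis using qp' cm by (simp add: f_def)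
      next
        case False
        \<comment> \<open>Before time \<open>q\<close> the coordinate vanishes, which makes the two branches of \<open>f\<close> compatible.\<close>
        hence "coord p y k = \<zero>\<^bsub>K\<^esub>" using coord_props(2)[OF p(1) y k(1)] k(2) by simp
        thus ?thesis using False cm my mr[of p'] by (simp add: f_def Fp'.M.minus_zero_right)
      qed
    qed
    moreover have "nt_eq nnrat F (\<lambda>v. \<phi> v \<circ> f v) \<phi>" unfolding nt_eq_def
    proof (intro ballI)
      fix p :: rat and y assume "p \<in> nnrat" and y: "y \<in> carrier (obj F p)"
      hence p: "0 \<le> p" "p \<in> nnrat" by auto
      interpret Gp: vectorspace K "obj G p" by (rule g.vs[OF p(1)])
      interpret Fp: vectorspace K "obj F p" by (rule vs[OF p(1)])
      have hom: "\<phi> p \<in> module_hom K (obj F p) (obj G p)" by (rule nat_trans_hom[OF \<phi> p(2)])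
      show "(\<phi> p \<circ> f p) y = \<phi> p y"
      proof (cases "q \<le> p")
        case True
        have sm: "coord p y k \<odot>\<^bsub>obj F p\<^esub> mor F q p r \<in> carrier (obj F p)"
          using ck[OF p(1) y] mr[OF True] by simp
        have "\<phi> p (mor F q p r) = \<zero>\<^bsub>obj G p\<^esub>"
          using nat_trans_natural[OF \<phi> _ p(2) True r] \<phi>r q
            hom_zero[OF g.vs[OF q] g.vs[OF p(1)] is_vfunctor_mor[OF G _ p(2) True]] by simp
        hence "\<phi> p (coord p y k \<odot>\<^bsub>obj F p\<^esub> mor F q p r) = \<zero>\<^bsub>obj G p\<^esub>"
          using module_hom_smult[OF hom ck[OF p(1) y] mr[OF True]] ck[OF p(1) y] by simp
        thus ?thesis using True hom_minus[OF vs[OF p(1)] g.vs[OF p(1)] hom y sm]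
            nat_trans_closed[OF \<phi> p(2) y] by (simp add: f_def Gp.M.minus_zero_right)
      qed (simp add: f_def)
    qed
    ultimately have "nat_iso nnrat K F F f" by (rule min)
    hence inj: "inj_on (f q) (carrier (obj F q))" and hom: "f q \<in> module_hom K (obj F q) (obj F q)"
      using nat_iso_bij[of nnrat K F F f q] nat_trans_hom[OF nat_iso_nat_trans, of nnrat K F F f q] q
      by (auto simp: bij_betw_def)
    have "f q r = \<zero>\<^bsub>obj F q\<^esub>"
      using rk r is_vfunctor_mor_id[OF vf _ r] q by (simp add: f_def)
    also have "\<dots> = f q \<zero>\<^bsub>obj F q\<^esub>" by (rule hom_zero[OF vs[OF q] vs[OF q] hom, symmetric])
    finally have "r = \<zero>\<^bsub>obj F q\<^esub>" using inj r by (simp add: inj_on_def)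
    moreover have "coord q \<zero>\<^bsub>obj F q\<^esub> k = \<zero>\<^bsub>K\<^esub>"
      using hom_zero[OF vs[OF q] vectorspace_self_module[OF field_K] coord_hom[OF q k(1)]] by simp
    ultimately show False using rk by simp
  qed
qed

lemma has_rank_imp_reduced_generating:
  fixes G :: "(rat, 'k, 'a) vfunctor"
  assumes G: "is_vfunctor nnrat K G" and "has_rank K G n"
  shows "\<exists>(B :: (rat \<times> 'a) set) s g. family K G B s g \<and> family.generating K G B s g \<and>
    family.reduced K G B s g \<and> card B = n"
proof -
  obtain P \<phi> where mc: "minimal_cover K P G \<phi>" and "free_of_rank K P n"
    using assms(2) by (auto simp: has_rank_def)
  then obtain B :: "(rat \<times> 'a) set" and s e where b: "basis K P B s e" "card B = n"
    using free_of_rank_imp_basis by blast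
  from basis.minimal_cover_reduced[OF b(1) G mc] b(2) show ?thesis by blast
qed

text \<open>
  Two minimal covers give two families that are both reduced and generating, so each is at most as
  large as the other.
\<close>

lemma functor_rank_eq:
  fixes G :: "(rat, 'k, 'a) vfunctor"
  assumes G: "is_vfunctor nnrat K G" and n: "has_rank K G n"
  shows "functor_rank K G = n"
  unfolding functor_rank_def
proof (rule the_equality)
  show "has_rank K G n" by (rule n)
  fix m assume m: "has_rank K G m"
  obtain B :: "(rat \<times> 'a) set" and s g where B: "family K G B s g" "family.generating K G B s g"
    "family.reduced K G B s g" "card B = n"
    using has_rank_imp_reduced_generating[OF G n] by blast
  obtain C :: "(rat \<times> 'a) set" and p h where C: "family K G C p h" "family.generating K G C p h"
    "family.reduced K G C p h" "card C = m"
    using has_rank_imp_reduced_generating[OF G m] by blast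
  show "m = n"
    using reduced_card_le_generating[OF B(1,3) C(1,2)] reduced_card_le_generating[OF C(1,3) B(1,2)]
      B(4) C(4) by simp
qed

section \<open>Decompositions into cyclic summands\<close>

text \<open>
  The cokernel of an epimorphism is zero, but a zero functor with carriers in \<open>'a set\<close>; its counterpart in
  the universe is the zero subfunctor of \<open>G\<close>.
\<close>

lemma coker_surj_noise:
  fixes F G :: "(rat, 'k, 'a) vfunctor" and S :: "rat \<Rightarrow> (rat, 'k, 'a) vfunctor set"
  assumes S: "noise_system K S" and F: "is_vfunctor nnrat K F" and G: "is_vfunctor nnrat K G"
    and \<psi>: "nat_trans nnrat K F G \<psi>"
    and surj: "\<And>v. 0 \<le> v \<Longrightarrow> carrier (obj G v) \<subseteq> \<psi> v ` carrier (obj F v)"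
  shows "in_upto_iso nnrat K (coker_functor F G \<psi>) (S 0)"
proof -
  define Z where "Z = restrict_functor G (\<lambda>v. {\<zero>\<^bsub>obj G v\<^esub>})"
  have "subfunctor nnrat K G (\<lambda>v. {\<zero>\<^bsub>obj G v\<^esub>})" unfolding subfunctor_def
  proof (intro conjI ballI impI)
    fix v :: rat assume v: "v \<in> nnrat"
    interpret vectorspace K "obj G v" by (rule is_vfunctor_vectorspace[OF G v])
    show "subspace K {\<zero>\<^bsub>obj G v\<^esub>} (obj G v)" by (rule subspaceI[OF vectorspace_axioms]) auto
  next
    fix v u :: rat assume "v \<in> nnrat" "u \<in> nnrat" "v \<le> u"
    thus "mor G v u ` {\<zero>\<^bsub>obj G v\<^esub>} \<subseteq> {\<zero>\<^bsub>obj G u\<^esub>}"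
      using hom_zero[OF is_vfunctor_vectorspace[OF G] is_vfunctor_vectorspace[OF G] is_vfunctor_mor[OF G]] by simp
  qed
  hence vZ: "is_vfunctor nnrat K Z" unfolding Z_def by (rule is_vfunctor_restrict[OF G])
  hence ZS: "Z \<in> S 0" by (rule noise_zero[OF S order_refl]) (simp add: zero_functor_def Z_def)
  let ?C = "coker_functor F G \<psi>"
  note vC = is_vfunctor_coker[OF F G \<psi>]
  have C0: "carrier (obj ?C v) = {\<zero>\<^bsub>obj ?C v\<^esub>}" if v: "0 \<le> v" for v
  proof -
    interpret vectorspace K "obj ?C v" using is_vfunctor_vectorspace[OF vC] v by simp
    have "x = \<zero>\<^bsub>obj ?C v\<^esub>" if "x \<in> carrier (obj ?C v)" for x
    proof -
      from that obtain y where "y \<in> carrier (obj G v)" "x = coset_map F G \<psi> v y"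
        unfolding coset_map_surj[OF F G \<psi>, symmetric] by blast
      thus ?thesis using coset_map_eq_zero_iff[OF F G \<psi>, of v y] surj[OF v] v by auto
    qed
    thus ?thesis by auto
  qed
  have "nat_iso nnrat K ?C Z (\<lambda>v x. \<zero>\<^bsub>obj Z v\<^esub>)"
  proof (rule nat_isoI_bij[OF vC])
    show "nat_trans nnrat K ?C Z (\<lambda>v x. \<zero>\<^bsub>obj Z v\<^esub>)" unfolding nat_trans_def
    proof (intro conjI ballI impI)
      fix v :: rat assume v: "v \<in> nnrat"
      interpret vectorspace K "obj Z v" by (rule is_vfunctor_vectorspace[OF vZ v])
      show "(\<lambda>x. \<zero>\<^bsub>obj Z v\<^esub>) \<in> module_hom K (obj ?C v) (obj Z v)" by (rule module_homI) auto
    next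
      fix v u :: rat assume "v \<in> nnrat" "u \<in> nnrat" "v \<le> u"
      thus "\<zero>\<^bsub>obj Z u\<^esub> = mor Z v u \<zero>\<^bsub>obj Z v\<^esub>"
        using hom_zero[OF is_vfunctor_vectorspace[OF vZ] is_vfunctor_vectorspace[OF vZ] is_vfunctor_mor[OF vZ]] by simp
    qed
    fix v :: rat assume "v \<in> nnrat"
    thus "bij_betw (\<lambda>x. \<zero>\<^bsub>obj Z v\<^esub>) (carrier (obj ?C v)) (carrier (obj Z v))"
      using C0[of v] by (simp add: bij_betw_def Z_def)
  qed
  thus ?thesis using ZS unfolding in_upto_iso_def isomorphic_def by blast
qed

lemma cyclic_simps [simp]:
  "carrier (obj (cyclic K F s x) q) = cyc_set K F s x q"
  "add (obj (cyclic K F s x) q) = add (obj F q)" "zero (obj (cyclic K F s x) q) = zero (obj F q)"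
  "smult (obj (cyclic K F s x) q) = smult (obj F q)" "mor (cyclic K F s x) = mor F"
  by (simp_all add: cyclic_def)

text \<open>
  An internal finite direct sum of cyclic functors, described by its projections as endomorphisms of
  \<open>F\<close>. That the projections add up to the identity is replaced by the equivalent condition that they
  have no common kernel, which is easier to verify and is used to compare elements componentwise.
\<close>

locale cyclic_sum = family K F B s x
  for K :: "('k, 'm) ring_scheme" and F :: "(rat, 'k, 'a) vfunctor"
    and B :: "'b set" and s :: "'b \<Rightarrow> rat" and x :: "'b \<Rightarrow> 'a" +
  fixes \<pi> :: "'b \<Rightarrow> rat \<Rightarrow> 'a \<Rightarrow> 'a"
  assumes tame_F: "tame K F"
    and \<pi>_nat: "\<And>b. b \<in> B \<Longrightarrow> nat_trans nnrat K F F (\<pi> b)"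
    and \<pi>_\<pi>: "\<And>b b' q y. b \<in> B \<Longrightarrow> b' \<in> B \<Longrightarrow> 0 \<le> q \<Longrightarrow> y \<in> carrier (obj F q) \<Longrightarrow>
      \<pi> b q (\<pi> b' q y) = (if b = b' then \<pi> b q y else \<zero>\<^bsub>obj F q\<^esub>)"
    and \<pi>_joint: "\<And>q y. 0 \<le> q \<Longrightarrow> y \<in> carrier (obj F q) \<Longrightarrow> (\<And>b. b \<in> B \<Longrightarrow> \<pi> b q y = \<zero>\<^bsub>obj F q\<^esub>) \<Longrightarrow>
      y = \<zero>\<^bsub>obj F q\<^esub>"
    and \<pi>_image: "\<And>b q. b \<in> B \<Longrightarrow> 0 \<le> q \<Longrightarrow> \<pi> b q ` carrier (obj F q) = cyc_set K F (s b) (x b) q"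
begin

abbreviation summand :: "'b \<Rightarrow> (rat, 'k, 'a) vfunctor" where
  "summand b \<equiv> cyclic K F (s b) (x b)"

definition part :: "'b set \<Rightarrow> rat \<Rightarrow> 'a \<Rightarrow> 'a" where
  "part A q y = (\<Oplus>\<^bsub>obj F q\<^esub>b\<in>A. \<pi> b q y)"

text \<open>
  The sum of the summands in \<open>A\<close>, as the subfunctor on which the components outside \<open>A\<close> vanish. Being a
  kernel it is tame.
\<close>

definition subsum :: "'b set \<Rightarrow> (rat, 'k, 'a) vfunctor" where
  "subsum A = ker_functor F F (part (B - A))"

lemma \<pi>_closed: "b \<in> B \<Longrightarrow> 0 \<le> q \<Longrightarrow> y \<in> carrier (obj F q) \<Longrightarrow> \<pi> b q y \<in> carrier (obj F q)"
  using nat_trans_closed[OF \<pi>_nat] by simp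

lemma \<pi>_hom: "b \<in> B \<Longrightarrow> 0 \<le> q \<Longrightarrow> \<pi> b q \<in> module_hom K (obj F q) (obj F q)"
  using nat_trans_hom[OF \<pi>_nat] by simp

lemma \<pi>_x:
  assumes b: "b \<in> B" "b' \<in> B"
  shows "\<pi> b (s b') (x b') = (if b = b' then x b else \<zero>\<^bsub>obj F (s b')\<^esub>)"
proof -
  note q = s_nonneg[OF b(2)]
  have "x b' \<in> cyc_set K F (s b') (x b') (s b')"
    using mor_in_cyc_set[OF vf q x_closed[OF b(2)] order_refl] is_vfunctor_mor_id[OF vf _ x_closed[OF b(2)]] q by simp
  then obtain z where "z \<in> carrier (obj F (s b'))" "x b' = \<pi> b' (s b') z"
    using \<pi>_image[OF b(2) q] by blast
  thus ?thesis using \<pi>_\<pi>[OF b q] by auto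
qed

lemma part_closed: "A \<subseteq> B \<Longrightarrow> 0 \<le> q \<Longrightarrow> y \<in> carrier (obj F q) \<Longrightarrow> part A q y \<in> carrier (obj F q)"
proof -
  assume A: "A \<subseteq> B" "0 \<le> q" "y \<in> carrier (obj F q)"
  interpret vectorspace K "obj F q" by (rule vs[OF A(2)])
  show ?thesis unfolding part_def by (rule M.finsum_closed) (use A \<pi>_closed in auto)
qed

lemma nat_trans_part:
  assumes A: "A \<subseteq> B" shows "nat_trans nnrat K F F (part A)"
  unfolding nat_trans_def
proof (intro conjI ballI impI)
  fix q :: rat assume "q \<in> nnrat" hence q: "0 \<le> q" by simp
  interpret vectorspace K "obj F q" by (rule vs[OF q])
  have cl: "\<pi> b q y \<in> carrier (obj F q)" if "b \<in> A" "y \<in> carrier (obj F q)" for b y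
    using \<pi>_closed[OF _ q that(2)] that(1) A by blast
  have fA: "finite A" using A finite_B by (rule finite_subset)
  have hom: "\<pi> b q \<in> module_hom K (obj F q) (obj F q)" if "b \<in> A" for b using \<pi>_hom[OF _ q] that A by blast
  show "part A q \<in> module_hom K (obj F q) (obj F q)"
  proof (rule module_homI)
    fix y assume "y \<in> carrier (obj F q)" thus "part A q y \<in> carrier (obj F q)" by (rule part_closed[OF A q])
  next
    fix y z assume yz: "y \<in> carrier (obj F q)" "z \<in> carrier (obj F q)"
    have "part A q (y \<oplus>\<^bsub>obj F q\<^esub> z) = (\<Oplus>\<^bsub>obj F q\<^esub>b\<in>A. \<pi> b q y \<oplus>\<^bsub>obj F q\<^esub> \<pi> b q z)"
      unfolding part_def by (rule M.finsum_cong') (use cl yz module_hom_add[OF hom] in auto)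
    also have "\<dots> = part A q y \<oplus>\<^bsub>obj F q\<^esub> part A q z"
      unfolding part_def by (rule M.finsum_addf) (use cl yz in auto)
    finally show "part A q (y \<oplus>\<^bsub>obj F q\<^esub> z) = part A q y \<oplus>\<^bsub>obj F q\<^esub> part A q z" .
  next
    fix c y assume cy: "c \<in> carrier K" "y \<in> carrier (obj F q)"
    have "part A q (c \<odot>\<^bsub>obj F q\<^esub> y) = (\<Oplus>\<^bsub>obj F q\<^esub>b\<in>A. c \<odot>\<^bsub>obj F q\<^esub> \<pi> b q y)"
      unfolding part_def by (rule M.finsum_cong') (use cl cy module_hom_smult[OF hom] in auto)
    also have "\<dots> = c \<odot>\<^bsub>obj F q\<^esub> part A q y"
      unfolding part_def by (rule finsum_smult_ldistr[OF fA cy(1), symmetric]) (use cl cy in auto)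
    finally show "part A q (c \<odot>\<^bsub>obj F q\<^esub> y) = c \<odot>\<^bsub>obj F q\<^esub> part A q y" .
  qed
next
  fix q q' :: rat and y assume qq: "q \<in> nnrat" "q' \<in> nnrat" "q \<le> q'" and y: "y \<in> carrier (obj F q)"
  hence q: "0 \<le> q" "0 \<le> q'" by auto
  interpret Fq': vectorspace K "obj F q'" by (rule vs[OF q(2)])
  have cl: "\<pi> b q y \<in> carrier (obj F q)" if "b \<in> A" for b using \<pi>_closed[OF _ q(1) y] that A by blast
  have "mor F q q' (part A q y) = (\<Oplus>\<^bsub>obj F q'\<^esub>b\<in>A. mor F q q' (\<pi> b q y))"
    unfolding part_def by (rule hom_finsum[OF vs[OF q(1)] vs[OF q(2)] is_vfunctor_mor[OF vf qq]]) (use cl in auto)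
  also have "\<dots> = part A q' (mor F q q' y)" unfolding part_def
  proof (rule Fq'.M.finsum_cong')
    fix b assume "b \<in> A"
    hence "b \<in> B" using A by blast
    thus "mor F q q' (\<pi> b q y) = \<pi> b q' (mor F q q' y)" using nat_trans_natural[OF \<pi>_nat qq y] by simp
  next
    show "(\<lambda>b. \<pi> b q' (mor F q q' y)) \<in> A \<rightarrow> carrier (obj F q')"
      using \<pi>_closed[OF _ q(2) is_vfunctor_mor_closed[OF vf qq y]] A by blast
  qed simp
  finally show "part A q' (mor F q q' y) = mor F q q' (part A q y)" by simp
qed

lemma \<pi>_part:
  assumes A: "A \<subseteq> B" and b: "b \<in> B" and q: "0 \<le> q" and y: "y \<in> carrier (obj F q)"
  shows "\<pi> b q (part A q y) = (if b \<in> A then \<pi> b q y else \<zero>\<^bsub>obj F q\<^esub>)"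
proof -
  interpret vectorspace K "obj F q" by (rule vs[OF q])
  have cl: "\<pi> b q y \<in> carrier (obj F q)" if "b \<in> A" for b using \<pi>_closed[OF _ q y] that A by blast
  have fA: "finite A" using A finite_B by (rule finite_subset)
  have "\<pi> b q (part A q y) = (\<Oplus>\<^bsub>obj F q\<^esub>b'\<in>A. \<pi> b q (\<pi> b' q y))"
    unfolding part_def by (rule hom_finsum[OF vs[OF q] vs[OF q] \<pi>_hom[OF b q]]) (use cl in auto)
  also have "\<dots> = (\<Oplus>\<^bsub>obj F q\<^esub>b'\<in>A. if b = b' then \<pi> b' q y else \<zero>\<^bsub>obj F q\<^esub>)"
    by (rule M.finsum_cong') (use cl \<pi>_\<pi>[OF b _ q y] A in auto)
  also have "\<dots> = (if b \<in> A then \<pi> b q y else \<zero>\<^bsub>obj F q\<^esub>)"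
  proof (cases "b \<in> A")
    case True
    thus ?thesis using M.add.finprod_singleton[OF True fA, of "\<lambda>b. \<pi> b q y"] cl by simp
  next
    case False
    hence "(\<Oplus>\<^bsub>obj F q\<^esub>b'\<in>A. if b = b' then \<pi> b' q y else \<zero>\<^bsub>obj F q\<^esub>) = \<zero>\<^bsub>obj F q\<^esub>"
      by (intro M.finsum_all0) auto
    with False show ?thesis by simp
  qed
  finally show ?thesis .
qed

lemma eq_by_\<pi>:
  assumes q: "0 \<le> q" and y: "y \<in> carrier (obj F q)" "z \<in> carrier (obj F q)"
    and eq: "\<And>b. b \<in> B \<Longrightarrow> \<pi> b q y = \<pi> b q z"
  shows "y = z"
proof -
  interpret vectorspace K "obj F q" by (rule vs[OF q])
  have "y \<ominus>\<^bsub>obj F q\<^esub> z = \<zero>\<^bsub>obj F q\<^esub>"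
  proof (rule \<pi>_joint[OF q])
    fix b assume b: "b \<in> B"
    show "\<pi> b q (y \<ominus>\<^bsub>obj F q\<^esub> z) = \<zero>\<^bsub>obj F q\<^esub>"
      using hom_minus[OF vs[OF q] vs[OF q] \<pi>_hom[OF b q] y] eq[OF b] \<pi>_closed[OF b q y(2)] by simp
  qed (use y in simp)
  thus ?thesis using y by simp
qed

lemma mem_subsum_iff:
  assumes A: "A \<subseteq> B" and q: "0 \<le> q"
  shows "y \<in> carrier (obj (subsum A) q) \<longleftrightarrow> y \<in> carrier (obj F q) \<and> part A q y = y"
proof -
  interpret vectorspace K "obj F q" by (rule vs[OF q])
  have BA: "B - A \<subseteq> B" by auto
  have \<pi>0: "\<pi> b q \<zero>\<^bsub>obj F q\<^esub> = \<zero>\<^bsub>obj F q\<^esub>" if "b \<in> B" for b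
    using hom_zero[OF vs[OF q] vs[OF q] \<pi>_hom[OF that q]] .
  have "part (B - A) q y = \<zero>\<^bsub>obj F q\<^esub> \<longleftrightarrow> part A q y = y" if y: "y \<in> carrier (obj F q)"
  proof
    assume z: "part (B - A) q y = \<zero>\<^bsub>obj F q\<^esub>"
    show "part A q y = y"
    proof (rule eq_by_\<pi>[OF q part_closed[OF A q y] y])
      fix b assume b: "b \<in> B"
      show "\<pi> b q (part A q y) = \<pi> b q y"
        using \<pi>_part[OF A b q y] \<pi>_part[OF BA b q y] z \<pi>0[OF b] b by (auto split: if_splits)
    qed
  next
    assume e: "part A q y = y"
    show "part (B - A) q y = \<zero>\<^bsub>obj F q\<^esub>"
    proof (rule eq_by_\<pi>[OF q part_closed[OF BA q y] M.zero_closed])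
      fix b assume b: "b \<in> B"
      show "\<pi> b q (part (B - A) q y) = \<pi> b q \<zero>\<^bsub>obj F q\<^esub>"
        using \<pi>_part[OF A b q y] \<pi>_part[OF BA b q y] e \<pi>0[OF b] b by (auto split: if_splits)
    qed
  qed
  thus ?thesis unfolding subsum_def ker_functor_def by auto
qed

lemma part_part:
  assumes A: "A \<subseteq> B" and q: "0 \<le> q" and y: "y \<in> carrier (obj F q)"
  shows "part A q (part A q y) = part A q y"
proof -
  note p = part_closed[OF A q y]
  show ?thesis
  proof (rule eq_by_\<pi>[OF q part_closed[OF A q p] p])
    fix b assume b: "b \<in> B"
    show "\<pi> b q (part A q (part A q y)) = \<pi> b q (part A q y)"
      unfolding \<pi>_part[OF A b q p] \<pi>_part[OF A b q y] by simp
  qed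
qed

lemma subsum_simps [simp]:
  "add (obj (subsum A) q) = add (obj F q)" "zero (obj (subsum A) q) = zero (obj F q)"
  "smult (obj (subsum A) q) = smult (obj F q)" "mor (subsum A) = mor F"
  by (simp_all add: subsum_def ker_functor_def)

lemma tame_subsum: "tame K (subsum A)"
  unfolding subsum_def by (rule tame_ker[OF tame_F tame_F nat_trans_part]) auto

lemma subsum_sub: "carrier (obj (subsum A) q) \<subseteq> carrier (obj F q)"
  by (auto simp: subsum_def ker_functor_def)

lemma subsum_restrict: "subsum A = restrict_functor F (\<lambda>q. carrier (obj (subsum A) q))"
  by (simp add: subsum_def ker_functor_def restrict_functor_def)

lemma nat_trans_part_subsum:
  assumes A: "A \<subseteq> B" shows "nat_trans nnrat K F (subsum A) (part A)"
  by (subst subsum_restrict, rule nat_trans_restrict_cod[OF nat_trans_part[OF A]])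
    (use A in \<open>auto simp: mem_subsum_iff part_closed part_part\<close>)

lemma nat_trans_subsum_incl: "nat_trans nnrat K (subsum A) F (\<lambda>q y. y)"
  by (subst subsum_restrict, rule nat_trans_restrict_dom[OF nat_trans_id[OF vf]]) (rule subsum_sub)

lemma part_insert:
  assumes A: "insert b A \<subseteq> B" "b \<notin> A" and q: "0 \<le> q" and y: "y \<in> carrier (obj F q)"
  shows "part (insert b A) q y = \<pi> b q y \<oplus>\<^bsub>obj F q\<^esub> part A q y"
proof -
  interpret vectorspace K "obj F q" by (rule vs[OF q])
  have "finite A" using A finite_B by (auto intro: finite_subset)
  thus ?thesis unfolding part_def
    using A \<pi>_closed[OF _ q y] by (intro M.finsum_insert) auto
qed

text \<open>A subsum of summands in \<open>S \<epsilon>\<close> is a quotient of an iterated direct sum of them.\<close>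

lemma subsum_noise:
  assumes S: "noise_system K S" "closed_under_direct_sums K S" and \<epsilon>: "0 \<le> \<epsilon>"
    and A: "A \<subseteq> B" and summands: "\<And>b. b \<in> A \<Longrightarrow> summand b \<in> S \<epsilon>"
  shows "subsum A \<in> S \<epsilon>"
proof -
  have "finite A" using A finite_B by (rule finite_subset)
  thus ?thesis using A summands
  proof (induction A)
    case empty
    show ?case
    proof (rule noise_zero[OF S(1) \<epsilon> tame_vfunctor[OF tame_subsum]])
      show "zero_functor nnrat (subsum {})" unfolding zero_functor_def
      proof
        fix q :: rat assume "q \<in> nnrat" hence q: "0 \<le> q" by simp
        interpret vectorspace K "obj F q" by (rule vs[OF q])
        show "carrier (obj (subsum {}) q) = {\<zero>\<^bsub>obj (subsum {}) q\<^esub>}"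
          by (auto simp: mem_subsum_iff[OF empty_subsetI q] part_def)
      qed
    qed
  next
    case (insert b A)
    have A: "A \<subseteq> B" and b: "b \<in> B" using insert.prems by auto
    have bA: "insert b A \<subseteq> B" using A b by simp
    note sb = s_nonneg[OF b] and xb = x_closed[OF b]
    have "subsum A \<in> S \<epsilon>" using insert by auto
    moreover have "summand b \<in> S \<epsilon>" using insert.prems by auto
    ultimately have "in_upto_iso nnrat K (dsum2 (subsum A) (summand b)) (S \<epsilon>)"
      using S(2) \<epsilon> unfolding closed_under_direct_sums_def by auto
    moreover note tame_subsum
    moreover have cyc: "z \<in> carrier (obj F q)" "part (insert b A) q z = z"
      if q: "0 \<le> q" and z: "z \<in> cyc_set K F (s b) (x b) q" for q z
    proof -
      have "z \<in> \<pi> b q ` carrier (obj F q)" using z \<pi>_image[OF b q] by simp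
      then obtain z' where z': "z' \<in> carrier (obj F q)" "z = \<pi> b q z'" by blast
      show zc: "z \<in> carrier (obj F q)" using z' \<pi>_closed[OF b q] by simp
      show "part (insert b A) q z = z"
        by (rule eq_by_\<pi>[OF q part_closed[OF bA q zc] zc])
          (use z' \<pi>_\<pi>[OF _ b q z'(1)] \<pi>_part[OF bA _ q zc] in auto)
    qed
    have subA: "y \<in> carrier (obj F q)" "part (insert b A) q y = y"
      if q: "0 \<le> q" and "y \<in> carrier (obj (subsum A) q)" for q y
    proof -
      have y: "y \<in> carrier (obj F q)" "part A q y = y" using that mem_subsum_iff[OF A q] by auto
      have "\<pi> b' q y = \<zero>\<^bsub>obj F q\<^esub>" if "b' \<in> B" "b' \<notin> A" for b'
        using \<pi>_part[OF A that(1) q y(1)] y(2) that(2) by simp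
      thus "part (insert b A) q y = y"
        by (intro eq_by_\<pi>[OF q part_closed[OF bA q y(1)] y(1)]) (auto simp: \<pi>_part[OF bA _ q y(1)])
      show "y \<in> carrier (obj F q)" by (rule y)
    qed
    \<comment> \<open>The addition map from the direct sum.\<close>
    let ?g = "\<lambda>q (y, z). y \<oplus>\<^bsub>obj F q\<^esub> z"
    have "nat_trans nnrat K (dsum2 (subsum A) (summand b)) (subsum (insert b A)) ?g"
      unfolding nat_trans_def
    proof (intro conjI ballI impI)
      fix q :: rat assume "q \<in> nnrat" hence q: "0 \<le> q" by simp
      interpret vectorspace K "obj F q" by (rule vs[OF q])
      have hp: "part (insert b A) q \<in> module_hom K (obj F q) (obj F q)"
        using nat_trans_hom[OF nat_trans_part[OF bA]] q by simp
      show "?g q \<in> module_hom K (obj (dsum2 (subsum A) (summand b)) q) (obj (subsum (insert b A)) q)"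
        by (rule module_homI)
          (auto simp: mem_subsum_iff[OF bA q] subA[OF q] cyc[OF q] module_hom_add[OF hp] M.a_ac smult_r_distr)
    next
      fix q q' :: rat and p assume qq: "q \<in> nnrat" "q' \<in> nnrat" "q \<le> q'"
        and p: "p \<in> carrier (obj (dsum2 (subsum A) (summand b)) q)"
      thus "?g q' (mor (dsum2 (subsum A) (summand b)) q q' p) = mor (subsum (insert b A)) q q' (?g q p)"
        using subA(1)[of q] cyc(1)[of q] module_hom_add[OF is_vfunctor_mor[OF vf qq]]
        by auto
    qed
    moreover have "carrier (obj (subsum (insert b A)) q) \<subseteq> ?g q ` carrier (obj (dsum2 (subsum A) (summand b)) q)"
      if q: "0 \<le> q" for q
    proof
      fix y assume "y \<in> carrier (obj (subsum (insert b A)) q)"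
      hence y: "y \<in> carrier (obj F q)" "part (insert b A) q y = y" using mem_subsum_iff[OF bA q] by auto
      interpret vectorspace K "obj F q" by (rule vs[OF q])
      have "y = ?g q (part A q y, \<pi> b q y)"
        using y part_insert[OF bA insert.hyps(2) q y(1)] part_closed[OF A q y(1)] \<pi>_closed[OF b q y(1)]
        by (simp add: M.a_comm)
      moreover have "part A q y \<in> carrier (obj (subsum A) q)"
        using mem_subsum_iff[OF A q] part_closed[OF A q y(1)] part_part[OF A q y(1)] by simp
      moreover have "\<pi> b q y \<in> carrier (obj (summand b) q)"
        using \<pi>_image[OF b q] y(1) by auto
      ultimately show "y \<in> ?g q ` carrier (obj (dsum2 (subsum A) (summand b)) q)" by (intro image_eqI) auto
    qed
    ultimately show ?case by (rule noise_quot[OF S(1) \<epsilon>])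
  qed
qed

end

section \<open>The upper and the lower bound\<close>

lemma cyc_set_smult:
  assumes F: "is_vfunctor nnrat K F" and s: "0 \<le> s" and x: "x \<in> carrier (obj F s)"
    and c: "c \<in> carrier K" "c \<noteq> \<zero>\<^bsub>K\<^esub>" and q: "0 \<le> q"
  shows "cyc_set K F s (c \<odot>\<^bsub>obj F s\<^esub> x) q = cyc_set K F s x q"
proof (cases "s \<le> q")
  case True
  interpret vectorspace K "obj F q" using is_vfunctor_vectorspace[OF F] q by simp
  have m: "mor F s q x \<in> carrier (obj F q)" using is_vfunctor_mor_closed[OF F _ _ True x] s q by simp
  have mc: "mor F s q (c \<odot>\<^bsub>obj F s\<^esub> x) = c \<odot>\<^bsub>obj F q\<^esub> mor F s q x"
    using module_hom_smult[OF is_vfunctor_mor[OF F _ _ True] c(1) x] s q by simp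
  have i: "inv\<^bsub>K\<^esub> c \<in> carrier K" "inv\<^bsub>K\<^esub> c \<otimes>\<^bsub>K\<^esub> c = \<one>\<^bsub>K\<^esub>" using c by (auto simp: field_Units)
  have "(\<lambda>a. a \<odot>\<^bsub>obj F q\<^esub> (c \<odot>\<^bsub>obj F q\<^esub> mor F s q x)) ` carrier K = (\<lambda>a. a \<odot>\<^bsub>obj F q\<^esub> mor F s q x) ` carrier K"
  proof
    show "(\<lambda>a. a \<odot>\<^bsub>obj F q\<^esub> (c \<odot>\<^bsub>obj F q\<^esub> mor F s q x)) ` carrier K \<subseteq> (\<lambda>a. a \<odot>\<^bsub>obj F q\<^esub> mor F s q x) ` carrier K"
      using c(1) m by (auto simp: smult_assoc1[symmetric])
    show "(\<lambda>a. a \<odot>\<^bsub>obj F q\<^esub> mor F s q x) ` carrier K \<subseteq> (\<lambda>a. a \<odot>\<^bsub>obj F q\<^esub> (c \<odot>\<^bsub>obj F q\<^esub> mor F s q x)) ` carrier K"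
    proof (rule image_subsetI)
      fix a assume a: "a \<in> carrier K"
      have "a \<odot>\<^bsub>obj F q\<^esub> mor F s q x = (a \<otimes>\<^bsub>K\<^esub> inv\<^bsub>K\<^esub> c) \<odot>\<^bsub>obj F q\<^esub> (c \<odot>\<^bsub>obj F q\<^esub> mor F s q x)"
        using a c(1) i m by (simp add: smult_assoc1[symmetric] R.m_assoc)
      moreover have "a \<otimes>\<^bsub>K\<^esub> inv\<^bsub>K\<^esub> c \<in> carrier K" using a i by simp
      ultimately show "a \<odot>\<^bsub>obj F q\<^esub> mor F s q x \<in> (\<lambda>a. a \<odot>\<^bsub>obj F q\<^esub> (c \<odot>\<^bsub>obj F q\<^esub> mor F s q x)) ` carrier K"
        by (rule image_eqI)
    qed
  qed
  with True mc show ?thesis by (simp add: cyc_set_def)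
qed (simp add: cyc_set_def)

context cyclic_sum
begin

text \<open>
  The projection to the \<open>k\<close>-th summand picks out the \<open>k\<close>-th term of a combination of homogeneous elements.
\<close>

lemma \<pi>_comb_diagonal:
  assumes m: "family K F A p m" and A: "A \<subseteq> B" and c: "c \<in> A \<rightarrow> carrier K"
    and diag: "\<And>k b. k \<in> B \<Longrightarrow> b \<in> A \<Longrightarrow> \<pi> k (p b) (m b) = (if k = b then m b else \<zero>\<^bsub>obj F (p b)\<^esub>)"
    and k: "k \<in> A" "p k \<le> q"
  shows "\<pi> k q (comb F A p m q c) = c k \<odot>\<^bsub>obj F q\<^esub> mor F (p k) q (m k)"
proof -
  interpret m: family K F A p m by (rule m)
  have kB: "k \<in> B" using k A by blast
  have q: "0 \<le> q" using m.s_nonneg[OF k(1)] k(2) by simp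
  interpret vectorspace K "obj F q" by (rule vs[OF q])
  have cl: "c b \<odot>\<^bsub>obj F q\<^esub> mor F (p b) q (m b) \<in> carrier (obj F q)" if "b \<in> A" "p b \<le> q" for b
    using m.mor_x_closed[OF that] c that by auto
  have off: "mor F (p b) q \<zero>\<^bsub>obj F (p b)\<^esub> = \<zero>\<^bsub>obj F q\<^esub>" if "b \<in> A" "p b \<le> q" for b
    using hom_zero[OF vs[OF m.s_nonneg[OF that(1)]] vs[OF q] is_vfunctor_mor[OF vf _ _ that(2)]]
      m.s_nonneg[OF that(1)] q by simp
  have ck: "c b \<in> carrier K" if "b \<in> A" for b using c that by auto
  have "\<pi> k q (comb F A p m q c) = comb F A p (\<lambda>b. \<pi> k (p b) (m b)) q c"
    by (rule m.comb_image[OF vf \<pi>_nat[OF kB] q c])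
  also have "\<dots> = (\<Oplus>\<^bsub>obj F q\<^esub>b\<in>{b \<in> A. p b \<le> q}. if k = b then c b \<odot>\<^bsub>obj F q\<^esub> mor F (p b) q (m b) else \<zero>\<^bsub>obj F q\<^esub>)"
    unfolding comb_def
    by (rule M.finsum_cong') (use cl off ck diag[OF kB] in auto)
  also have "\<dots> = c k \<odot>\<^bsub>obj F q\<^esub> mor F (p k) q (m k)"
    by (rule M.add.finprod_singleton) (use k m.finite_B cl in auto)
  finally show ?thesis .
qed

text \<open>
  \<open>F\<close> itself connects \<open>F\<close> with \<open>subsum A\<close>: the projection is onto and its kernel is the sum of the remaining
  summands.
\<close>

lemma eps_close_subsum:
  assumes S: "noise_system K S" "closed_under_direct_sums K S" and \<epsilon>: "0 \<le> \<epsilon>"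
    and A: "A \<subseteq> B" and noise: "\<And>b. b \<in> B - A \<Longrightarrow> summand b \<in> S \<epsilon>"
  shows "eps_close K S \<epsilon> F (subsum A)"
proof -
  have id: "eps_equivalence K S 0 F F (\<lambda>q y. y)"
    unfolding eps_equivalence_def
  proof (intro conjI bexI[of _ 0])
    show nt: "nat_trans nnrat K F F (\<lambda>q y. y)" by (rule nat_trans_id[OF vf])
    have "zero_functor nnrat (ker_functor F F (\<lambda>q y. y))" unfolding zero_functor_def ker_functor_def
    proof
      fix q :: rat assume "q \<in> nnrat"
      then interpret vectorspace K "obj F q" using vs by simp
      show "carrier (obj (restrict_functor F (\<lambda>v. {x \<in> carrier (obj F v). x = \<zero>\<^bsub>obj F v\<^esub>})) q) =
          {\<zero>\<^bsub>obj (restrict_functor F (\<lambda>v. {x \<in> carrier (obj F v). x = \<zero>\<^bsub>obj F v\<^esub>})) q\<^esub>}" by auto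
    qed
    thus "ker_functor F F (\<lambda>q y. y) \<in> S 0" by (rule noise_zero[OF S(1) order_refl is_vfunctor_ker[OF vf vf nt]])
    show "in_upto_iso nnrat K (coker_functor F F (\<lambda>q y. y)) (S 0)"
      by (rule coker_surj_noise[OF S(1) vf vf nt]) simp
  qed auto
  have nt: "nat_trans nnrat K F (subsum A) (part A)" by (rule nat_trans_part_subsum[OF A])
  have "ker_functor F (subsum A) (part A) = subsum (B - A)"
    using A by (simp add: subsum_def[of "B - A"] ker_functor_def double_diff)
  moreover have "subsum (B - A) \<in> S \<epsilon>" by (rule subsum_noise[OF S \<epsilon>]) (use noise in auto)
  ultimately have ker: "ker_functor F (subsum A) (part A) \<in> S \<epsilon>" by simp
  have "in_upto_iso nnrat K (coker_functor F (subsum A) (part A)) (S 0)"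
  proof (rule coker_surj_noise[OF S(1) vf tame_vfunctor[OF tame_subsum] nt])
    fix q :: rat assume q: "0 \<le> q"
    show "carrier (obj (subsum A) q) \<subseteq> part A q ` carrier (obj F q)"
      using mem_subsum_iff[OF A q] by (metis image_eqI subsetI)
  qed
  with ker have "\<exists>\<tau>\<in>nnrat. \<exists>\<mu>\<in>nnrat. \<tau> + \<mu> \<le> \<epsilon> \<and> ker_functor F (subsum A) (part A) \<in> S \<tau> \<and>
      in_upto_iso nnrat K (coker_functor F (subsum A) (part A)) (S \<mu>)"
    using \<epsilon> by - (rule bexI[of _ \<epsilon>], rule bexI[of _ 0], auto)
  with nt have "eps_equivalence K S \<epsilon> F (subsum A) (part A)"
    unfolding eps_equivalence_def by blast
  with id tame_F \<epsilon> show ?thesis unfolding eps_close_def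
    by (intro exI[of _ F] exI[of _ "\<lambda>q y. y"] exI[of _ "part A"] conjI bexI[of _ 0] bexI[of _ \<epsilon>]) auto
qed

text \<open>
  The generators of the summands are reduced: the components of a relation are relations, and
  \<open>c \<odot> x k = 0\<close> with \<open>x k \<noteq> 0\<close> forces \<open>c = 0\<close>.
\<close>

lemma has_rank_subsum:
  assumes u: "adequate_universe K TYPE('a)" and A: "A \<subseteq> B" and nz: "\<And>b. b \<in> A \<Longrightarrow> x b \<noteq> \<zero>\<^bsub>obj F (s b)\<^esub>"
  shows "has_rank K (subsum A) (card A)"
proof -
  note vS = tame_vfunctor[OF tame_subsum[of A]]
  have fA: "finite A" using A finite_B by (rule finite_subset)
  have xF: "family K F A s x" using A by unfold_locales (auto simp: vf fA s_nonneg x_closed)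
  interpret xF: family K F A s x by (rule xF)
  interpret xS: family K "subsum A" A s x
  proof
    fix b assume b: "b \<in> A"
    hence bB: "b \<in> B" using A by blast
    note q = s_nonneg[OF bB] and xb = x_closed[OF bB]
    have "part A (s b) (x b) = x b"
    proof (rule eq_by_\<pi>[OF q part_closed[OF A q xb] xb])
      fix k assume k: "k \<in> B"
      show "\<pi> k (s b) (part A (s b) (x b)) = \<pi> k (s b) (x b)"
        unfolding \<pi>_part[OF A k q xb] using \<pi>_x[OF k bB] b by auto
    qed
    with xb show "x b \<in> carrier (obj (subsum A) (s b))" by (simp add: mem_subsum_iff[OF A q])
  qed (use vS fA xF.s_nonneg in auto)
  have comb_eq: "comb (subsum A) A s x q c = comb F A s x q c" if "0 \<le> q" "c \<in> A \<rightarrow> carrier K" for q c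
    by (rule xS.comb_image[OF vf nat_trans_subsum_incl that])
  have "xS.generating" unfolding xS.generating_def
  proof (intro allI impI ballI)
    fix q :: rat and y assume q: "0 \<le> q" and "y \<in> carrier (obj (subsum A) q)"
    hence y: "y \<in> carrier (obj F q)" "part A q y = y" using mem_subsum_iff[OF A q] by auto
    interpret vectorspace K "obj F q" by (rule vs[OF q])
    have "\<exists>a. a \<in> carrier K \<and> \<pi> b q y = (if s b \<le> q then a \<odot>\<^bsub>obj F q\<^esub> mor F (s b) q (x b) else \<zero>\<^bsub>obj F q\<^esub>)"
      if b: "b \<in> A" for b
    proof -
      have "\<pi> b q y \<in> cyc_set K F (s b) (x b) q" using \<pi>_image[OF _ q] b A y(1) by blast
      thus ?thesis by (auto simp: cyc_set_def split: if_splits)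
    qed
    then obtain c where c: "\<And>b. b \<in> A \<Longrightarrow> c b \<in> carrier K"
      "\<And>b. b \<in> A \<Longrightarrow> \<pi> b q y = (if s b \<le> q then c b \<odot>\<^bsub>obj F q\<^esub> mor F (s b) q (x b) else \<zero>\<^bsub>obj F q\<^esub>)"
      by metis
    have cA: "c \<in> A \<rightarrow> carrier K" using c(1) by blast
    have "comb F A s x q c = part A q y" unfolding comb_def part_def
      by (rule M.add.finprod_mono_neutral_cong_left) (use fA c xF.mor_x_closed in auto)
    hence "y = comb (subsum A) A s x q c" using comb_eq[OF q cA] y(2) by simp
    with cA show "\<exists>c\<in>A \<rightarrow> carrier K. y = comb (subsum A) A s x q c" by blast
  qed
  moreover have "xS.reduced" unfolding xS.reduced_def
  proof (intro allI impI ballI, rule ccontr)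
    fix q :: rat and c k assume q: "0 \<le> q" and c: "c \<in> A \<rightarrow> carrier K"
      and z: "comb (subsum A) A s x q c = \<zero>\<^bsub>obj (subsum A) q\<^esub>" and k: "k \<in> A" "s k = q" and ck: "c k \<noteq> \<zero>\<^bsub>K\<^esub>"
    have kB: "k \<in> B" using k(1) A by blast
    interpret vectorspace K "obj F q" by (rule vs[OF q])
    have cK: "c k \<in> carrier K" using c k(1) by auto
    have xk: "x k \<in> carrier (obj F q)" using x_closed[OF kB] k(2) by simp
    have "c k \<odot>\<^bsub>obj F q\<^esub> x k = c k \<odot>\<^bsub>obj F q\<^esub> mor F (s k) q (x k)"
      using is_vfunctor_mor_id[OF vf _ xk] k(2) q by simp
    also have "\<dots> = \<pi> k q (comb F A s x q c)"
      by (rule \<pi>_comb_diagonal[OF xF A c _ k(1), symmetric]) (use \<pi>_x A k(2) in auto)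
    also have "\<dots> = \<pi> k q \<zero>\<^bsub>obj F q\<^esub>" using comb_eq[OF q c] z by simp
    also have "\<dots> = \<zero>\<^bsub>obj F q\<^esub>" by (rule hom_zero[OF vs[OF q] vs[OF q] \<pi>_hom[OF kB q]])
    finally have 0: "c k \<odot>\<^bsub>obj F q\<^esub> x k = \<zero>\<^bsub>obj F q\<^esub>" .
    have i: "inv\<^bsub>K\<^esub> c k \<in> carrier K" "inv\<^bsub>K\<^esub> c k \<otimes>\<^bsub>K\<^esub> c k = \<one>\<^bsub>K\<^esub>" using cK ck by (auto simp: field_Units)
    have "x k = (inv\<^bsub>K\<^esub> c k \<otimes>\<^bsub>K\<^esub> c k) \<odot>\<^bsub>obj F q\<^esub> x k" using i(2) xk by simp
    also have "\<dots> = \<zero>\<^bsub>obj F q\<^esub>" using smult_assoc1[OF i(1) cK xk] 0 i(1) by simp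
    finally show False using nz[OF k(1)] k(2) by simp
  qed
  ultimately show ?thesis by (rule has_rank_of_reduced_generating[OF u xS.family_axioms])
qed

text \<open>
  Let \<open>Y\<close> be the cokernel of \<open>\<phi>\<close> and \<open>\<theta>\<close> the projection to it. For \<open>k \<in> A\<close> the kernel of \<open>\<theta>\<close> on the \<open>k\<close>-th
  summand is generated by the generator \<open>x k\<close> pushed to the first time \<open>p k\<close> at which it vanishes in \<open>Y\<close>;
  such a time exists, for otherwise the summand would embed in \<open>Y \<in> S \<beta>\<close>. This element \<open>m k\<close> lifts to
  \<open>h k \<in> H (p k)\<close>, and the claim is that the images of the \<open>h k\<close> in \<open>G\<close> form a reduced family.

  A relation at time \<open>p k\<close> with nonzero coefficient at \<open>k\<close> provides an element \<open>z\<close> of \<open>ker \<psi>\<close>. It generates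
  a functor in \<open>S \<gamma>\<close>, which the projection to the \<open>k\<close>-th summand maps onto the functor generated by \<open>m k\<close>.
  Hence the \<open>k\<close>-th summand is an extension of a subfunctor of \<open>Y\<close> by a member of \<open>S \<gamma>\<close>, and so lies
  in \<open>S (\<gamma> + \<beta>)\<close>.
\<close>

theorem rank_lower_bound:
  fixes H G :: "(rat, 'k, 'a) vfunctor" and S :: "rat \<Rightarrow> (rat, 'k, 'a) vfunctor set"
  assumes S: "noise_system K S" and H: "tame K H" and G: "tame K G"
    and \<phi>: "nat_trans nnrat K H F \<phi>" and \<psi>: "nat_trans nnrat K H G \<psi>"
    and coker: "in_upto_iso nnrat K (coker_functor H F \<phi>) (S \<beta>)" and ker: "ker_functor H G \<psi> \<in> S \<gamma>"
    and \<beta>: "0 \<le> \<beta>" and \<gamma>: "0 \<le> \<gamma>"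
    and A: "A \<subseteq> B" and not_noise: "\<And>b. b \<in> A \<Longrightarrow> summand b \<notin> S (\<gamma> + \<beta>)"
    and g: "family K G C r g" "family.generating K G C r g"
  shows "card A \<le> card C"
proof -
  note vH = tame_vfunctor[OF H] and vG = tame_vfunctor[OF G]
  obtain Y \<Theta> where Y: "Y \<in> S \<beta>" and \<Theta>: "nat_iso nnrat K (coker_functor H F \<phi>) Y \<Theta>"
    using coker unfolding in_upto_iso_def isomorphic_def by blast
  note tY = noise_tame[OF S \<beta> Y]
  note vY = tame_vfunctor[OF tY] and vC = is_vfunctor_coker[OF vH vf \<phi>]
  define \<theta> where "\<theta> q y = \<Theta> q (coset_map H F \<phi> q y)" for q y
  have \<theta>: "nat_trans nnrat K F Y \<theta>"
    unfolding \<theta>_def by (rule nat_trans_comp[OF nat_trans_coset_map[OF vH vf \<phi>] nat_iso_nat_trans[OF \<Theta>]])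
  have \<theta>_zero: "y \<in> \<phi> q ` carrier (obj H q)"
    if q: "0 \<le> q" and y: "y \<in> carrier (obj F q)" and z: "\<theta> q y = \<zero>\<^bsub>obj Y q\<^esub>" for q y
  proof -
    let ?C = "coker_functor H F \<phi>"
    have q': "q \<in> nnrat" using q by simp
    interpret Cq: vectorspace K "obj ?C q" by (rule is_vfunctor_vectorspace[OF vC q'])
    have "\<Theta> q \<zero>\<^bsub>obj ?C q\<^esub> = \<zero>\<^bsub>obj Y q\<^esub>"
      by (rule hom_zero[OF Cq.vectorspace_axioms is_vfunctor_vectorspace[OF vY q'] nat_trans_hom[OF nat_iso_nat_trans[OF \<Theta>] q']])
    hence "coset_map H F \<phi> q y = \<zero>\<^bsub>obj ?C q\<^esub>"
      using nat_iso_bij[OF \<Theta> q'] z nat_trans_closed[OF nat_trans_coset_map[OF vH vf \<phi>] q' y]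
      unfolding \<theta>_def bij_betw_def inj_on_def by (metis Cq.M.zero_closed)
    thus ?thesis using coset_map_eq_zero_iff[OF vH vf \<phi> q' y] by simp
  qed
  \<comment> \<open>A common grid on which \<open>F\<close> and \<open>Y\<close> are constant and which contains all birth times.\<close>
  obtain \<alpha> where \<alpha>: "\<alpha> > 0" "grid_const \<alpha> Y" using tY unfolding tame_iff_grid_const by auto
  have "0 \<le> a" if "a \<in> insert \<alpha> (s ` B)" for a using that \<alpha>(1) s_nonneg by auto
  from common_grid[OF finite.insertI[OF finite_imageI[OF finite_B]] this]
  obtain \<delta> where \<delta>: "\<delta> > 0" "\<forall>a\<in>insert \<alpha> (s ` B). on_grid \<delta> a" by blast
  have gY: "grid_const \<delta> Y" using grid_const_refine[OF \<alpha>(2)] \<delta>(2) by simp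
  define \<xi> where "\<xi> b q = mor F (s b) q (x b)" for b q
  have \<xi>: "\<xi> b q \<in> carrier (obj F q)" if "b \<in> B" "s b \<le> q" for b q
    unfolding \<xi>_def by (rule mor_x_closed[OF that])
  have \<xi>_mor: "mor F q q' (\<xi> b q) = \<xi> b q'" if "b \<in> B" "s b \<le> q" "q \<le> q'" for b q q'
    unfolding \<xi>_def using is_vfunctor_mor_comp[OF vf _ _ _ that(2,3) x_closed[OF that(1)]] s_nonneg[OF that(1)] that by simp
  have s_floor: "s b \<le> \<delta> * of_nat (b_floor \<delta> q)" if b: "b \<in> B" and sq: "s b \<le> q" for b q
  proof -
    obtain k :: nat where k: "s b = \<delta> * of_nat k" using \<delta>(2) b by (auto simp: on_grid_def)
    have "b_floor \<delta> (s b) \<le> b_floor \<delta> q" by (rule b_floor_mono[OF \<delta>(1) s_nonneg[OF b] sq])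
    hence "k \<le> b_floor \<delta> q" using \<delta>(1) by (simp add: k)
    thus ?thesis unfolding k using \<delta>(1) by (simp add: mult_left_mono)
  qed
  \<comment> \<open>As \<open>Y\<close> is constant between grid points, a generator dead at time \<open>q\<close> is dead at the last grid point before.\<close>
  have to_grid: "\<theta> (\<delta> * of_nat (b_floor \<delta> q)) (\<xi> b (\<delta> * of_nat (b_floor \<delta> q))) = \<zero>\<^bsub>obj Y (\<delta> * of_nat (b_floor \<delta> q))\<^esub>"
    if b: "b \<in> B" and sq: "s b \<le> q" and z: "\<theta> q (\<xi> b q) = \<zero>\<^bsub>obj Y q\<^esub>" for b q
  proof -
    let ?p = "\<delta> * of_nat (b_floor \<delta> q)"
    have q: "0 \<le> q" using s_nonneg[OF b] sq by simp
    have sp: "s b \<le> ?p" by (rule s_floor[OF b sq])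
    have p: "0 \<le> ?p" "?p \<le> q" using \<delta>(1) b_floor_bounds(1)[OF \<delta>(1) q] by auto
    have pq': "?p \<in> nnrat" "q \<in> nnrat" using p q by auto
    interpret Yp: vectorspace K "obj Y ?p" by (rule is_vfunctor_vectorspace[OF vY pq'(1)])
    have "\<not> (?p < \<delta> * of_nat k \<and> \<delta> * of_nat k \<le> q)" for k :: nat
    proof
      assume k: "?p < \<delta> * of_nat k \<and> \<delta> * of_nat k \<le> q"
      hence "b_floor \<delta> q < k" using \<delta>(1) by (simp add: mult_less_cancel_left)
      hence "\<delta> * of_nat (Suc (b_floor \<delta> q)) \<le> \<delta> * of_nat k"
        using \<delta>(1) by (intro mult_left_mono) (simp_all only: of_nat_le_iff Suc_le_eq less_imp_le)
      thus False using k b_floor_bounds(2)[OF \<delta>(1) q] by simp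
    qed
    hence inj: "inj_on (mor Y ?p q) (carrier (obj Y ?p))"
      using gY p unfolding grid_const_def bij_betw_def by blast
    have "mor Y ?p q (\<theta> ?p (\<xi> b ?p)) = \<zero>\<^bsub>obj Y q\<^esub>"
      using nat_trans_natural[OF \<theta> pq' p(2) \<xi>[OF b sp]] \<xi>_mor[OF b sp p(2)] z by simp
    also have "\<dots> = mor Y ?p q \<zero>\<^bsub>obj Y ?p\<^esub>"
      by (rule hom_zero[OF is_vfunctor_vectorspace[OF vY pq'(1)] is_vfunctor_vectorspace[OF vY pq'(2)]
            is_vfunctor_mor[OF vY pq' p(2)], symmetric])
    finally show ?thesis
      using inj nat_trans_closed[OF \<theta> pq'(1) \<xi>[OF b sp]] by (auto simp: inj_on_def)
  qed
  have \<theta>_smult: "\<theta> q (a \<odot>\<^bsub>obj F q\<^esub> y) = a \<odot>\<^bsub>obj Y q\<^esub> \<theta> q y"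
    if "0 \<le> q" "a \<in> carrier K" "y \<in> carrier (obj F q)" for q a y
    using module_hom_smult[OF nat_trans_hom[OF \<theta>]] that by simp
  have \<theta>_ann: "a = \<zero>\<^bsub>K\<^esub> \<or> \<theta> q y = \<zero>\<^bsub>obj Y q\<^esub>"
    if q: "0 \<le> q" and a: "a \<in> carrier K" and y: "y \<in> carrier (obj F q)"
      and z: "\<theta> q (a \<odot>\<^bsub>obj F q\<^esub> y) = \<zero>\<^bsub>obj Y q\<^esub>" for q a y
  proof (rule disjCI)
    assume ne: "\<theta> q y \<noteq> \<zero>\<^bsub>obj Y q\<^esub>"
    interpret Yq: vectorspace K "obj Y q" using is_vfunctor_vectorspace[OF vY] q by simp
    have ty: "\<theta> q y \<in> carrier (obj Y q)" using nat_trans_closed[OF \<theta> _ y] q by simp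
    show "a = \<zero>\<^bsub>K\<^esub>"
    proof (rule ccontr)
      assume "a \<noteq> \<zero>\<^bsub>K\<^esub>"
      hence i: "inv\<^bsub>K\<^esub> a \<in> carrier K" "inv\<^bsub>K\<^esub> a \<otimes>\<^bsub>K\<^esub> a = \<one>\<^bsub>K\<^esub>" using a by (auto simp: Yq.field_Units)
      have az: "a \<odot>\<^bsub>obj Y q\<^esub> \<theta> q y = \<zero>\<^bsub>obj Y q\<^esub>" using \<theta>_smult[OF q a y] z by simp
      have "\<theta> q y = (inv\<^bsub>K\<^esub> a \<otimes>\<^bsub>K\<^esub> a) \<odot>\<^bsub>obj Y q\<^esub> \<theta> q y" using i(2) ty by simp
      also have "\<dots> = inv\<^bsub>K\<^esub> a \<odot>\<^bsub>obj Y q\<^esub> (a \<odot>\<^bsub>obj Y q\<^esub> \<theta> q y)" by (rule Yq.smult_assoc1[OF i(1) a ty])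
      also have "\<dots> = \<zero>\<^bsub>obj Y q\<^esub>" unfolding az using i(1) by simp
      finally show False using ne by simp
    qed
  qed
  have tX: "tame K (summand b)" if "b \<in> B" for b
    by (rule tame_cyclic[OF vf s_nonneg[OF that] x_closed[OF that] tame_F])
  have \<theta>x: "\<theta> (s b) (x b) \<in> carrier (obj Y (s b))" if "b \<in> B" for b
    using nat_trans_closed[OF \<theta> _ x_closed[OF that]] s_nonneg[OF that] by simp
  have tZ: "tame K (cyclic K Y (s b) (\<theta> (s b) (x b)))" "cyclic K Y (s b) (\<theta> (s b) (x b)) \<in> S \<beta>" if "b \<in> B" for b
    using tame_cyclic[OF vY s_nonneg[OF that] \<theta>x[OF that] tY]
      noise_cyclic[OF vY s_nonneg[OF that] \<theta>x[OF that] S \<beta> Y] by auto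
  have cyc_sub: "cyc_set K F (s b) (x b) q \<subseteq> carrier (obj F q)" if "b \<in> B" "0 \<le> q" for b q
    by (rule subspaceD(2)[OF cyc_set_sub[OF vf s_nonneg[OF that(1)] x_closed[OF that(1)] that(2)]])
  have \<theta>_cyc: "nat_trans nnrat K (summand b) (cyclic K Y (s b) (\<theta> (s b) (x b))) \<theta>" if b: "b \<in> B" for b
  proof -
    have "nat_trans nnrat K (summand b) Y \<theta>" unfolding cyclic_def
      by (rule nat_trans_restrict_dom[OF \<theta>]) (use cyc_sub[OF b] in auto)
    thus ?thesis unfolding cyclic_def[of K Y]
      by (rule nat_trans_restrict_cod)
        (use image_cyc_set[OF vf s_nonneg[OF b] x_closed[OF b] vY \<theta>] in auto)
  qed
  have hit: "\<exists>n. s b \<le> \<delta> * of_nat n \<and> \<theta> (\<delta> * of_nat n) (\<xi> b (\<delta> * of_nat n)) = \<zero>\<^bsub>obj Y (\<delta> * of_nat n)\<^esub>"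
    if b: "b \<in> A" for b
  proof (rule ccontr)
    assume no: "\<not> ?thesis"
    have bB: "b \<in> B" using b A by blast
    have "summand b \<in> S \<beta>"
    proof (rule noise_sub[OF S \<beta> tZ(2)[OF bB] tX[OF bB] \<theta>_cyc[OF bB]])
      fix q :: rat assume q: "0 \<le> q"
      have q': "q \<in> nnrat" using q by simp
      show "inj_on (\<theta> q) (carrier (obj (summand b) q))"
      proof (rule hom_inj_on[OF is_vfunctor_vectorspace[OF tame_vfunctor[OF tX[OF bB]] q']
            is_vfunctor_vectorspace[OF tame_vfunctor[OF tZ(1)[OF bB]] q'] nat_trans_hom[OF \<theta>_cyc[OF bB] q']])
        fix y assume "y \<in> carrier (obj (summand b) q)" and z: "\<theta> q y = \<zero>\<^bsub>obj (cyclic K Y (s b) (\<theta> (s b) (x b))) q\<^esub>"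
        hence y: "y \<in> cyc_set K F (s b) (x b) q" by simp
        interpret Fq: vectorspace K "obj F q" by (rule vs[OF q])
        show "y = \<zero>\<^bsub>obj (summand b) q\<^esub>"
        proof (cases "s b \<le> q")
          case True
          then obtain a where a: "a \<in> carrier K" "y = a \<odot>\<^bsub>obj F q\<^esub> \<xi> b q"
            using y by (auto simp: cyc_set_def \<xi>_def)
          have "\<theta> q (\<xi> b q) \<noteq> \<zero>\<^bsub>obj Y q\<^esub>" using to_grid[OF bB True] s_floor[OF bB True] no by blast
          hence "a = \<zero>\<^bsub>K\<^esub>" using \<theta>_ann[OF q a(1) \<xi>[OF bB True]] z a(2) by auto
          thus ?thesis using a(2) \<xi>[OF bB True] by simp
        qed (use y in \<open>simp add: cyc_set_def\<close>)
      qed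
    qed
    hence "summand b \<in> S (\<gamma> + \<beta>)" by (rule noise_mono[OF S \<beta>, rotated]) (use \<gamma> in simp)
    thus False using not_noise[OF b] by simp
  qed
  \<comment> \<open>The first grid time at which the generator of the summand vanishes in \<open>Y\<close>.\<close>
  define n where "n b = (LEAST n. s b \<le> \<delta> * of_nat n \<and> \<theta> (\<delta> * of_nat n) (\<xi> b (\<delta> * of_nat n)) = \<zero>\<^bsub>obj Y (\<delta> * of_nat n)\<^esub>)" for b
  define p where "p b = \<delta> * of_nat (n b)" for b
  have p: "s b \<le> p b" "\<theta> (p b) (\<xi> b (p b)) = \<zero>\<^bsub>obj Y (p b)\<^esub>" if "b \<in> A" for b
    using LeastI_ex[OF hit[OF that], folded n_def] unfolding p_def by auto
  have p_min: "p b \<le> q" if b: "b \<in> A" and sq: "s b \<le> q" and z: "\<theta> q (\<xi> b q) = \<zero>\<^bsub>obj Y q\<^esub>" for b q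
  proof -
    have bB: "b \<in> B" using b A by blast
    have q: "0 \<le> q" using s_nonneg[OF bB] sq by simp
    have "n b \<le> b_floor \<delta> q"
      unfolding n_def by (rule Least_le) (use s_floor[OF bB sq] to_grid[OF bB sq z] in simp)
    hence "p b \<le> \<delta> * of_nat (b_floor \<delta> q)" unfolding p_def using \<delta>(1) by (simp add: mult_left_mono)
    thus ?thesis using b_floor_bounds(1)[OF \<delta>(1) q] by simp
  qed
  have p0: "0 \<le> p b" for b unfolding p_def using \<delta>(1) by simp
  define m where "m b = \<xi> b (p b)" for b
  have m: "m b \<in> carrier (obj F (p b))" if "b \<in> A" for b
    unfolding m_def using \<xi>[of b] p(1)[OF that] that A by blast
  have "\<exists>h. h \<in> carrier (obj H (p b)) \<and> \<phi> (p b) h = m b" if b: "b \<in> A" for b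
  proof -
    have "m b \<in> \<phi> (p b) ` carrier (obj H (p b))"
      by (rule \<theta>_zero[OF p0 m[OF b]]) (simp only: m_def p(2)[OF b])
    then obtain h where "m b = \<phi> (p b) h" "h \<in> carrier (obj H (p b))" by (rule imageE)
    thus ?thesis by (intro exI[of _ h]) simp
  qed
  then obtain h where h: "\<And>b. b \<in> A \<Longrightarrow> h b \<in> carrier (obj H (p b))" "\<And>b. b \<in> A \<Longrightarrow> \<phi> (p b) (h b) = m b"
    by metis
  have fA: "finite A" using A finite_B by (rule finite_subset)
  interpret h: family K H A p h by unfold_locales (use vH fA p0 h in auto)
  have fam: "family K G A p (\<lambda>b. \<psi> (p b) (h b))" by (rule h.family_image[OF vG \<psi>])
  interpret y: family K G A p "\<lambda>b. \<psi> (p b) (h b)" by (rule fam)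
  have fm: "family K F A p m" by unfold_locales (use vf fA p0 m in auto)
  interpret fm: family K F A p m by (rule fm)
  have diag: "\<pi> k (p b) (m b) = (if k = b then m b else \<zero>\<^bsub>obj F (p b)\<^esub>)" if k: "k \<in> B" and b: "b \<in> A" for k b
  proof -
    have bB: "b \<in> B" using b A by blast
    have s': "s b \<in> nnrat" "p b \<in> nnrat" using s_nonneg[OF bB] p0 by auto
    have "\<pi> k (p b) (m b) = mor F (s b) (p b) (\<pi> k (s b) (x b))"
      unfolding m_def \<xi>_def by (rule nat_trans_natural[OF \<pi>_nat[OF k] s' p(1)[OF b] x_closed[OF bB]])
    thus ?thesis
      using \<pi>_x[OF k bB] hom_zero[OF vs[OF s_nonneg[OF bB]] vs[OF p0] is_vfunctor_mor[OF vf s' p(1)[OF b]]]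
      by (auto simp: m_def \<xi>_def)
  qed
  have "y.reduced" unfolding y.reduced_def
  proof (intro allI impI ballI, rule ccontr)
    fix q :: rat and c k assume q: "0 \<le> q" and c: "c \<in> A \<rightarrow> carrier K"
      and zero: "comb G A p (\<lambda>b. \<psi> (p b) (h b)) q c = \<zero>\<^bsub>obj G q\<^esub>" and k: "k \<in> A" "p k = q" and ck: "c k \<noteq> \<zero>\<^bsub>K\<^esub>"
    have kB: "k \<in> B" using k(1) A by blast
    have q': "q \<in> nnrat" using q by simp
    have cK: "c k \<in> carrier K" using c k(1) by auto
    have mk: "m k \<in> carrier (obj F q)" using m[OF k(1)] k(2) by simp
    \<comment> \<open>The relation in \<open>G\<close> lifts to an element of \<open>ker \<psi>\<close>.\<close>
    define z where "z = comb H A p h q c"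
    have zH: "z \<in> carrier (obj H q)" unfolding z_def by (rule h.comb_closed[OF q c])
    let ?N = "ker_functor H G \<psi>"
    have vN: "is_vfunctor nnrat K ?N" by (rule is_vfunctor_ker[OF vH vG \<psi>])
    have zN: "z \<in> carrier (obj ?N q)"
      using zH h.comb_image[OF vG \<psi> q c] zero unfolding z_def ker_functor_def by simp
    let ?\<kappa> = "\<lambda>v y. \<pi> k v (\<phi> v y)"
    have \<kappa>: "nat_trans nnrat K ?N F ?\<kappa>"
      unfolding ker_functor_def
      by (rule nat_trans_comp[OF nat_trans_restrict_dom[OF \<phi>] \<pi>_nat[OF kB]]) auto
    have "?\<kappa> q z = \<pi> k q (comb F A p (\<lambda>b. \<phi> (p b) (h b)) q c)"
      unfolding z_def using h.comb_image[OF vf \<phi> q c] by simp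
    also have "comb F A p (\<lambda>b. \<phi> (p b) (h b)) q c = comb F A p m q c"
    proof -
      interpret Fq: vectorspace K "obj F q" by (rule vs[OF q])
      show ?thesis unfolding comb_def
        by (rule Fq.M.finsum_cong') (use h(2) c fm.mor_x_closed in auto)
    qed
    also have "\<pi> k q \<dots> = c k \<odot>\<^bsub>obj F q\<^esub> mor F (p k) q (m k)"
      by (rule \<pi>_comb_diagonal[OF fm A c diag k(1)]) (use k(2) in auto)
    also have "mor F (p k) q (m k) = m k" using is_vfunctor_mor_id[OF vf q' mk] k(2) by simp
    finally have \<kappa>z: "?\<kappa> q z = c k \<odot>\<^bsub>obj F q\<^esub> m k" .
    let ?Z = "cyclic K F q (m k)"
    have tame_Z: "tame K ?Z" by (rule tame_cyclic[OF vf q mk tame_F])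
    have im: "?\<kappa> v ` cyc_set K ?N q z v = cyc_set K F q (m k) v" if v: "0 \<le> v" for v
      using image_cyc_set[OF vN q zN vf \<kappa> v] cyc_set_smult[OF vf q mk cK ck v] \<kappa>z by simp
    have Z: "?Z \<in> S \<gamma>"
    proof (rule noise_quot[OF S \<gamma> in_upto_iso_self[OF S \<gamma> noise_cyclic[OF vN q zN S \<gamma> ker]] tame_Z])
      have "nat_trans nnrat K (cyclic K ?N q z) F ?\<kappa>"
        by (rule nat_trans_comp[OF nat_trans_cyclic_incl[OF vN q zN] \<kappa>])
      thus "nat_trans nnrat K (cyclic K ?N q z) ?Z ?\<kappa>"
        unfolding cyclic_def[of K F] by (rule nat_trans_restrict_cod) (use im in auto)
      fix v :: rat assume "0 \<le> v"
      thus "carrier (obj ?Z v) \<subseteq> ?\<kappa> v ` carrier (obj (cyclic K ?N q z) v)" using im by simp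
    qed
    let ?X = "summand k" and ?Y = "cyclic K Y (s k) (\<theta> (s k) (x k))"
    have m_def': "m k = \<xi> k q" unfolding m_def k(2) ..
    have sq: "s k \<le> q" using p(1)[OF k(1)] k(2) by simp
    \<comment> \<open>The functor generated by \<open>m k\<close> is the whole kernel of \<open>\<theta>\<close> on the summand, by the choice of \<open>p k\<close>.\<close>
    have kernel: "cyc_set K F q (m k) v = {y \<in> cyc_set K F (s k) (x k) v. \<theta> v y = \<zero>\<^bsub>obj Y v\<^esub>}"
      if v: "0 \<le> v" for v
    proof (intro equalityI subsetI)
      have v': "v \<in> nnrat" using v by simp
      interpret Fv: vectorspace K "obj F v" by (rule vs[OF v])
      interpret Yv: vectorspace K "obj Y v" by (rule is_vfunctor_vectorspace[OF vY v'])
      have \<theta>0: "\<theta> v \<zero>\<^bsub>obj F v\<^esub> = \<zero>\<^bsub>obj Y v\<^esub>"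
        by (rule hom_zero[OF vs[OF v] is_vfunctor_vectorspace[OF vY v'] nat_trans_hom[OF \<theta> v']])
      note sub = cyc_set_sub[OF vf s_nonneg[OF kB] x_closed[OF kB] v]
      {
        fix y assume y: "y \<in> cyc_set K F q (m k) v"
        show "y \<in> {y \<in> cyc_set K F (s k) (x k) v. \<theta> v y = \<zero>\<^bsub>obj Y v\<^esub>}"
        proof (cases "q \<le> v")
          case True
          have sv: "s k \<le> v" using sq True by simp
          obtain a where a: "a \<in> carrier K" "y = a \<odot>\<^bsub>obj F v\<^esub> \<xi> k v"
            using y True \<xi>_mor[OF kB sq True] by (auto simp: cyc_set_def m_def')
          have "\<theta> v (\<xi> k v) = mor Y q v (\<theta> q (\<xi> k q))"
            using nat_trans_natural[OF \<theta> q' v' True \<xi>[OF kB sq]] \<xi>_mor[OF kB sq True] by simp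
          also have "\<dots> = \<zero>\<^bsub>obj Y v\<^esub>"
            using p(2)[OF k(1)] k(2) hom_zero[OF is_vfunctor_vectorspace[OF vY q'] is_vfunctor_vectorspace[OF vY v']
              is_vfunctor_mor[OF vY q' v' True]] by simp
          finally have "\<theta> v y = \<zero>\<^bsub>obj Y v\<^esub>" using \<theta>_smult[OF v a(1) \<xi>[OF kB sv]] a by simp
          moreover have "y \<in> cyc_set K F (s k) (x k) v" using a sv by (simp add: cyc_set_def \<xi>_def)
          ultimately show ?thesis by simp
        next
          case False
          with y \<theta>0 subspaceD(3)[OF sub] show ?thesis by (simp add: cyc_set_def[of K F q])
        qed
      next
        fix y assume "y \<in> {y \<in> cyc_set K F (s k) (x k) v. \<theta> v y = \<zero>\<^bsub>obj Y v\<^esub>}"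
        hence y: "y \<in> cyc_set K F (s k) (x k) v" "\<theta> v y = \<zero>\<^bsub>obj Y v\<^esub>" by auto
        have zero_in: "\<zero>\<^bsub>obj F v\<^esub> \<in> cyc_set K F q (m k) v" by (rule subspaceD(3)[OF cyc_set_sub[OF vf q mk v]])
        show "y \<in> cyc_set K F q (m k) v"
        proof (cases "s k \<le> v")
          case True
          obtain a where a: "a \<in> carrier K" "y = a \<odot>\<^bsub>obj F v\<^esub> \<xi> k v"
            using y(1) True by (auto simp: cyc_set_def \<xi>_def)
          show ?thesis
          proof (cases "a = \<zero>\<^bsub>K\<^esub>")
            case True
            thus ?thesis using a zero_in \<xi>[OF kB \<open>s k \<le> v\<close>] by simp
          next
            case False
            hence "\<theta> v (\<xi> k v) = \<zero>\<^bsub>obj Y v\<^esub>" using \<theta>_ann[OF v a(1) \<xi>[OF kB True]] y(2) a(2) by auto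
            hence "q \<le> v" using p_min[OF k(1) True] k(2) by simp
            thus ?thesis using a \<xi>_mor[OF kB sq] by (simp add: cyc_set_def m_def')
          qed
        qed (use y zero_in in \<open>simp add: cyc_set_def[of K F "s k"]\<close>)
      }
    qed
    have "short_exact nnrat K ?Z ?X ?Y (\<lambda>v y. y) \<theta>"
      unfolding short_exact_def
    proof (intro conjI ballI)
      show "nat_trans nnrat K ?X ?Y \<theta>" by (rule \<theta>_cyc[OF kB])
      show "nat_trans nnrat K ?Z ?X (\<lambda>v y. y)"
        unfolding cyclic_def[of K F "s k"]
        by (rule nat_trans_restrict_cod[OF nat_trans_cyclic_incl[OF vf q mk]]) (use kernel in auto)
      fix v :: rat assume "v \<in> nnrat" hence v: "0 \<le> v" by simp
      show "inj_on (\<lambda>y. y) (carrier (obj ?Z v))" by simp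
      show "(\<lambda>y. y) ` carrier (obj ?Z v) = {y \<in> carrier (obj ?X v). \<theta> v y = \<zero>\<^bsub>obj ?Y v\<^esub>}"
        using kernel[OF v] by simp
      show "\<theta> v ` carrier (obj ?X v) = carrier (obj ?Y v)"
        using image_cyc_set[OF vf s_nonneg[OF kB] x_closed[OF kB] vY \<theta> v] by simp
    qed
    from noise_short_exact(3)[OF S tame_Z tX[OF kB] tZ(1)[OF kB] this \<gamma> \<beta> Z tZ(2)[OF kB]]
    show False using not_noise[OF k(1)] by simp
  qed
  from reduced_card_le_generating[OF fam this g] show ?thesis .
qed

end

section \<open>Finite direct sums of cyclic functors\<close>

lemma nat_trans_dsum_proj:
  "j \<in> J \<Longrightarrow> nat_trans I K (dsum J X) (X j) (\<lambda>q f. f j)"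
  using module_sum_eval_hom by (auto simp: nat_trans_def)

lemma nat_trans_dsum_incl:
  assumes X: "\<And>j. j \<in> J \<Longrightarrow> is_vfunctor I K (X j)" and j: "j \<in> J"
  shows "nat_trans I K (X j) (dsum J X) (\<lambda>q a. \<lambda>j'\<in>J. if j' = j then a else \<zero>\<^bsub>obj (X j') q\<^esub>)"
  unfolding nat_trans_def
proof (intro conjI ballI impI)
  fix q assume q: "q \<in> I"
  note z = is_vfunctor_zero[OF X q]
  show "(\<lambda>a. \<lambda>j'\<in>J. if j' = j then a else \<zero>\<^bsub>obj (X j') q\<^esub>) \<in> module_hom K (obj (X j) q) (obj (dsum J X) q)"
  proof (rule module_homI)
    fix a assume "a \<in> carrier (obj (X j) q)"
    thus "(\<lambda>j'\<in>J. if j' = j then a else \<zero>\<^bsub>obj (X j') q\<^esub>) \<in> carrier (obj (dsum J X) q)"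
      unfolding dsum_simps by (intro module_sum_carrierI[of _ _ _ "{j}"]) (auto simp: z)
  qed (auto simp: z intro!: restrict_ext)
next
  fix q q' a assume "q \<in> I" "q' \<in> I" "q \<le> q'" "a \<in> carrier (obj (X j) q)"
  thus "(\<lambda>j'\<in>J. if j' = j then mor (X j) q q' a else \<zero>\<^bsub>obj (X j') q'\<^esub>) =
      mor (dsum J X) q q' (\<lambda>j'\<in>J. if j' = j then a else \<zero>\<^bsub>obj (X j') q\<^esub>)"
    using hom_zero[OF is_vfunctor_vectorspace[OF X] is_vfunctor_vectorspace[OF X] is_vfunctor_mor[OF X]]
    by (auto intro!: restrict_ext)
qed

lemma nat_trans_dsum2_proj:
  "nat_trans I K (dsum2 F G) F (\<lambda>q. fst)" "nat_trans I K (dsum2 F G) G (\<lambda>q. snd)"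
  by (auto simp: nat_trans_def intro!: module_homI)

lemma nat_trans_dsum2_incl:
  assumes F: "is_vfunctor I K F" and G: "is_vfunctor I K G"
  shows "nat_trans I K F (dsum2 F G) (\<lambda>q a. (a, \<zero>\<^bsub>obj G q\<^esub>))"
    "nat_trans I K G (dsum2 F G) (\<lambda>q b. (\<zero>\<^bsub>obj F q\<^esub>, b))"
proof -
  note mz = hom_zero[OF is_vfunctor_vectorspace is_vfunctor_vectorspace is_vfunctor_mor]
  show "nat_trans I K F (dsum2 F G) (\<lambda>q a. (a, \<zero>\<^bsub>obj G q\<^esub>))"
    "nat_trans I K G (dsum2 F G) (\<lambda>q b. (\<zero>\<^bsub>obj F q\<^esub>, b))"
    using is_vfunctor_zero[OF F] is_vfunctor_zero[OF G] mz[OF F _ F _ F] mz[OF G _ G _ G]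
    by (auto simp: nat_trans_def intro!: module_homI)
qed

text \<open>
  The image of the idempotent \<open>\<iota> \<circ> \<rho>\<close> is the image of \<open>\<iota>\<close>, which is generated by the image of the
  generator \<open>z\<close>.
\<close>

lemma retract_of_cyclic:
  fixes F :: "(rat, 'k, 'a) vfunctor" and X :: "(rat, 'k, 'c) vfunctor"
  assumes F: "is_vfunctor nnrat K F" and X: "is_vfunctor nnrat K X"
    and \<iota>: "nat_trans nnrat K X F \<iota>" and \<rho>: "nat_trans nnrat K F X \<rho>"
    and \<rho>\<iota>: "\<And>q a. 0 \<le> q \<Longrightarrow> a \<in> carrier (obj X q) \<Longrightarrow> \<rho> q (\<iota> q a) = a"
    and s: "0 \<le> s" and z: "z \<in> carrier (obj X s)"
    and gen: "\<And>q. 0 \<le> q \<Longrightarrow> carrier (obj X q) = cyc_set K X s z q"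
  shows "0 \<le> q \<Longrightarrow> (\<lambda>y. \<iota> q (\<rho> q y)) ` carrier (obj F q) = cyc_set K F s (\<iota> s z) q"
    "isomorphic nnrat K X (cyclic K F s (\<iota> s z))"
proof -
  have im: "\<iota> q ` carrier (obj X q) = cyc_set K F s (\<iota> s z) q" if "0 \<le> q" for q
    using image_cyc_set[OF X s z F \<iota> that] gen[OF that] by simp
  have \<rho>_surj: "\<rho> q ` carrier (obj F q) = carrier (obj X q)" if q: "0 \<le> q" for q
  proof
    show "\<rho> q ` carrier (obj F q) \<subseteq> carrier (obj X q)" using nat_trans_closed[OF \<rho>] q by auto
    show "carrier (obj X q) \<subseteq> \<rho> q ` carrier (obj F q)"
    proof
      fix a assume a: "a \<in> carrier (obj X q)"
      have "\<iota> q a \<in> carrier (obj F q)" using nat_trans_closed[OF \<iota> _ a] q by simp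
      thus "a \<in> \<rho> q ` carrier (obj F q)" using \<rho>\<iota>[OF q a] by (metis imageI)
    qed
  qed
  show "(\<lambda>y. \<iota> q (\<rho> q y)) ` carrier (obj F q) = cyc_set K F s (\<iota> s z) q" if "0 \<le> q"
    using im[OF that] \<rho>_surj[OF that] by (simp add: image_image[symmetric])
  have "nat_iso nnrat K X (cyclic K F s (\<iota> s z)) \<iota>"
  proof (rule nat_isoI_bij[OF X])
    show "nat_trans nnrat K X (cyclic K F s (\<iota> s z)) \<iota>"
      unfolding cyclic_def by (rule nat_trans_restrict_cod[OF \<iota>]) (use im in auto)
    fix q :: rat assume "q \<in> nnrat" hence q: "0 \<le> q" by simp
    have "inj_on (\<iota> q) (carrier (obj X q))" by (rule inj_on_inverseI[of _ "\<rho> q"]) (rule \<rho>\<iota>[OF q])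
    thus "bij_betw (\<iota> q) (carrier (obj X q)) (carrier (obj (cyclic K F s (\<iota> s z)) q))"
      using im[OF q] by (simp add: bij_betw_def)
  qed
  thus "isomorphic nnrat K X (cyclic K F s (\<iota> s z))" unfolding isomorphic_def by blast
qed

text \<open>
  The summands come in two families because intervals and free functors have carriers in different
  types. Transporting the projections of the direct sum to \<open>F\<close> makes all of them endomorphisms of \<open>F\<close>, so
  that from here on the two kinds are treated alike.
\<close>

theorem cyclic_sum_of_iso:
  fixes F :: "(rat, 'k, 'a) vfunctor"
    and X :: "'i \<Rightarrow> (rat, 'k, 'c) vfunctor" and Y :: "'j \<Rightarrow> (rat, 'k, 'd) vfunctor"
  assumes K: "field K" and F: "tame K F" and I: "finite I" and J: "finite J"
    and X: "\<And>i. i \<in> I \<Longrightarrow> is_vfunctor nnrat K (X i)" "\<And>i. i \<in> I \<Longrightarrow> 0 \<le> w i"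
      "\<And>i. i \<in> I \<Longrightarrow> a i \<in> carrier (obj (X i) (w i))"
      "\<And>i q. i \<in> I \<Longrightarrow> 0 \<le> q \<Longrightarrow> carrier (obj (X i) q) = cyc_set K (X i) (w i) (a i) q"
    and Y: "\<And>j. j \<in> J \<Longrightarrow> is_vfunctor nnrat K (Y j)" "\<And>j. j \<in> J \<Longrightarrow> 0 \<le> v j"
      "\<And>j. j \<in> J \<Longrightarrow> b j \<in> carrier (obj (Y j) (v j))"
      "\<And>j q. j \<in> J \<Longrightarrow> 0 \<le> q \<Longrightarrow> carrier (obj (Y j) q) = cyc_set K (Y j) (v j) (b j) q"
    and iso: "isomorphic nnrat K F (dsum2 (dsum I X) (dsum J Y))"
  shows "\<exists>x \<pi>. cyclic_sum K F (I <+> J) (case_sum w v) x \<pi> \<and>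
    (\<forall>i\<in>I. isomorphic nnrat K (X i) (cyclic K F (w i) (x (Inl i)))) \<and>
    (\<forall>j\<in>J. isomorphic nnrat K (Y j) (cyclic K F (v j) (x (Inr j))))"
proof -
  let ?D1 = "dsum I X" and ?D2 = "dsum J Y"
  let ?D = "dsum2 ?D1 ?D2"
  note vF = tame_vfunctor[OF F]
  have v1: "is_vfunctor nnrat K ?D1" and v2: "is_vfunctor nnrat K ?D2"
    using is_vfunctor_dsum[OF K] X(1) Y(1) by auto
  note vD = is_vfunctor_dsum2[OF v1 v2]
  obtain \<Phi> \<Psi> where \<Phi>: "nat_trans nnrat K F ?D \<Phi>" and \<Psi>: "nat_trans nnrat K ?D F \<Psi>"
    and \<Psi>\<Phi>: "nt_eq nnrat F (\<lambda>v. \<Psi> v \<circ> \<Phi> v) (\<lambda>v x. x)" and \<Phi>\<Psi>: "nt_eq nnrat ?D (\<lambda>v. \<Phi> v \<circ> \<Psi> v) (\<lambda>v x. x)"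
    using iso unfolding isomorphic_def nat_iso_def by blast
  have \<Psi>\<Phi>: "\<Psi> q (\<Phi> q y) = y" if "0 \<le> q" "y \<in> carrier (obj F q)" for q y
    using \<Psi>\<Phi> that by (simp add: nt_eq_def)
  have \<Phi>\<Psi>: "\<Phi> q (\<Psi> q d) = d" if "0 \<le> q" "d \<in> carrier (obj ?D q)" for q d
    using bspec[OF bspec[OF \<Phi>\<Psi>[unfolded nt_eq_def], of q] that(2)] that(1) by simp
  define eX where "eX i q c = (\<lambda>i'\<in>I. if i' = i then c else \<zero>\<^bsub>obj (X i') q\<^esub>, \<zero>\<^bsub>obj ?D2 q\<^esub>)" for i q c
  define eY where "eY j q c = (\<zero>\<^bsub>obj ?D1 q\<^esub>, \<lambda>j'\<in>J. if j' = j then c else \<zero>\<^bsub>obj (Y j') q\<^esub>)" for j q c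
  have eX: "nat_trans nnrat K (X i) ?D (eX i)" if i: "i \<in> I" for i
    unfolding eX_def
    by (rule nat_trans_comp[OF nat_trans_dsum_incl[OF X(1) i] nat_trans_dsum2_incl(1)[OF v1 v2]])
  have eY: "nat_trans nnrat K (Y j) ?D (eY j)" if j: "j \<in> J" for j
    unfolding eY_def
    by (rule nat_trans_comp[OF nat_trans_dsum_incl[OF Y(1) j] nat_trans_dsum2_incl(2)[OF v1 v2]])
  define \<iota>X where "\<iota>X i q c = \<Psi> q (eX i q c)" for i q c
  define \<iota>Y where "\<iota>Y j q c = \<Psi> q (eY j q c)" for j q c
  define \<rho>X where "\<rho>X i q y = fst (\<Phi> q y) i" for i q y
  define \<rho>Y where "\<rho>Y j q y = snd (\<Phi> q y) j" for j q y
  have \<iota>X: "nat_trans nnrat K (X i) F (\<iota>X i)" if "i \<in> I" for i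
    unfolding \<iota>X_def by (rule nat_trans_comp[OF eX[OF that] \<Psi>])
  have \<iota>Y: "nat_trans nnrat K (Y j) F (\<iota>Y j)" if "j \<in> J" for j
    unfolding \<iota>Y_def by (rule nat_trans_comp[OF eY[OF that] \<Psi>])
  have \<rho>X: "nat_trans nnrat K F (X i) (\<rho>X i)" if "i \<in> I" for i
    unfolding \<rho>X_def
    by (rule nat_trans_comp[OF nat_trans_comp[OF \<Phi> nat_trans_dsum2_proj(1)] nat_trans_dsum_proj[OF that]])
  have \<rho>Y: "nat_trans nnrat K F (Y j) (\<rho>Y j)" if "j \<in> J" for j
    unfolding \<rho>Y_def
    by (rule nat_trans_comp[OF nat_trans_comp[OF \<Phi> nat_trans_dsum2_proj(2)] nat_trans_dsum_proj[OF that]])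
  have XX: "\<rho>X i q (\<iota>X i' q c) = (if i = i' then c else \<zero>\<^bsub>obj (X i) q\<^esub>)"
    if "i \<in> I" "i' \<in> I" "0 \<le> q" "c \<in> carrier (obj (X i') q)" for i i' q c
    using \<Phi>\<Psi>[OF that(3) nat_trans_closed[OF eX[OF that(2)] _ that(4)]] that
    by (auto simp: \<rho>X_def \<iota>X_def eX_def)
  have YY: "\<rho>Y j q (\<iota>Y j' q c) = (if j = j' then c else \<zero>\<^bsub>obj (Y j) q\<^esub>)"
    if "j \<in> J" "j' \<in> J" "0 \<le> q" "c \<in> carrier (obj (Y j') q)" for j j' q c
    using \<Phi>\<Psi>[OF that(3) nat_trans_closed[OF eY[OF that(2)] _ that(4)]] that
    by (auto simp: \<rho>Y_def \<iota>Y_def eY_def)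
  have XY: "\<rho>X i q (\<iota>Y j q c) = \<zero>\<^bsub>obj (X i) q\<^esub>"
    if "i \<in> I" "j \<in> J" "0 \<le> q" "c \<in> carrier (obj (Y j) q)" for i j q c
    using \<Phi>\<Psi>[OF that(3) nat_trans_closed[OF eY[OF that(2)] _ that(4)]] that
    by (auto simp: \<rho>X_def \<iota>Y_def eY_def)
  have YX: "\<rho>Y j q (\<iota>X i q c) = \<zero>\<^bsub>obj (Y j) q\<^esub>"
    if "j \<in> J" "i \<in> I" "0 \<le> q" "c \<in> carrier (obj (X i) q)" for i j q c
    using \<Phi>\<Psi>[OF that(3) nat_trans_closed[OF eX[OF that(2)] _ that(4)]] that
    by (auto simp: \<rho>Y_def \<iota>X_def eX_def)
  define \<pi> where "\<pi> = case_sum (\<lambda>i q y. \<iota>X i q (\<rho>X i q y)) (\<lambda>j q y. \<iota>Y j q (\<rho>Y j q y))"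
  define x where "x = case_sum (\<lambda>i. \<iota>X i (w i) (a i)) (\<lambda>j. \<iota>Y j (v j) (b j))"
  have rX: "(\<lambda>y. \<iota>X i q (\<rho>X i q y)) ` carrier (obj F q) = cyc_set K F (w i) (\<iota>X i (w i) (a i)) q"
    if "i \<in> I" "0 \<le> q" for i q
    using retract_of_cyclic(1)[OF vF X(1)[OF that(1)] \<iota>X[OF that(1)] \<rho>X[OF that(1)] _ X(2)[OF that(1)] X(3)[OF that(1)] X(4)[OF that(1)] that(2)]
      XX that(1) by simp
  have isoX: "isomorphic nnrat K (X i) (cyclic K F (w i) (\<iota>X i (w i) (a i)))" if "i \<in> I" for i
    using retract_of_cyclic(2)[OF vF X(1)[OF that(1)] \<iota>X[OF that(1)] \<rho>X[OF that(1)] _ X(2)[OF that(1)] X(3)[OF that(1)] X(4)[OF that(1)]]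
      XX that(1) by simp
  have rY: "(\<lambda>y. \<iota>Y i q (\<rho>Y i q y)) ` carrier (obj F q) = cyc_set K F (v i) (\<iota>Y i (v i) (b i)) q"
    if "i \<in> J" "0 \<le> q" for i q
    using retract_of_cyclic(1)[OF vF Y(1)[OF that(1)] \<iota>Y[OF that(1)] \<rho>Y[OF that(1)] _ Y(2)[OF that(1)] Y(3)[OF that(1)] Y(4)[OF that(1)] that(2)]
      YY that(1) by simp
  have isoY: "isomorphic nnrat K (Y i) (cyclic K F (v i) (\<iota>Y i (v i) (b i)))" if "i \<in> J" for i
    using retract_of_cyclic(2)[OF vF Y(1)[OF that(1)] \<iota>Y[OF that(1)] \<rho>Y[OF that(1)] _ Y(2)[OF that(1)] Y(3)[OF that(1)] Y(4)[OF that(1)]]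
      YY that(1) by simp
  have zX: "\<iota>X i q \<zero>\<^bsub>obj (X i) q\<^esub> = \<zero>\<^bsub>obj F q\<^esub>" "\<rho>X i q \<zero>\<^bsub>obj F q\<^esub> = \<zero>\<^bsub>obj (X i) q\<^esub>" if "i \<in> I" "q \<in> nnrat" for i q
    using hom_zero[OF is_vfunctor_vectorspace[OF X(1)] is_vfunctor_vectorspace[OF vF] nat_trans_hom[OF \<iota>X]]
      hom_zero[OF is_vfunctor_vectorspace[OF vF] is_vfunctor_vectorspace[OF X(1)] nat_trans_hom[OF \<rho>X]] that by blast+
  have zY: "\<iota>Y i q \<zero>\<^bsub>obj (Y i) q\<^esub> = \<zero>\<^bsub>obj F q\<^esub>" "\<rho>Y i q \<zero>\<^bsub>obj F q\<^esub> = \<zero>\<^bsub>obj (Y i) q\<^esub>" if "i \<in> J" "q \<in> nnrat" for i q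
    using hom_zero[OF is_vfunctor_vectorspace[OF Y(1)] is_vfunctor_vectorspace[OF vF] nat_trans_hom[OF \<iota>Y]]
      hom_zero[OF is_vfunctor_vectorspace[OF vF] is_vfunctor_vectorspace[OF Y(1)] nat_trans_hom[OF \<rho>Y]] that by blast+
  have "cyclic_sum K F (I <+> J) (case_sum w v) x \<pi>"
  proof
    show "is_vfunctor nnrat K F" by (rule vF)
    show "tame K F" by (rule F)
    show "finite (I <+> J)" using I J by simp
    show "0 \<le> case_sum w v k" if "k \<in> I <+> J" for k using that X(2) Y(2) by auto
    show "x k \<in> carrier (obj F (case_sum w v k))" if "k \<in> I <+> J" for k
      using that X(2,3) Y(2,3) nat_trans_closed[OF \<iota>X] nat_trans_closed[OF \<iota>Y] by (auto simp: x_def)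
    show "nat_trans nnrat K F F (\<pi> k)" if "k \<in> I <+> J" for k
      using that nat_trans_comp[OF \<rho>X \<iota>X] nat_trans_comp[OF \<rho>Y \<iota>Y] by (auto simp: \<pi>_def)
    show "\<pi> k q ` carrier (obj F q) = cyc_set K F (case_sum w v k) (x k) q" if "k \<in> I <+> J" "0 \<le> q" for k q
      using that by (elim PlusE) (simp_all add: rX rY \<pi>_def x_def)
    show "\<pi> k q (\<pi> k' q y) = (if k = k' then \<pi> k q y else \<zero>\<^bsub>obj F q\<^esub>)"
      if k: "k \<in> I <+> J" "k' \<in> I <+> J" and q: "0 \<le> q" and y: "y \<in> carrier (obj F q)" for k k' q y
    proof -
      have q': "q \<in> nnrat" using q by simp
      have cX: "\<rho>X i q y \<in> carrier (obj (X i) q)" if "i \<in> I" for i using nat_trans_closed[OF \<rho>X[OF that] q' y] .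
      have cY: "\<rho>Y i q y \<in> carrier (obj (Y i) q)" if "i \<in> J" for i using nat_trans_closed[OF \<rho>Y[OF that] q' y] .
      from k show ?thesis
        by (auto simp: \<pi>_def XX[OF _ _ q cX] YY[OF _ _ q cY] XY[OF _ _ q cY] YX[OF _ _ q cX] zX[OF _ q'] zY[OF _ q'] split: if_splits)
    qed
    show "y = \<zero>\<^bsub>obj F q\<^esub>"
      if q: "0 \<le> q" and y: "y \<in> carrier (obj F q)" and all: "\<And>k. k \<in> I <+> J \<Longrightarrow> \<pi> k q y = \<zero>\<^bsub>obj F q\<^esub>" for q y
    proof -
      have q': "q \<in> nnrat" using q by simp
      have X0: "\<rho>X i q y = \<zero>\<^bsub>obj (X i) q\<^esub>" if i: "i \<in> I" for i
      proof -
        have "\<rho>X i q y = \<rho>X i q (\<pi> (Inl i) q y)"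
          using XX[OF i i q nat_trans_closed[OF \<rho>X[OF i] q' y]] by (simp add: \<pi>_def)
        also have "\<dots> = \<zero>\<^bsub>obj (X i) q\<^esub>" using all[OF InlI[OF i]] zX(2)[OF i q'] by simp
        finally show ?thesis .
      qed
      have Y0: "\<rho>Y i q y = \<zero>\<^bsub>obj (Y i) q\<^esub>" if i: "i \<in> J" for i
      proof -
        have "\<rho>Y i q y = \<rho>Y i q (\<pi> (Inr i) q y)"
          using YY[OF i i q nat_trans_closed[OF \<rho>Y[OF i] q' y]] by (simp add: \<pi>_def)
        also have "\<dots> = \<zero>\<^bsub>obj (Y i) q\<^esub>" using all[OF InrI[OF i]] zY(2)[OF i q'] by simp
        finally show ?thesis .
      qed
      have "\<Phi> q y \<in> carrier (obj ?D q)" by (rule nat_trans_closed[OF \<Phi> q' y])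
      hence c: "fst (\<Phi> q y) \<in> extensional I" "snd (\<Phi> q y) \<in> extensional J"
        by (auto simp: mem_Times_iff module_sum_carrierD(2))
      have "fst (\<Phi> q y) = (\<lambda>i\<in>I. \<zero>\<^bsub>obj (X i) q\<^esub>)"
        by (rule extensionalityI[OF c(1)]) (use X0 in \<open>auto simp: \<rho>X_def\<close>)
      moreover have "snd (\<Phi> q y) = (\<lambda>i\<in>J. \<zero>\<^bsub>obj (Y i) q\<^esub>)"
        by (rule extensionalityI[OF c(2)]) (use Y0 in \<open>auto simp: \<rho>Y_def\<close>)
      ultimately have "\<Phi> q y = \<zero>\<^bsub>obj ?D q\<^esub>" by (simp add: prod_eq_iff)
      hence "y = \<Psi> q \<zero>\<^bsub>obj ?D q\<^esub>" using \<Psi>\<Phi>[OF q y] by simp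
      also have "\<dots> = \<zero>\<^bsub>obj F q\<^esub>"
        by (rule hom_zero[OF is_vfunctor_vectorspace[OF vD q'] is_vfunctor_vectorspace[OF vF q'] nat_trans_hom[OF \<Psi> q']])
      finally show ?thesis .
    qed
  qed
  moreover have "x (Inl i) = \<iota>X i (w i) (a i)" "x (Inr j) = \<iota>Y j (v j) (b j)" for i j
    by (simp_all add: x_def)
  ultimately show ?thesis using isoX isoY by (intro exI[of _ x] exI[of _ \<pi>]) auto
qed

lemma carrier_K_functor:
  assumes "field K" shows "carrier (obj (K_functor K v) q) = cyc_set K (K_functor K v) v \<one>\<^bsub>K\<^esub> q"
proof -
  interpret field K by fact
  have "(\<lambda>c. c \<otimes>\<^bsub>K\<^esub> \<one>\<^bsub>K\<^esub>) ` carrier K = (\<lambda>c. c) ` carrier K" by (rule image_cong) simp_all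
  thus ?thesis by (simp add: cyc_set_def K_functor_def)
qed

lemma one_in_K_functor:
  assumes "field K" shows "\<one>\<^bsub>K\<^esub> \<in> carrier (obj (K_functor K v) v)"
proof -
  interpret field K by fact
  show ?thesis by (simp add: K_functor_def)
qed

text \<open>
  The interval is a quotient of \<open>K(w,-)\<close> and hence generated by the coset of the unit. For \<open>u = w\<close> it is
  zero and generated by zero.
\<close>

lemma interval_functor_cyclic:
  assumes K: "field K" and w: "0 \<le> w" "w \<le> u"
  shows "is_vfunctor nnrat K (interval_functor K w u)"
    "\<exists>a\<in>carrier (obj (interval_functor K w u) w). \<forall>q\<ge>0. carrier (obj (interval_functor K w u) q) =
       cyc_set K (interval_functor K w u) w a q"
proof -
  note vK = is_vfunctor_K_functor[OF K]
  interpret field K by (rule K)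
  have nt: "nat_trans nnrat K (K_functor K u) (K_functor K w) (\<lambda>_ x. x)"
    unfolding nat_trans_def using w
    by (auto simp: K_functor_def intro!: module_homI split: if_splits)
  show vI: "is_vfunctor nnrat K (interval_functor K w u)"
    unfolding interval_functor_def by (rule is_vfunctor_coker[OF vK vK nt])
  let ?p = "coset_map (K_functor K u) (K_functor K w) (\<lambda>_ x. x)"
  note p = nat_trans_coset_map[OF vK vK nt, folded interval_functor_def]
  have one: "\<one>\<^bsub>K\<^esub> \<in> carrier (obj (K_functor K w) w)" by (rule one_in_K_functor[OF K])
  have "?p w \<one>\<^bsub>K\<^esub> \<in> carrier (obj (interval_functor K w u) w)"
    using nat_trans_closed[OF p _ one] w by simp
  moreover have "carrier (obj (interval_functor K w u) q) = cyc_set K (interval_functor K w u) w (?p w \<one>\<^bsub>K\<^esub>) q"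
    if q: "0 \<le> q" for q
    using image_cyc_set[OF vK w(1) one vI p q] carrier_K_functor[OF K, of w q]
      coset_map_surj[OF vK vK nt, of q, folded interval_functor_def] by simp
  ultimately show "\<exists>a\<in>carrier (obj (interval_functor K w u) w). \<forall>q\<ge>0. carrier (obj (interval_functor K w u) q) =
       cyc_set K (interval_functor K w u) w a q" by blast
qed

lemma in_upto_iso_iff:
  assumes S: "noise_system K S" and \<epsilon>: "0 \<le> \<epsilon>" and iso: "isomorphic nnrat K X C" and C: "tame K C"
  shows "in_upto_iso nnrat K X (S \<epsilon>) \<longleftrightarrow> C \<in> S \<epsilon>"
proof
  assume X: "in_upto_iso nnrat K X (S \<epsilon>)"
  obtain \<phi> where \<phi>: "nat_iso nnrat K X C \<phi>" using iso unfolding isomorphic_def by blast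
  show "C \<in> S \<epsilon>"
    by (rule noise_quot[OF S \<epsilon> X C nat_iso_nat_trans[OF \<phi>]]) (use nat_iso_bij[OF \<phi>] in \<open>auto simp: bij_betw_def\<close>)
qed (use iso in \<open>auto simp: in_upto_iso_def\<close>)

text \<open>
  The upper bound discards exactly the summands that lie in some \<open>S \<epsilon>\<close> with \<open>\<epsilon> < t\<close>; since there are
  finitely many, a single \<open>\<epsilon> < t\<close> serves for all of them. A kept summand is nonzero, as the zero functor
  is in \<open>S 0\<close>.
\<close>

lemma (in cyclic_sum) bar_eq_card:
  assumes u: "adequate_universe K TYPE('a)" and S: "noise_system K S" "closed_under_direct_sums K S"
    and t: "0 < t"
  shows "bar K S F t = card {b \<in> B. \<forall>\<epsilon>. 0 \<le> \<epsilon> \<and> \<epsilon> < t \<longrightarrow> summand b \<notin> S \<epsilon>}"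
proof -
  let ?A = "{b \<in> B. \<forall>\<epsilon>. 0 \<le> \<epsilon> \<and> \<epsilon> < t \<longrightarrow> summand b \<notin> S \<epsilon>}"
  have A: "?A \<subseteq> B" by auto
  have "\<forall>b\<in>B - ?A. \<exists>\<epsilon>. 0 \<le> \<epsilon> \<and> \<epsilon> < t \<and> summand b \<in> S \<epsilon>" by auto
  from bchoice[OF this] obtain e where e': "\<forall>b\<in>B - ?A. 0 \<le> e b \<and> e b < t \<and> summand b \<in> S (e b)" ..
  have e: "0 \<le> e b \<and> e b < t \<and> summand b \<in> S (e b)" if "b \<in> B - ?A" for b by (rule bspec[OF e' that])
  \<comment> \<open>The zero covers the case that no summand is discarded.\<close>
  define \<epsilon> where "\<epsilon> = Max (insert 0 (e ` (B - ?A)))"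
  have fe: "finite (insert 0 (e ` (B - ?A)))" using finite_B by simp
  have \<epsilon>: "0 \<le> \<epsilon>" "\<epsilon> < t" and le: "\<And>b. b \<in> B - ?A \<Longrightarrow> e b \<le> \<epsilon>"
    unfolding \<epsilon>_def using fe t e by (auto simp: Max_ge)
  have noise: "summand b \<in> S \<epsilon>" if "b \<in> B - ?A" for b
    using noise_mono[OF S(1) _ le[OF that]] e[OF that] by blast
  have nz: "x b \<noteq> \<zero>\<^bsub>obj F (s b)\<^esub>" if b: "b \<in> ?A" for b
  proof
    assume x0: "x b = \<zero>\<^bsub>obj F (s b)\<^esub>"
    have bB: "b \<in> B" using b by simp
    have "zero_functor nnrat (summand b)" unfolding zero_functor_def
    proof
      fix q :: rat assume q: "q \<in> nnrat"
      interpret vectorspace K "obj F q" using vs q by simp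
      have "mor F (s b) q \<zero>\<^bsub>obj F (s b)\<^esub> = \<zero>\<^bsub>obj F q\<^esub>" if "s b \<le> q"
        using hom_zero[OF vs[OF s_nonneg[OF bB]] vs is_vfunctor_mor[OF vf _ q that]] s_nonneg[OF bB] q by simp
      thus "carrier (obj (summand b) q) = {\<zero>\<^bsub>obj (summand b) q\<^esub>}"
        using R.zero_closed by (auto simp: cyc_set_def x0)
    qed
    hence "summand b \<in> S 0"
      by (rule noise_zero[OF S(1) order_refl is_vfunctor_cyclic[OF vf s_nonneg[OF bB] x_closed[OF bB]]])
    thus False using b t by auto
  qed
  have "eps_close K S \<epsilon> F (subsum ?A)" by (rule eps_close_subsum[OF S \<epsilon>(1) A noise])
  hence in_ball: "subsum ?A \<in> noise_ball K S F t"
    using tame_subsum \<epsilon> unfolding noise_ball_def by auto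
  have rank: "has_rank K (subsum ?A) (card ?A)" by (rule has_rank_subsum[OF u A nz])
  have rank_eq: "functor_rank K (subsum ?A) = card ?A"
    by (rule functor_rank_eq[OF tame_vfunctor[OF tame_subsum] rank])
  have lower: "card ?A \<le> functor_rank K G" if G: "G \<in> noise_ball K S F t" and fin: "finite_rank K G" for G
  proof -
    obtain \<epsilon>' where tG: "tame K G" and \<epsilon>': "\<epsilon>' < t" and close: "eps_close K S \<epsilon>' F G"
      using G unfolding noise_ball_def by blast
    obtain H \<phi> \<psi> \<tau> \<mu> where H: "tame K H" and \<tau>\<mu>: "\<tau> + \<mu> \<le> \<epsilon>'"
      and e1: "eps_equivalence K S \<tau> H F \<phi>" and e2: "eps_equivalence K S \<mu> H G \<psi>"
      using close unfolding eps_close_def by blast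
    obtain \<tau>1 \<beta> where \<phi>: "nat_trans nnrat K H F \<phi>" and n1: "\<tau>1 \<in> nnrat" "\<beta> \<in> nnrat" "\<tau>1 + \<beta> \<le> \<tau>"
      and coker: "in_upto_iso nnrat K (coker_functor H F \<phi>) (S \<beta>)"
      using e1 unfolding eps_equivalence_def by blast
    obtain \<gamma> \<mu>1 where \<psi>: "nat_trans nnrat K H G \<psi>" and n2: "\<gamma> \<in> nnrat" "\<mu>1 \<in> nnrat" "\<gamma> + \<mu>1 \<le> \<mu>"
      and ker: "ker_functor H G \<psi> \<in> S \<gamma>"
      using e2 unfolding eps_equivalence_def by blast
    have sum: "0 \<le> \<gamma> + \<beta>" "\<gamma> + \<beta> < t" using n1 n2 \<tau>\<mu> \<epsilon>' by auto
    have nn: "0 \<le> \<beta>" "0 \<le> \<gamma>" using n1 n2 by auto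
    obtain n where n: "has_rank K G n" using fin unfolding finite_rank_def by blast
    obtain C :: "(rat \<times> 'a) set" and r g where C: "family K G C r g" "family.generating K G C r g" "card C = n"
      using has_rank_imp_reduced_generating[OF tame_vfunctor[OF tG] n] by blast
    have "card ?A \<le> card C"
      by (rule rank_lower_bound[OF S(1) H tG \<phi> \<psi> coker ker nn A _ C(1,2)]) (use sum in auto)
    thus ?thesis using C(3) functor_rank_eq[OF tame_vfunctor[OF tG] n] by simp
  qed
  have "(LEAST n. \<exists>G\<in>noise_ball K S F t. finite_rank K G \<and> functor_rank K G = n) = card ?A"
  proof (rule Least_equality)
    show "\<exists>G\<in>noise_ball K S F t. finite_rank K G \<and> functor_rank K G = card ?A"
      using in_ball rank rank_eq unfolding finite_rank_def by blast
  qed (use lower in auto)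
  thus ?thesis using t by (simp add: bar_def)
qed

theorem proposition10p2:
  fixes K :: "('k, 'm) ring_scheme"
    and S :: "rat \<Rightarrow> (rat, 'k, 'a) vfunctor set"
    and F :: "(rat, 'k, 'a) vfunctor"
    and I :: "'i set" and J :: "'j set"
    and w u :: "'i \<Rightarrow> rat" and v :: "'j \<Rightarrow> rat"
    and t :: rat
  assumes "field K"
    and "adequate_universe K TYPE('a)"
    and "noise_system K S"
    and "closed_under_direct_sums K S"
    and "tame K F"
    and "compact_functor nnrat K F"
    and "finite I" and "finite J"
    and "\<forall>i\<in>I. 0 \<le> w i \<and> w i \<le> u i"
    and "\<forall>j\<in>J. 0 \<le> v j"
    and "isomorphic nnrat K F
           (dsum2 (dsum I (\<lambda>i. interval_functor K (w i) (u i))) (dsum J (\<lambda>j. K_functor K (v j))))"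
    and "t > 0"
  shows "bar K S F t =
           card {i\<in>I. \<forall>\<epsilon>. 0 \<le> \<epsilon> \<and> \<epsilon> < t \<longrightarrow>
                        \<not> in_upto_iso nnrat K (interval_functor K (w i) (u i)) (S \<epsilon>)} +
           card {j\<in>J. \<forall>\<epsilon>. 0 \<le> \<epsilon> \<and> \<epsilon> < t \<longrightarrow>
                        \<not> in_upto_iso nnrat K (K_functor K (v j)) (S \<epsilon>)}"
proof -
  let ?X = "\<lambda>i. interval_functor K (w i) (u i)" and ?Y = "\<lambda>j. K_functor K (v j)"
  note K = assms(1) and S = assms(3)
  have w: "0 \<le> w i" "w i \<le> u i" if "i \<in> I" for i using assms(9) that by auto
  have v: "0 \<le> v j" if "j \<in> J" for j using assms(10) that by auto
  have "\<exists>a. \<forall>i\<in>I. a i \<in> carrier (obj (?X i) (w i)) \<and> (\<forall>q\<ge>0. carrier (obj (?X i) q) = cyc_set K (?X i) (w i) (a i) q)"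
    by (rule bchoice) (use interval_functor_cyclic(2)[OF K w] in blast)
  then obtain a where a: "\<And>i. i \<in> I \<Longrightarrow> a i \<in> carrier (obj (?X i) (w i))"
    "\<And>i q. i \<in> I \<Longrightarrow> 0 \<le> q \<Longrightarrow> carrier (obj (?X i) q) = cyc_set K (?X i) (w i) (a i) q" by blast
  obtain x \<pi> where cs: "cyclic_sum K F (I <+> J) (case_sum w v) x \<pi>"
    and isoX: "\<And>i. i \<in> I \<Longrightarrow> isomorphic nnrat K (?X i) (cyclic K F (w i) (x (Inl i)))"
    and isoY: "\<And>j. j \<in> J \<Longrightarrow> isomorphic nnrat K (?Y j) (cyclic K F (v j) (x (Inr j)))"
    using cyclic_sum_of_iso[OF K assms(5,7,8) interval_functor_cyclic(1)[OF K w] w(1) a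
        is_vfunctor_K_functor[OF K] v one_in_K_functor[OF K] carrier_K_functor[OF K] assms(11)] by blast
  interpret cyclic_sum K F "I <+> J" "case_sum w v" x \<pi> by (rule cs)
  let ?keep = "\<lambda>b. \<forall>\<epsilon>. 0 \<le> \<epsilon> \<and> \<epsilon> < t \<longrightarrow> summand b \<notin> S \<epsilon>"
  let ?It = "{i\<in>I. \<forall>\<epsilon>. 0 \<le> \<epsilon> \<and> \<epsilon> < t \<longrightarrow> \<not> in_upto_iso nnrat K (?X i) (S \<epsilon>)}"
  let ?Jt = "{j\<in>J. \<forall>\<epsilon>. 0 \<le> \<epsilon> \<and> \<epsilon> < t \<longrightarrow> \<not> in_upto_iso nnrat K (?Y j) (S \<epsilon>)}"
  have tame_summand: "tame K (summand b)" if "b \<in> I <+> J" for b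
    by (rule tame_cyclic[OF vf s_nonneg[OF that] x_closed[OF that] tame_F])
  have keepX: "(\<forall>\<epsilon>. 0 \<le> \<epsilon> \<and> \<epsilon> < t \<longrightarrow> cyclic K F (w i) (x (Inl i)) \<notin> S \<epsilon>) \<longleftrightarrow>
      (\<forall>\<epsilon>. 0 \<le> \<epsilon> \<and> \<epsilon> < t \<longrightarrow> \<not> in_upto_iso nnrat K (?X i) (S \<epsilon>))" if "i \<in> I" for i
    using in_upto_iso_iff[OF S _ isoX[OF that]] tame_summand[of "Inl i"] that by auto
  have keepY: "(\<forall>\<epsilon>. 0 \<le> \<epsilon> \<and> \<epsilon> < t \<longrightarrow> cyclic K F (v j) (x (Inr j)) \<notin> S \<epsilon>) \<longleftrightarrow>
      (\<forall>\<epsilon>. 0 \<le> \<epsilon> \<and> \<epsilon> < t \<longrightarrow> \<not> in_upto_iso nnrat K (?Y j) (S \<epsilon>))" if "j \<in> J" for j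
    using in_upto_iso_iff[OF S _ isoY[OF that]] tame_summand[of "Inr j"] that by auto
  have Plus_iff: "Inl i \<in> M <+> N \<longleftrightarrow> i \<in> M" "Inr j \<in> M <+> N \<longleftrightarrow> j \<in> N"
    for i :: 'i and j :: 'j and M N by auto
  have "{b \<in> I <+> J. ?keep b} = ?It <+> ?Jt"
  proof (rule Set.set_eqI)
    fix b show "b \<in> {b \<in> I <+> J. ?keep b} \<longleftrightarrow> b \<in> ?It <+> ?Jt"
      by (cases b) (simp_all only: mem_Collect_eq Plus_iff sum.case keepX keepY cong: conj_cong)
  qed
  hence "bar K S F t = card (?It <+> ?Jt)"
    using bar_eq_card[OF assms(2) S assms(4,12)] by simp
  also have "\<dots> = card ?It + card ?Jt" by (rule card_Plus) (use assms(7,8) in auto)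
  finally show ?thesis .
qed

end
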